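(* Let $\mathcal{T}$ be a triangulated category with a Serre functor $\mathbb{S}$, let $n\ge1$, put $\mathbb{S}_n=\mathbb{S}\circ[-n]$, and let $\mathcal{C}$ be an $n$-cluster tilting subcategory of $\mathcal{T}$. If $X\in\mathrm{ind}\,\mathcal{C}$ has no loops in $\mathcal{C}$, then $\mathrm{ind}\,\mathcal{C}-\{\mathbb{S}_n^\ell X\mid\ell\in\mathbb{Z}\}$ is contained in exactly $n$ $n$-cluster tilting subcategories of $\mathcal{T}$, namely $\mu_X^i(\mathcal{C})$ ($i\in\mathbb{Z}/n\mathbb{Z}$).
   Context: Conventions: $k$ is a fixed field; all additive categories are Krull-Schmidt; triangulated categories are $k$-linear with finite-dimensional Hom-spaces and shift $[1]$. A subcategory means a full subcategory closed under isomorphisms, direct sums and direct summands (not necessarily under $[1]$); $\mathrm{ind}\,\mathcal{C}$ is the set of isoclasses of indecomposable objects, $\mathrm{add}\,X$ the smallest subcategory containing $X$. $(X,Y)$ denotes the morphism space; $fg$ means first $f$, then $g$; $J_{\mathcal{C}}$ is the Jacobson radical. $\mathcal{X}^\perp=\{T\mid(\mathcal{X},T)=0\}$, ${}^\perp\mathcal{X}=\{T\mid (T,\mathcal{X})=0\}$. A Serre functor is a $k$-linear autofunctor $\mathbb{S}$ with functorial isomorphisms $(X,Y)\simeq D(Y,\mathbb{S}X)$, $D$ the $k$-dual. A morphism is right minimal if it has no direct summand of the form $T\to0$ with $T\ne0$; left minimal is dual. A right $\mathcal{C}$-approximation of $Y$ is $f:X\to Y$ with $X\in\mathcal{C}$ and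 $(-,X)\to(-,Y)$ surjective on $\mathcal{C}$; left approximations are dual; $\mathcal{C}$ is functorially finite if every object has both. A sink map of $Y\in\mathcal{C}$ in $\mathcal{C}$ is a right minimal $f:X\to Y$ in $J_{\mathcal{C}}$ with $(-,X)\to J_{\mathcal{C}}(-,Y)\to0$ exact on $\mathcal{C}$; source maps are dual. A functorially finite $\mathcal{C}$ is $n$-cluster tilting if $\mathcal{C}=\bigcap_{i=1}^{n-1}\mathcal{C}[-i]^\perp=\bigcap_{i=1}^{n-1}{}^\perp\mathcal{C}[i]$; then $\mathbb{S}_n\mathcal{C}=\mathcal{C}$. An $(n+2)$-angle is a complex $X_n\xrightarrow{b_n}C_{n-1}\xrightarrow{a_{n-1}b_{n-1}}\cdots\xrightarrow{a_1b_1}C_0\xrightarrow{a_0}X_0$ obtained by gluing triangles $X_{i+1}\xrightarrow{b_{i+1}}C_i\xrightarrow{a_i}X_i\to X_{i+1}[1]$, $0\le i<n$. It is an AR $(n+2)$-angle of $X_0$ in the $n$-cluster tilting $\mathcal{C}$ if $X_0,X_n$ and all $C_i$ lie in $\mathcal{C}$, $a_0$ is a sink map of $X_0$ in $\mathcal{C}$, $b_n$ is a source map of $X_n$ in $\mathcal{C}$, and for $0<i<n$, $a_i$ is a minimal right and $b_i$ a minimal left $\mathcal{C}$-approximation of $X_i$. For every $X\in\mathcal{C}$ such an angle with $X_0=X$ exists, is unique up to isomorphism, and has $X_n=\mathbb{S}_nX$. $X\in\mathrm{ind}\,\mathcal{C}$ has no loops in $\mathcal{C}$ if $\mathbb{S}_n^\ell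 X\notin\mathrm{add}\bigoplus_{i=0}^{n-1}C_i$ for all $\ell\in\mathbb{Z}$, with $C_i$ the terms of the AR $(n+2)$-angle of $X$. In this case, for $i\in\mathbb{Z}/n\mathbb{Z}$ (represented by $0\le i<n$), $\mu_X^i(\mathcal{C})$ is the subcategory with $\mathrm{ind}\,\mu_X^i(\mathcal{C})=(\mathrm{ind}\,\mathcal{C}-\{\mathbb{S}_n^\ell X\mid\ell\in\mathbb{Z}\})\coprod\{\mathbb{S}_n^\ell X_i\mid\ell\in\mathbb{Z}\}$, where $X_i$ is the $i$-th object in the triangles defining the AR $(n+2)$-angle of $X=X_0$. *)

theory Defs
  imports Complex_Main
begin

section \<open>Linear categories\<close>

text \<open>
  Morphisms of all hom-spaces live in one ambient \<open>'k\<close>-vector space \<open>'m\<close>, of which the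
  \<open>Hom T X Y\<close> are subspaces.  This is no restriction: take for \<open>'m\<close> the direct sum of all
  hom-spaces, with the induced composition.  Consequently all zero morphisms are \<open>0 :: 'm\<close>.
  Composition is written in diagrammatic order: \<open>f \<cdot>\<^bsub>T\<^esub> g\<close> is first \<open>f\<close>, then \<open>g\<close>.
\<close>

record ('k, 'o, 'm) lincat =
  Obj :: "'o set"
  Hom :: "'o \<Rightarrow> 'o \<Rightarrow> 'm set"
  cmp :: "'m \<Rightarrow> 'm \<Rightarrow> 'm"  (infixl "\<cdot>\<index>" 70)
  ident :: "'o \<Rightarrow> 'm"
  smul :: "'k \<Rightarrow> 'm \<Rightarrow> 'm"

locale linear_category =
  fixes T :: "('k::field, 'o, 'm::ab_group_add, 'z) lincat_scheme" (structure)
  assumes ambient: "vector_space (smul T)"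
    and Hom_subspace: "\<lbrakk>X \<in> Obj T; Y \<in> Obj T\<rbrakk> \<Longrightarrow> module.subspace (smul T) (Hom T X Y)"
    and ident_Hom: "X \<in> Obj T \<Longrightarrow> ident T X \<in> Hom T X X"
    and cmp_Hom: "\<lbrakk>X \<in> Obj T; Y \<in> Obj T; Z \<in> Obj T; f \<in> Hom T X Y; g \<in> Hom T Y Z\<rbrakk>
      \<Longrightarrow> f \<cdot> g \<in> Hom T X Z"
    and ident_cmp: "\<lbrakk>X \<in> Obj T; Y \<in> Obj T; f \<in> Hom T X Y\<rbrakk> \<Longrightarrow> ident T X \<cdot> f = f"
    and cmp_ident: "\<lbrakk>X \<in> Obj T; Y \<in> Obj T; f \<in> Hom T X Y\<rbrakk> \<Longrightarrow> f \<cdot> ident T Y = f"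
    and cmp_assoc: "\<lbrakk>W \<in> Obj T; X \<in> Obj T; Y \<in> Obj T; Z \<in> Obj T;
        f \<in> Hom T W X; g \<in> Hom T X Y; h \<in> Hom T Y Z\<rbrakk> \<Longrightarrow> (f \<cdot> g) \<cdot> h = f \<cdot> (g \<cdot> h)"
    and cmp_add_left: "\<lbrakk>X \<in> Obj T; Y \<in> Obj T; Z \<in> Obj T;
        f \<in> Hom T X Y; f' \<in> Hom T X Y; g \<in> Hom T Y Z\<rbrakk> \<Longrightarrow> (f + f') \<cdot> g = f \<cdot> g + f' \<cdot> g"
    and cmp_add_right: "\<lbrakk>X \<in> Obj T; Y \<in> Obj T; Z \<in> Obj T;
        f \<in> Hom T X Y; g \<in> Hom T Y Z; g' \<in> Hom T Y Z\<rbrakk> \<Longrightarrow> f \<cdot> (g + g') = f \<cdot> g + f \<cdot> g'"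
    and cmp_smul_left: "\<lbrakk>X \<in> Obj T; Y \<in> Obj T; Z \<in> Obj T; f \<in> Hom T X Y; g \<in> Hom T Y Z\<rbrakk>
      \<Longrightarrow> smul T c f \<cdot> g = smul T c (f \<cdot> g)"
    and cmp_smul_right: "\<lbrakk>X \<in> Obj T; Y \<in> Obj T; Z \<in> Obj T; f \<in> Hom T X Y; g \<in> Hom T Y Z\<rbrakk>
      \<Longrightarrow> f \<cdot> smul T c g = smul T c (f \<cdot> g)"

definition inverse_pair ::
    "('k, 'o, 'm, 'z) lincat_scheme \<Rightarrow> 'o \<Rightarrow> 'o \<Rightarrow> 'm \<Rightarrow> 'm \<Rightarrow> bool" where
  "inverse_pair T X Y f g \<longleftrightarrow> f \<in> Hom T X Y \<and> g \<in> Hom T Y X \<and>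
     f \<cdot>\<^bsub>T\<^esub> g = ident T X \<and> g \<cdot>\<^bsub>T\<^esub> f = ident T Y"

definition invertible :: "('k, 'o, 'm, 'z) lincat_scheme \<Rightarrow> 'o \<Rightarrow> 'o \<Rightarrow> 'm \<Rightarrow> bool" where
  "invertible T X Y f \<longleftrightarrow> (\<exists>g. inverse_pair T X Y f g)"

definition iso :: "('k, 'o, 'm, 'z) lincat_scheme \<Rightarrow> 'o \<Rightarrow> 'o \<Rightarrow> bool" where
  "iso T X Y \<longleftrightarrow> X \<in> Obj T \<and> Y \<in> Obj T \<and> (\<exists>f. invertible T X Y f)"

definition isoclass :: "('k, 'o, 'm, 'z) lincat_scheme \<Rightarrow> 'o \<Rightarrow> 'o set" where
  "isoclass T X = {Y. iso T X Y}"

definition zero_object :: "('k, 'o, 'm::ab_group_add, 'z) lincat_scheme \<Rightarrow> 'o \<Rightarrow> bool" where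
  "zero_object T X \<longleftrightarrow> X \<in> Obj T \<and> ident T X = 0"

text \<open>\<open>S\<close> is the direct sum of the list \<open>Xs\<close>, with injections \<open>\<iota> i\<close> and projections \<open>\<pi> i\<close>;
  direct sums of the empty list are zero objects.\<close>

definition direct_sum_via ::
    "('k, 'o, 'm::ab_group_add, 'z) lincat_scheme \<Rightarrow> 'o list \<Rightarrow> 'o \<Rightarrow> (nat \<Rightarrow> 'm) \<Rightarrow> (nat \<Rightarrow> 'm) \<Rightarrow> bool"
  where
  "direct_sum_via T Xs S \<iota> \<pi> \<longleftrightarrow> set Xs \<subseteq> Obj T \<and> S \<in> Obj T \<and>
     (\<forall>i<length Xs. \<iota> i \<in> Hom T (Xs ! i) S \<and> \<pi> i \<in> Hom T S (Xs ! i)) \<and>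
     (\<forall>i<length Xs. \<forall>j<length Xs. \<iota> i \<cdot>\<^bsub>T\<^esub> \<pi> j = (if i = j then ident T (Xs ! i) else 0)) \<and>
     (\<Sum>i<length Xs. \<pi> i \<cdot>\<^bsub>T\<^esub> \<iota> i) = ident T S"

definition direct_sum :: "('k, 'o, 'm::ab_group_add, 'z) lincat_scheme \<Rightarrow> 'o list \<Rightarrow> 'o \<Rightarrow> bool" where
  "direct_sum T Xs S \<longleftrightarrow> (\<exists>\<iota> \<pi>. direct_sum_via T Xs S \<iota> \<pi>)"

definition indecomposable :: "('k, 'o, 'm::ab_group_add, 'z) lincat_scheme \<Rightarrow> 'o \<Rightarrow> bool" where
  "indecomposable T X \<longleftrightarrow> X \<in> Obj T \<and> \<not> zero_object T X \<and>
     (\<forall>Y Z. direct_sum T [Y, Z] X \<longrightarrow> zero_object T Y \<or> zero_object T Z)"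

text \<open>The endomorphism ring of \<open>X\<close> is local: it is nonzero and the sum of two non-units is a non-unit.\<close>

definition local_end :: "('k, 'o, 'm::ab_group_add, 'z) lincat_scheme \<Rightarrow> 'o \<Rightarrow> bool" where
  "local_end T X \<longleftrightarrow> X \<in> Obj T \<and> ident T X \<noteq> 0 \<and>
     (\<forall>f\<in>Hom T X X. \<forall>g\<in>Hom T X X.
        invertible T X X (f + g) \<longrightarrow> invertible T X X f \<or> invertible T X X g)"

locale krull_schmidt_category = linear_category T
  for T :: "('k::field, 'o, 'm::ab_group_add, 'z) lincat_scheme" (structure) +
  assumes ex_direct_sum: "set Xs \<subseteq> Obj T \<Longrightarrow> \<exists>S. direct_sum T Xs S"
    and krull_schmidt: "X \<in> Obj T \<Longrightarrow> \<exists>Xs. direct_sum T Xs X \<and> (\<forall>Y\<in>set Xs. local_end T Y)"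

section \<open>Functors\<close>

record ('o, 'm) endofunctor =
  fobj :: "'o \<Rightarrow> 'o"
  fmor :: "'m \<Rightarrow> 'm"

definition linear_functor ::
    "('k, 'o, 'm::ab_group_add, 'z) lincat_scheme \<Rightarrow> ('o, 'm) endofunctor \<Rightarrow> bool" where
  "linear_functor T F \<longleftrightarrow>
     (\<forall>X\<in>Obj T. fobj F X \<in> Obj T \<and> fmor F (ident T X) = ident T (fobj F X)) \<and>
     (\<forall>X\<in>Obj T. \<forall>Y\<in>Obj T. \<forall>f\<in>Hom T X Y. fmor F f \<in> Hom T (fobj F X) (fobj F Y) \<and>
        (\<forall>g\<in>Hom T X Y. fmor F (f + g) = fmor F f + fmor F g) \<and>
        (\<forall>c. fmor F (smul T c f) = smul T c (fmor F f))) \<and>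
     (\<forall>X\<in>Obj T. \<forall>Y\<in>Obj T. \<forall>Z\<in>Obj T. \<forall>f\<in>Hom T X Y. \<forall>g\<in>Hom T Y Z.
        fmor F (f \<cdot>\<^bsub>T\<^esub> g) = fmor F f \<cdot>\<^bsub>T\<^esub> fmor F g)"

definition autoequivalence ::
    "('k, 'o, 'm::ab_group_add, 'z) lincat_scheme \<Rightarrow> ('o, 'm) endofunctor \<Rightarrow> bool" where
  "autoequivalence T F \<longleftrightarrow> linear_functor T F \<and>
     (\<forall>X\<in>Obj T. \<forall>Y\<in>Obj T. bij_betw (fmor F) (Hom T X Y) (Hom T (fobj F X) (fobj F Y))) \<and>
     (\<forall>Y\<in>Obj T. \<exists>X\<in>Obj T. iso T (fobj F X) Y)"

text \<open>
  Integer powers, on objects, of an autoequivalence with object map \<open>F\<close>.  Negative powers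
  are powers of a quasi-inverse, whose values are chosen arbitrarily in the right isomorphism
  class; only isomorphism-invariant properties of them are used.
\<close>

definition quasi_inverse :: "('k, 'o, 'm, 'z) lincat_scheme \<Rightarrow> ('o \<Rightarrow> 'o) \<Rightarrow> 'o \<Rightarrow> 'o" where
  "quasi_inverse T F Y = (SOME X. X \<in> Obj T \<and> iso T (F X) Y)"

definition int_power :: "('k, 'o, 'm, 'z) lincat_scheme \<Rightarrow> ('o \<Rightarrow> 'o) \<Rightarrow> int \<Rightarrow> 'o \<Rightarrow> 'o" where
  "int_power T F l = (if l \<ge> 0 then F ^^ nat l else quasi_inverse T F ^^ nat (- l))"

section \<open>Triangulated categories and Serre functors\<close>

text \<open>\<open>Tri T X Y Z u v w\<close> says that \<open>X \<rightarrow> Y \<rightarrow> Z \<rightarrow> X[1]\<close> (with maps \<open>u, v, w\<close>) is a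
  distinguished triangle.\<close>

record ('k, 'o, 'm) tricat = "('k, 'o, 'm) lincat" +
  Shift :: "('o, 'm) endofunctor"
  Tri :: "'o \<Rightarrow> 'o \<Rightarrow> 'o \<Rightarrow> 'm \<Rightarrow> 'm \<Rightarrow> 'm \<Rightarrow> bool"

text \<open>The standing conventions are part of the definition: Krull-Schmidt, \<open>k\<close>-linear, with
  finite-dimensional hom-spaces.\<close>

locale triangulated_category = krull_schmidt_category T
  for T :: "('k::field, 'o, 'm::ab_group_add, 'z) tricat_scheme" (structure) +
  assumes Hom_finite_dim: "\<lbrakk>X \<in> Obj T; Y \<in> Obj T\<rbrakk>
      \<Longrightarrow> \<exists>B. finite B \<and> Hom T X Y = module.span (smul T) B"
    and Shift_autoequivalence: "autoequivalence T (Shift T)"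
    and Tri_typed: "Tri T X Y Z u v w \<Longrightarrow> X \<in> Obj T \<and> Y \<in> Obj T \<and> Z \<in> Obj T \<and>
      u \<in> Hom T X Y \<and> v \<in> Hom T Y Z \<and> w \<in> Hom T Z (fobj (Shift T) X)"
    and Tri_iso: "\<lbrakk>Tri T X Y Z u v w; X' \<in> Obj T; Y' \<in> Obj T; Z' \<in> Obj T;
        u' \<in> Hom T X' Y'; v' \<in> Hom T Y' Z'; w' \<in> Hom T Z' (fobj (Shift T) X');
        invertible T X X' f; invertible T Y Y' g; invertible T Z Z' h;
        u \<cdot> g = f \<cdot> u'; v \<cdot> h = g \<cdot> v'; w \<cdot> fmor (Shift T) f = h \<cdot> w'\<rbrakk>
      \<Longrightarrow> Tri T X' Y' Z' u' v' w'"
    and Tri_ident: "\<lbrakk>X \<in> Obj T; zero_object T Z\<rbrakk> \<Longrightarrow> Tri T X X Z (ident T X) 0 0"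
    and Tri_cone: "\<lbrakk>X \<in> Obj T; Y \<in> Obj T; u \<in> Hom T X Y\<rbrakk> \<Longrightarrow> \<exists>Z v w. Tri T X Y Z u v w"
    and Tri_rotate: "\<lbrakk>X \<in> Obj T; Y \<in> Obj T; Z \<in> Obj T;
        u \<in> Hom T X Y; v \<in> Hom T Y Z; w \<in> Hom T Z (fobj (Shift T) X)\<rbrakk>
      \<Longrightarrow> Tri T X Y Z u v w \<longleftrightarrow> Tri T Y Z (fobj (Shift T) X) v w (- fmor (Shift T) u)"
    and Tri_morphism: "\<lbrakk>Tri T X Y Z u v w; Tri T X' Y' Z' u' v' w';
        f \<in> Hom T X X'; g \<in> Hom T Y Y'; u \<cdot> g = f \<cdot> u'\<rbrakk>
      \<Longrightarrow> \<exists>h\<in>Hom T Z Z'. v \<cdot> h = g \<cdot> v' \<and> w \<cdot> fmor (Shift T) f = h \<cdot> w'"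
    and Tri_octahedral: "\<lbrakk>Tri T X Y Z' f f' f''; Tri T Y Z X' g g' g''; Tri T X Z Y' (f \<cdot> g) h' h''\<rbrakk>
      \<Longrightarrow> \<exists>u v. Tri T Z' Y' X' u v (g'' \<cdot> fmor (Shift T) f') \<and>
            f' \<cdot> u = g \<cdot> h' \<and> h' \<cdot> v = g' \<and> u \<cdot> h'' = f'' \<and> v \<cdot> g'' = h'' \<cdot> fmor (Shift T) f"

definition shift :: "('k, 'o, 'm, 'z) tricat_scheme \<Rightarrow> int \<Rightarrow> 'o \<Rightarrow> 'o" where
  "shift T = int_power T (fobj (Shift T))"

text \<open>The dual of a subspace \<open>V\<close> of the ambient space, as functions vanishing outside \<open>V\<close>.\<close>

definition dual_space ::
    "('k::field, 'o, 'm::ab_group_add, 'z) lincat_scheme \<Rightarrow> 'm set \<Rightarrow> ('m \<Rightarrow> 'k) set" where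
  "dual_space T V = {\<phi>. (\<forall>f\<in>V. \<forall>g\<in>V. \<phi> (f + g) = \<phi> f + \<phi> g) \<and>
     (\<forall>c. \<forall>f\<in>V. \<phi> (smul T c f) = c * \<phi> f) \<and> (\<forall>f. f \<notin> V \<longrightarrow> \<phi> f = 0)}"

text \<open>\<open>\<eta> X Y\<close> is the isomorphism \<open>(X, Y) \<simeq> D(Y, \<SS>X)\<close>; the last conjunct is its naturality in
  both variables.\<close>

definition serre_functor ::
    "('k::field, 'o, 'm::ab_group_add, 'z) lincat_scheme \<Rightarrow> ('o, 'm) endofunctor \<Rightarrow> bool" where
  "serre_functor T S \<longleftrightarrow> autoequivalence T S \<and>
     (\<exists>\<eta>. (\<forall>X\<in>Obj T. \<forall>Y\<in>Obj T.
            bij_betw (\<eta> X Y) (Hom T X Y) (dual_space T (Hom T Y (fobj S X))) \<and>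
            (\<forall>f\<in>Hom T X Y. \<forall>g\<in>Hom T Y (fobj S X).
               (\<forall>f'\<in>Hom T X Y. \<eta> X Y (f + f') g = \<eta> X Y f g + \<eta> X Y f' g) \<and>
               (\<forall>c. \<eta> X Y (smul T c f) g = c * \<eta> X Y f g))) \<and>
          (\<forall>X\<in>Obj T. \<forall>X'\<in>Obj T. \<forall>Y\<in>Obj T. \<forall>Y'\<in>Obj T.
            \<forall>a\<in>Hom T X' X. \<forall>f\<in>Hom T X Y. \<forall>b\<in>Hom T Y Y'. \<forall>g\<in>Hom T Y' (fobj S X').
              \<eta> X' Y' (a \<cdot>\<^bsub>T\<^esub> f \<cdot>\<^bsub>T\<^esub> b) g = \<eta> X Y f (b \<cdot>\<^bsub>T\<^esub> g \<cdot>\<^bsub>T\<^esub> fmor S a)))"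

text \<open>The object map of \<open>\<SS>\<^sub>n = \<SS> \<circ> [-n]\<close>, and the set of isoclasses of the \<open>\<SS>\<^sub>n\<^sup>l X\<close>, \<open>l \<in> \<int>\<close>.\<close>

definition serre_n ::
    "('k, 'o, 'm, 'z) tricat_scheme \<Rightarrow> ('o, 'm) endofunctor \<Rightarrow> nat \<Rightarrow> 'o \<Rightarrow> 'o" where
  "serre_n T S n X = fobj S (shift T (- int n) X)"

definition serre_orbit ::
    "('k, 'o, 'm, 'z) tricat_scheme \<Rightarrow> ('o, 'm) endofunctor \<Rightarrow> nat \<Rightarrow> 'o \<Rightarrow> 'o set set" where
  "serre_orbit T S n X = {isoclass T (int_power T (serre_n T S n) l X) | l. True}"

section \<open>Subcategories and approximations\<close>

text \<open>Subcategories are full, hence given by their sets of objects.\<close>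

definition subcategory :: "('k, 'o, 'm::ab_group_add, 'z) lincat_scheme \<Rightarrow> 'o set \<Rightarrow> bool" where
  "subcategory T C \<longleftrightarrow> C \<subseteq> Obj T \<and>
     (\<forall>X\<in>C. \<forall>Y. iso T X Y \<longrightarrow> Y \<in> C) \<and>
     (\<forall>Xs S. set Xs \<subseteq> C \<and> direct_sum T Xs S \<longrightarrow> S \<in> C) \<and>
     (\<forall>X Y S. S \<in> C \<and> direct_sum T [X, Y] S \<longrightarrow> X \<in> C)"

definition add :: "('k, 'o, 'm::ab_group_add, 'z) lincat_scheme \<Rightarrow> 'o \<Rightarrow> 'o set" where
  "add T X = \<Inter> {C. subcategory T C \<and> X \<in> C}"

definition ind :: "('k, 'o, 'm::ab_group_add, 'z) lincat_scheme \<Rightarrow> 'o set \<Rightarrow> 'o set set" where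
  "ind T C = isoclass T ` {X \<in> C. indecomposable T X}"

definition right_perp :: "('k, 'o, 'm::ab_group_add, 'z) lincat_scheme \<Rightarrow> 'o set \<Rightarrow> 'o set" where
  "right_perp T U = {Y \<in> Obj T. \<forall>X\<in>U. Hom T X Y = {0}}"

definition left_perp :: "('k, 'o, 'm::ab_group_add, 'z) lincat_scheme \<Rightarrow> 'o set \<Rightarrow> 'o set" where
  "left_perp T U = {Y \<in> Obj T. \<forall>X\<in>U. Hom T Y X = {0}}"

definition radical :: "('k, 'o, 'm::ab_group_add, 'z) lincat_scheme \<Rightarrow> 'o \<Rightarrow> 'o \<Rightarrow> 'm set" where
  "radical T X Y = {f \<in> Hom T X Y. \<forall>g\<in>Hom T Y X. invertible T X X (ident T X - f \<cdot>\<^bsub>T\<^esub> g)}"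

text \<open>The complex \<open>A \<rightarrow> 0\<close> is a direct summand of \<open>f : X \<rightarrow> Y\<close> iff \<open>X = A \<oplus> B\<close> with \<open>f\<close>
  vanishing on \<open>A\<close>; dually for \<open>0 \<rightarrow> A\<close>.\<close>

definition right_minimal :: "('k, 'o, 'm::ab_group_add, 'z) lincat_scheme \<Rightarrow> 'o \<Rightarrow> 'o \<Rightarrow> 'm \<Rightarrow> bool" where
  "right_minimal T X Y f \<longleftrightarrow> f \<in> Hom T X Y \<and>
     \<not> (\<exists>A B \<iota> \<pi>. \<not> zero_object T A \<and> direct_sum_via T [A, B] X \<iota> \<pi> \<and> \<iota> 0 \<cdot>\<^bsub>T\<^esub> f = 0)"

definition left_minimal :: "('k, 'o, 'm::ab_group_add, 'z) lincat_scheme \<Rightarrow> 'o \<Rightarrow> 'o \<Rightarrow> 'm \<Rightarrow> bool" where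
  "left_minimal T X Y f \<longleftrightarrow> f \<in> Hom T X Y \<and>
     \<not> (\<exists>A B \<iota> \<pi>. \<not> zero_object T A \<and> direct_sum_via T [A, B] Y \<iota> \<pi> \<and> f \<cdot>\<^bsub>T\<^esub> \<pi> 0 = 0)"

definition right_approximation ::
    "('k, 'o, 'm, 'z) lincat_scheme \<Rightarrow> 'o set \<Rightarrow> 'o \<Rightarrow> 'o \<Rightarrow> 'm \<Rightarrow> bool" where
  "right_approximation T C X Y f \<longleftrightarrow> X \<in> C \<and> f \<in> Hom T X Y \<and>
     (\<forall>Z\<in>C. (\<lambda>h. h \<cdot>\<^bsub>T\<^esub> f) ` Hom T Z X = Hom T Z Y)"

definition left_approximation ::
    "('k, 'o, 'm, 'z) lincat_scheme \<Rightarrow> 'o set \<Rightarrow> 'o \<Rightarrow> 'o \<Rightarrow> 'm \<Rightarrow> bool" where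
  "left_approximation T C X Y f \<longleftrightarrow> Y \<in> C \<and> f \<in> Hom T X Y \<and>
     (\<forall>Z\<in>C. (\<lambda>h. f \<cdot>\<^bsub>T\<^esub> h) ` Hom T Y Z = Hom T X Z)"

definition functorially_finite :: "('k, 'o, 'm, 'z) lincat_scheme \<Rightarrow> 'o set \<Rightarrow> bool" where
  "functorially_finite T C \<longleftrightarrow> (\<forall>Y\<in>Obj T.
     (\<exists>X f. right_approximation T C X Y f) \<and> (\<exists>X f. left_approximation T C Y X f))"

definition sink_map ::
    "('k, 'o, 'm::ab_group_add, 'z) lincat_scheme \<Rightarrow> 'o set \<Rightarrow> 'o \<Rightarrow> 'o \<Rightarrow> 'm \<Rightarrow> bool" where
  "sink_map T C X Y f \<longleftrightarrow> X \<in> C \<and> Y \<in> C \<and> right_minimal T X Y f \<and> f \<in> radical T X Y \<and>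
     (\<forall>Z\<in>C. (\<lambda>h. h \<cdot>\<^bsub>T\<^esub> f) ` Hom T Z X = radical T Z Y)"

definition source_map ::
    "('k, 'o, 'm::ab_group_add, 'z) lincat_scheme \<Rightarrow> 'o set \<Rightarrow> 'o \<Rightarrow> 'o \<Rightarrow> 'm \<Rightarrow> bool" where
  "source_map T C X Y f \<longleftrightarrow> X \<in> C \<and> Y \<in> C \<and> left_minimal T X Y f \<and> f \<in> radical T X Y \<and>
     (\<forall>Z\<in>C. (\<lambda>h. f \<cdot>\<^bsub>T\<^esub> h) ` Hom T Y Z = radical T X Z)"

section \<open>Cluster tilting and mutation\<close>

text \<open>For \<open>n = 1\<close> the intersections are empty, i.e. all of \<open>Obj T\<close>.\<close>

definition n_cluster_tilting ::
    "('k, 'o, 'm::ab_group_add, 'z) tricat_scheme \<Rightarrow> nat \<Rightarrow> 'o set \<Rightarrow> bool" where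
  "n_cluster_tilting T n C \<longleftrightarrow> subcategory T C \<and> functorially_finite T C \<and>
     C = Obj T \<inter> (\<Inter>i\<in>{1..<n}. right_perp T (shift T (- int i) ` C)) \<and>
     C = Obj T \<inter> (\<Inter>i\<in>{1..<n}. left_perp T (shift T (int i) ` C))"

text \<open>The \<open>(n+2)\<close>-angle is given by its triangles
  \<open>X\<^sub>i\<^sub>+\<^sub>1 \<rightarrow> C\<^sub>i \<rightarrow> X\<^sub>i \<rightarrow> X\<^sub>i\<^sub>+\<^sub>1[1]\<close> (with first two maps \<open>b\<^sub>i\<^sub>+\<^sub>1\<close> and \<open>a\<^sub>i\<close>), \<open>0 \<le> i < n\<close>;
  values of \<open>Xs, Cs, a, b\<close> at other indices are irrelevant.\<close>

definition angle ::
    "('k, 'o, 'm, 'z) tricat_scheme \<Rightarrow> nat \<Rightarrow> (nat \<Rightarrow> 'o) \<Rightarrow> (nat \<Rightarrow> 'o) \<Rightarrow> (nat \<Rightarrow> 'm) \<Rightarrow> (nat \<Rightarrow> 'm) \<Rightarrow> bool"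
  where
  "angle T n Xs Cs a b \<longleftrightarrow>
     (\<forall>i<n. \<exists>w. Tri T (Xs (Suc i)) (Cs i) (Xs i) (b (Suc i)) (a i) w)"

definition AR_angle ::
    "('k, 'o, 'm::ab_group_add, 'z) tricat_scheme \<Rightarrow> nat \<Rightarrow> 'o set \<Rightarrow> 'o \<Rightarrow>
      (nat \<Rightarrow> 'o) \<Rightarrow> (nat \<Rightarrow> 'o) \<Rightarrow> (nat \<Rightarrow> 'm) \<Rightarrow> (nat \<Rightarrow> 'm) \<Rightarrow> bool" where
  "AR_angle T n C X Xs Cs a b \<longleftrightarrow> angle T n Xs Cs a b \<and> Xs 0 = X \<and>
     Xs 0 \<in> C \<and> Xs n \<in> C \<and> (\<forall>i<n. Cs i \<in> C) \<and>
     sink_map T C (Cs 0) (Xs 0) (a 0) \<and>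
     source_map T C (Xs n) (Cs (n - 1)) (b n) \<and>
     (\<forall>i. 0 < i \<and> i < n \<longrightarrow>
        right_minimal T (Cs i) (Xs i) (a i) \<and> right_approximation T C (Cs i) (Xs i) (a i) \<and>
        left_minimal T (Xs i) (Cs (i - 1)) (b i) \<and> left_approximation T C (Xs i) (Cs (i - 1)) (b i))"

definition no_loops ::
    "('k, 'o, 'm::ab_group_add, 'z) tricat_scheme \<Rightarrow> ('o, 'm) endofunctor \<Rightarrow> nat \<Rightarrow> 'o set \<Rightarrow> 'o \<Rightarrow> bool"
  where
  "no_loops T S n C X \<longleftrightarrow> (\<exists>Xs Cs a b. AR_angle T n C X Xs Cs a b \<and>
     (\<forall>E l. direct_sum T (map Cs [0..<n]) E \<longrightarrow> int_power T (serre_n T S n) l X \<notin> add T E))"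

text \<open>\<open>mutation T S n C X i\<close> is \<open>\<mu>\<^sub>X\<^sup>i(C)\<close> for \<open>0 \<le> i < n\<close>.  A subcategory of a Krull-Schmidt
  category is determined by its indecomposables, and \<open>X\<^sub>i\<close> is unique up to isomorphism.\<close>

definition is_mutation ::
    "('k, 'o, 'm::ab_group_add, 'z) tricat_scheme \<Rightarrow> ('o, 'm) endofunctor \<Rightarrow> nat \<Rightarrow> 'o set \<Rightarrow> 'o \<Rightarrow> nat \<Rightarrow>
      'o set \<Rightarrow> bool" where
  "is_mutation T S n C X i D \<longleftrightarrow> subcategory T D \<and> (\<exists>Xs Cs a b. AR_angle T n C X Xs Cs a b \<and>
     (ind T C - serre_orbit T S n X) \<inter> serre_orbit T S n (Xs i) = {} \<and>
     ind T D = (ind T C - serre_orbit T S n X) \<union> serre_orbit T S n (Xs i))"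

definition mutation ::
    "('k, 'o, 'm::ab_group_add, 'z) tricat_scheme \<Rightarrow> ('o, 'm) endofunctor \<Rightarrow> nat \<Rightarrow> 'o set \<Rightarrow> 'o \<Rightarrow> nat \<Rightarrow>
      'o set" where
  "mutation T S n C X i = (THE D. is_mutation T S n C X i D)"

end

theory Submission
  imports Defs
begin

text \<open>
  Let \<open>D\<close> consist of the objects of \<open>C\<close> without summands in the orbit of \<open>X\<close>, and call \<open>Y\<close>
  orthogonal if there are no nonzero maps from \<open>D\<close> to \<open>Y[j]\<close> for \<open>0 < j < n\<close>. Since all \<open>C\<^sub>i\<close>
  lie in \<open>D\<close>, modulo maps factoring through \<open>D\<close> the object \<open>X\<^sub>i\<close> behaves like \<open>X[-i]\<close>, and the
  endomorphisms of \<open>X\<^sub>i\<close> form a division ring. An orthogonal indecomposable \<open>Y\<close> outside of \<open>C\<close>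
  receives a nonzero map \<open>\<SS>\<^sub>n\<^sup>l X \<rightarrow> Y[j]\<close> with \<open>0 < j < n\<close>; it yields a map \<open>\<SS>\<^sub>n\<^sup>l X\<^sub>j \<rightarrow> Y\<close>, Serre
  duality yields a map back whose composite with it is invertible, and hence \<open>Y \<cong> \<SS>\<^sub>n\<^sup>l X\<^sub>j\<close>. So a
  cluster tilting subcategory containing \<open>D\<close> consists of \<open>D\<close> and orbits of objects \<open>X\<^sub>i\<close>, and only
  one orbit can occur, because \<open>X\<^sub>i \<rightarrow> X\<^sub>m[m-i]\<close> is nonzero for \<open>i < m\<close>.

  Conversely \<open>D\<close> with the orbit of \<open>X\<^sub>i\<close> is rigid, and it is maximal by the same classification.
  It has right approximations because \<open>D\<close> does and because only finitely many \<open>\<SS>\<^sub>n\<^sup>l X\<^sub>i\<close> have a map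
  to a given object \<open>W\<close> that does not factor through \<open>D\<close>: by filtering \<open>W\<close> with layers in
  \<open>C\<close>, \<open>C[1]\<close>, \<open>\<dots>\<close>, \<open>C[n-1]\<close> this reduces to \<open>W\<close> in some \<open>C[m]\<close>.
\<close>

subsection \<open>Morphisms in linear categories\<close>

text \<open>Serre duality pairs (A, Y[j]) with (Y, B[n-j]), where B is the
  \<open>\<SS>\<^sub>n\<close>-translate of A. Statements about maps out of Y thus follow from
  statements about maps into Y as long as every family is stable under \<open>\<SS>\<^sub>n\<close>;
  this is why whole orbits are exchanged.

  The Serre functor and the shift come without a chosen isomorphism between their composites.
  Translates are therefore compared through vanishing of Hom-spaces: applying duality twice shows
  that translation by \<open>\<SS>\<^sub>n\<close> preserves the vanishing of (A, B[j]) for j up to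
  n.

  Locality of the endomorphism ring of X_i is inherited from X: minimality makes an endomorphism of
  a triangle of the angle invertible as soon as one outer component is.

  The delicate point of rigidity is j = n - i. Moving X_i along the angle towards X_n then ends at
  unshifted maps X_n -> Y, Y a translate of X_i, which need not vanish. Such a map lifts through the
  translate of a_i to an object of D, and the absence of loops lets it factor through the source map
  b_n, which the connecting map kills.

  The orbit of X_i may be infinite, so right approximations by the new subcategory cannot simply sum
  over it.\<close>

context linear_category
begin

text \<open>Bundling membership of source and target lets each category axiom be applied by giving
  it only the typed morphisms.\<close>

definition arr :: "'o \<Rightarrow> 'o \<Rightarrow> 'm \<Rightarrow> bool" where
  "arr X Y f \<longleftrightarrow> X \<in> Obj T \<and> Y \<in> Obj T \<and> f \<in> Hom T X Y"

abbreviation idm :: "'o \<Rightarrow> 'm" where "idm X \<equiv> ident T X"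

definition hom0 :: "'o \<Rightarrow> 'o \<Rightarrow> bool" where
  "hom0 X Y \<longleftrightarrow> (\<forall>f. arr X Y f \<longrightarrow> f = 0)"

definition inv_arr :: "'o \<Rightarrow> 'o \<Rightarrow> 'm \<Rightarrow> bool" where
  "inv_arr X Y f \<longleftrightarrow> (\<exists>g. arr X Y f \<and> arr Y X g \<and> f \<cdot> g = idm X \<and> g \<cdot> f = idm Y)"

text \<open>Summands without a chosen complement; in the triangulated setting
  \<open>complement\<close> supplies one. Retracts compose and pass through equivalences by short
  computations.\<close>

definition retract :: "'o \<Rightarrow> 'o \<Rightarrow> bool" where
  "retract A X \<longleftrightarrow> (\<exists>s t. arr A X s \<and> arr X A t \<and> s \<cdot> t = idm A)"

definition rad :: "'o \<Rightarrow> 'o \<Rightarrow> 'm \<Rightarrow> bool" where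
  "rad X Y f \<longleftrightarrow> arr X Y f \<and> (\<forall>g. arr Y X g \<longrightarrow> inv_arr X X (idm X - f \<cdot> g))"

lemma arrD: "arr X Y f \<Longrightarrow> X \<in> Obj T" "arr X Y f \<Longrightarrow> Y \<in> Obj T" "arr X Y f \<Longrightarrow> f \<in> Hom T X Y"
  by (auto simp: arr_def)

lemma arr_id [intro, simp]: "X \<in> Obj T \<Longrightarrow> arr X X (idm X)"
  by (simp add: arr_def ident_Hom)

lemma arr_cmp [intro]: "arr X Y f \<Longrightarrow> arr Y Z g \<Longrightarrow> arr X Z (f \<cdot> g)"
  by (auto simp: arr_def intro: cmp_Hom)

lemma
  assumes "X \<in> Obj T" "Y \<in> Obj T"
  shows zero_Hom: "0 \<in> Hom T X Y"
    and add_Hom: "f \<in> Hom T X Y \<Longrightarrow> g \<in> Hom T X Y \<Longrightarrow> f + g \<in> Hom T X Y"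
    and smul_Hom: "f \<in> Hom T X Y \<Longrightarrow> smul T c f \<in> Hom T X Y"
    and uminus_Hom: "f \<in> Hom T X Y \<Longrightarrow> - f \<in> Hom T X Y"
    and diff_Hom: "f \<in> Hom T X Y \<Longrightarrow> g \<in> Hom T X Y \<Longrightarrow> f - g \<in> Hom T X Y"
proof -
  interpret vector_space "smul T" by (rule ambient)
  have s: "subspace (Hom T X Y)" using Hom_subspace assms by blast
  show "0 \<in> Hom T X Y"
    "f \<in> Hom T X Y \<Longrightarrow> g \<in> Hom T X Y \<Longrightarrow> f + g \<in> Hom T X Y"
    "f \<in> Hom T X Y \<Longrightarrow> smul T c f \<in> Hom T X Y"
    "f \<in> Hom T X Y \<Longrightarrow> - f \<in> Hom T X Y"
    "f \<in> Hom T X Y \<Longrightarrow> g \<in> Hom T X Y \<Longrightarrow> f - g \<in> Hom T X Y"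
    using subspace_0[OF s] subspace_add[OF s] subspace_scale[OF s] subspace_neg[OF s]
      subspace_diff[OF s] by auto
qed

lemma arr_zero [intro, simp]: "X \<in> Obj T \<Longrightarrow> Y \<in> Obj T \<Longrightarrow> arr X Y 0"
  by (simp add: arr_def zero_Hom)
lemma arr_add [intro]: "arr X Y f \<Longrightarrow> arr X Y g \<Longrightarrow> arr X Y (f + g)"
  by (auto simp: arr_def add_Hom)
lemma arr_uminus [intro]: "arr X Y f \<Longrightarrow> arr X Y (- f)"
  by (auto simp: arr_def uminus_Hom)
lemma arr_diff [intro]: "arr X Y f \<Longrightarrow> arr X Y g \<Longrightarrow> arr X Y (f - g)"
  by (auto simp: arr_def diff_Hom)
lemma arr_smul [intro]: "arr X Y f \<Longrightarrow> arr X Y (smul T c f)"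
  by (auto simp: arr_def smul_Hom)
lemma arr_sum: "X \<in> Obj T \<Longrightarrow> Y \<in> Obj T \<Longrightarrow> (\<And>i. i \<in> I \<Longrightarrow> arr X Y (f i)) \<Longrightarrow> arr X Y (\<Sum>i\<in>I. f i)"
  by (induct I rule: infinite_finite_induct) auto

lemma assoc: "arr W X f \<Longrightarrow> arr X Y g \<Longrightarrow> arr Y Z h \<Longrightarrow> (f \<cdot> g) \<cdot> h = f \<cdot> (g \<cdot> h)"
  by (auto simp: arr_def intro: cmp_assoc)
lemma id_left: "arr X Y f \<Longrightarrow> idm X \<cdot> f = f"
  by (auto simp: arr_def intro: ident_cmp)
lemma id_right: "arr X Y f \<Longrightarrow> f \<cdot> idm Y = f"
  by (auto simp: arr_def intro: cmp_ident)
lemma add_cmp: "arr X Y f \<Longrightarrow> arr X Y f' \<Longrightarrow> arr Y Z g \<Longrightarrow> (f + f') \<cdot> g = f \<cdot> g + f' \<cdot> g"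
  by (auto simp: arr_def intro: cmp_add_left)
lemma cmp_add: "arr X Y f \<Longrightarrow> arr Y Z g \<Longrightarrow> arr Y Z g' \<Longrightarrow> f \<cdot> (g + g') = f \<cdot> g + f \<cdot> g'"
  by (auto simp: arr_def intro: cmp_add_right)
lemma smul_cmp: "arr X Y f \<Longrightarrow> arr Y Z g \<Longrightarrow> smul T c f \<cdot> g = smul T c (f \<cdot> g)"
  by (auto simp: arr_def intro: cmp_smul_left)

lemma zero_cmp: "X \<in> Obj T \<Longrightarrow> arr Y Z g \<Longrightarrow> 0 \<cdot> g = 0"
proof -
  assume "X \<in> Obj T" "arr Y Z g"
  hence "(0 + 0) \<cdot> g = 0 \<cdot> g + 0 \<cdot> g" by (intro add_cmp) (auto dest: arrD)
  thus "0 \<cdot> g = 0" by simp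
qed
lemma cmp_zero: "Z \<in> Obj T \<Longrightarrow> arr X Y f \<Longrightarrow> f \<cdot> 0 = 0"
proof -
  assume "Z \<in> Obj T" "arr X Y f"
  hence "f \<cdot> (0 + 0) = f \<cdot> 0 + f \<cdot> 0" by (intro cmp_add) (auto dest: arrD)
  thus "f \<cdot> 0 = 0" by simp
qed
lemma zero_cmp' [simp]: "arr Y Z g \<Longrightarrow> 0 \<cdot> g = 0" by (rule zero_cmp) (auto dest: arrD)
lemma cmp_zero' [simp]: "arr X Y f \<Longrightarrow> f \<cdot> 0 = 0" by (rule cmp_zero) (auto dest: arrD)

lemma uminus_cmp: "arr X Y f \<Longrightarrow> arr Y Z g \<Longrightarrow> (- f) \<cdot> g = - (f \<cdot> g)"
  using add_cmp[of X Y f "- f" Z g] by (simp add: arr_uminus add_eq_0_iff)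
lemma cmp_uminus: "arr X Y f \<Longrightarrow> arr Y Z g \<Longrightarrow> f \<cdot> (- g) = - (f \<cdot> g)"
  using cmp_add[of X Y f Z g "- g"] by (simp add: arr_uminus add_eq_0_iff)
lemma diff_cmp: "arr X Y f \<Longrightarrow> arr X Y f' \<Longrightarrow> arr Y Z g \<Longrightarrow> (f - f') \<cdot> g = f \<cdot> g - f' \<cdot> g"
  using add_cmp[of X Y f "- f'" Z g] by (simp add: arr_uminus uminus_cmp)
lemma cmp_diff: "arr X Y f \<Longrightarrow> arr Y Z g \<Longrightarrow> arr Y Z g' \<Longrightarrow> f \<cdot> (g - g') = f \<cdot> g - f \<cdot> g'"
  using cmp_add[of X Y f Z g "- g'"] by (simp add: arr_uminus cmp_uminus)

lemma sum_cmp: "(\<And>i. i \<in> I \<Longrightarrow> arr X Y (f i)) \<Longrightarrow> arr Y Z g \<Longrightarrow> X \<in> Obj T \<Longrightarrow>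
    (\<Sum>i\<in>I. f i) \<cdot> g = (\<Sum>i\<in>I. f i \<cdot> g)"
proof (induct I rule: infinite_finite_induct)
  case (insert i I)
  have "(f i + sum f I) \<cdot> g = f i \<cdot> g + sum f I \<cdot> g"
    by (rule add_cmp[of X Y]) (use insert in \<open>auto intro!: arr_sum dest: arrD\<close>)
  thus ?case using insert by simp
qed simp_all
lemma cmp_sum: "(\<And>i. i \<in> I \<Longrightarrow> arr Y Z (f i)) \<Longrightarrow> arr X Y g \<Longrightarrow> Z \<in> Obj T \<Longrightarrow>
    g \<cdot> (\<Sum>i\<in>I. f i) = (\<Sum>i\<in>I. g \<cdot> f i)"
proof (induct I rule: infinite_finite_induct)
  case (insert i I)
  have "g \<cdot> (f i + sum f I) = g \<cdot> f i + g \<cdot> sum f I"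
    by (rule cmp_add[of X Y _ Z]) (use insert in \<open>auto intro!: arr_sum dest: arrD\<close>)
  thus ?case using insert by simp
qed simp_all

section \<open>Vanishing Hom-spaces and isomorphisms\<close>

lemma hom0_iff: "X \<in> Obj T \<Longrightarrow> Y \<in> Obj T \<Longrightarrow> Hom T X Y = {0} \<longleftrightarrow> hom0 X Y"
  using zero_Hom[of X Y] by (auto simp: hom0_def arr_def)

lemma inv_arr_iff: "X \<in> Obj T \<Longrightarrow> Y \<in> Obj T \<Longrightarrow> invertible T X Y f \<longleftrightarrow> inv_arr X Y f"
  by (auto simp: invertible_def inverse_pair_def inv_arr_def arr_def)

lemma inv_arr_arr: "inv_arr X Y f \<Longrightarrow> arr X Y f" by (auto simp: inv_arr_def)

lemma iso_iff: "iso T X Y \<longleftrightarrow> (\<exists>f. inv_arr X Y f)"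
  by (auto simp: iso_def inv_arr_iff dest: inv_arr_arr arrD) (metis inv_arr_iff inv_arr_arr arrD(1,2))

lemma isoE:
  assumes "iso T X Y"
  obtains f g where "arr X Y f" "arr Y X g" "f \<cdot> g = idm X" "g \<cdot> f = idm Y"
  using assms by (auto simp: iso_iff inv_arr_def)

lemma isoI: "arr X Y f \<Longrightarrow> arr Y X g \<Longrightarrow> f \<cdot> g = idm X \<Longrightarrow> g \<cdot> f = idm Y \<Longrightarrow> iso T X Y"
  by (auto simp: iso_iff inv_arr_def)

lemma inv_id: "X \<in> Obj T \<Longrightarrow> inv_arr X X (idm X)"
  unfolding inv_arr_def by (rule exI[of _ "idm X"]) (simp add: id_left[OF arr_id])

lemma inv_cmp:
  assumes "inv_arr X Y f" "inv_arr Y Z g"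
  shows "inv_arr X Z (f \<cdot> g)"
proof -
  from assms obtain f' g' where f: "arr X Y f" "arr Y X f'" "f \<cdot> f' = idm X" "f' \<cdot> f = idm Y"
    and g: "arr Y Z g" "arr Z Y g'" "g \<cdot> g' = idm Y" "g' \<cdot> g = idm Z"
    by (auto simp: inv_arr_def)
  have "(f \<cdot> g) \<cdot> (g' \<cdot> f') = f \<cdot> (g \<cdot> (g' \<cdot> f'))"
    using f g by (intro assoc) auto
  also have "g \<cdot> (g' \<cdot> f') = f'"
    using assoc[OF g(1,2) f(2)] g id_left[OF f(2)] by simp
  finally have 1: "(f \<cdot> g) \<cdot> (g' \<cdot> f') = idm X" using f by simp
  have "(g' \<cdot> f') \<cdot> (f \<cdot> g) = g' \<cdot> (f' \<cdot> (f \<cdot> g))"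
    using f g by (intro assoc) auto
  also have "f' \<cdot> (f \<cdot> g) = g"
    using assoc[OF f(2,1) g(1)] f id_left[OF g(1)] by simp
  finally have 2: "(g' \<cdot> f') \<cdot> (f \<cdot> g) = idm Z" using g by simp
  show ?thesis unfolding inv_arr_def
    using 1 2 f g by (intro exI[of _ "g' \<cdot> f'"]) auto
qed

lemma iso_Obj: "iso T X Y \<Longrightarrow> X \<in> Obj T" "iso T X Y \<Longrightarrow> Y \<in> Obj T"
  by (auto simp: iso_def)
lemma iso_refl: "X \<in> Obj T \<Longrightarrow> iso T X X"
  using inv_id by (auto simp: iso_iff)
lemma iso_sym: "iso T X Y \<Longrightarrow> iso T Y X"
  by (meson isoE isoI)
lemma iso_trans [trans]: "iso T X Y \<Longrightarrow> iso T Y Z \<Longrightarrow> iso T X Z"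
  unfolding iso_iff using inv_cmp by blast

lemma isoclass_eq: "X \<in> Obj T \<Longrightarrow> isoclass T X = isoclass T Y \<longleftrightarrow> iso T X Y"
  unfolding isoclass_def using iso_refl iso_sym iso_trans by blast

lemma inv_of_left_right:
  assumes "arr X Y f" "arr Y X g" "arr Y X h" "g \<cdot> f = idm Y" "f \<cdot> h = idm X"
  shows "inv_arr X Y f"
proof -
  have "g = g \<cdot> (f \<cdot> h)" using assms id_right by metis
  also have "\<dots> = h" using assoc[OF assms(2,1,3)] assms id_left by metis
  finally show ?thesis using assms by (auto simp: inv_arr_def)
qed

lemma inv_of_two_sided:
  assumes "arr X Y f" "arr Y X g" "inv_arr X X (f \<cdot> g)" "inv_arr Y Y (g \<cdot> f)"
  shows "inv_arr X Y f"
proof -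
  from assms(3) obtain u where u: "arr X X u" "(f \<cdot> g) \<cdot> u = idm X" by (auto simp: inv_arr_def)
  from assms(4) obtain v where v: "arr Y Y v" "v \<cdot> (g \<cdot> f) = idm Y" by (auto simp: inv_arr_def)
  have "f \<cdot> (g \<cdot> u) = idm X" using u assoc[OF assms(1,2) u(1)] by simp
  moreover have "(v \<cdot> g) \<cdot> f = idm Y" using v assoc[OF v(1) assms(2,1)] by simp
  ultimately show ?thesis
    using assms(1,2) u v by (intro inv_of_left_right[of _ _ _ "v \<cdot> g" "g \<cdot> u"]) auto
qed

text \<open>If \<open>u\<close> inverts 1 - fg, then 1 + guf inverts 1 - gf, as the geometric series
  suggests. This gives the symmetry between the two sides of the radical.\<close>

lemma inv_one_minus_swap:
  assumes f: "arr X Y f" and g: "arr Y X g" and i: "inv_arr X X (idm X - f \<cdot> g)"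
  shows "inv_arr Y Y (idm Y - g \<cdot> f)"
proof -
  from i obtain u where u: "arr X X u" "(idm X - f \<cdot> g) \<cdot> u = idm X" "u \<cdot> (idm X - f \<cdot> g) = idm X"
    by (auto simp: inv_arr_def)
  have X: "X \<in> Obj T" and Y: "Y \<in> Obj T" using f by (auto dest: arrD)
  have fg: "arr X X (f \<cdot> g)" and gf: "arr Y Y (g \<cdot> f)" using f g by auto
  define w where "w = g \<cdot> (u \<cdot> f)"
  have w: "arr Y Y w" using f g u by (auto simp: w_def)
  have 1: "u - (f \<cdot> g) \<cdot> u = idm X" using u diff_cmp[OF arr_id[OF X] fg u(1)] id_left by metis
  have 2: "u - u \<cdot> (f \<cdot> g) = idm X" using u cmp_diff[OF u(1) arr_id[OF X] fg] id_right by metis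
  have uf: "arr X Y (u \<cdot> f)" using f u by auto
  have "(g \<cdot> f) \<cdot> w = g \<cdot> ((f \<cdot> g) \<cdot> (u \<cdot> f))"
    using assoc[OF g f w] assoc[OF f g uf] by (simp add: w_def)
  also have "(f \<cdot> g) \<cdot> (u \<cdot> f) = ((f \<cdot> g) \<cdot> u) \<cdot> f" using assoc[OF fg u(1) f] by simp
  also have "(f \<cdot> g) \<cdot> u = u - idm X" using 1 by (simp add: algebra_simps)
  also have "(u - idm X) \<cdot> f = u \<cdot> f - f"
    using diff_cmp[OF u(1) arr_id[OF X] f] id_left[OF f] by simp
  also have "g \<cdot> (u \<cdot> f - f) = w - g \<cdot> f" using cmp_diff[OF g uf f] by (simp add: w_def)
  finally have A: "(g \<cdot> f) \<cdot> w = w - g \<cdot> f" .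
  have "w \<cdot> (g \<cdot> f) = g \<cdot> ((u \<cdot> (f \<cdot> g)) \<cdot> f)"
    using assoc[OF g uf gf] assoc[OF u(1) f gf] assoc[OF f g f] assoc[OF u(1) fg f]
    by (simp add: w_def)
  also have "u \<cdot> (f \<cdot> g) = u - idm X" using 2 by (simp add: algebra_simps)
  also have "(u - idm X) \<cdot> f = u \<cdot> f - f"
    using diff_cmp[OF u(1) arr_id[OF X] f] id_left[OF f] by simp
  also have "g \<cdot> (u \<cdot> f - f) = w - g \<cdot> f" using cmp_diff[OF g uf f] by (simp add: w_def)
  finally have B: "w \<cdot> (g \<cdot> f) = w - g \<cdot> f" .
  have iw: "arr Y Y (idm Y + w)" using w Y by auto
  have "(idm Y - g \<cdot> f) \<cdot> (idm Y + w) = (idm Y + w) - (g \<cdot> f) \<cdot> (idm Y + w)"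
    using diff_cmp[OF arr_id[OF Y] gf iw] id_left[OF iw] by simp
  also have "(g \<cdot> f) \<cdot> (idm Y + w) = g \<cdot> f + (g \<cdot> f) \<cdot> w"
    using cmp_add[OF gf arr_id[OF Y] w] id_right[OF gf] by simp
  finally have C: "(idm Y - g \<cdot> f) \<cdot> (idm Y + w) = idm Y" using A by simp
  have "(idm Y + w) \<cdot> (idm Y - g \<cdot> f) = (idm Y + w) - (idm Y + w) \<cdot> (g \<cdot> f)"
    using cmp_diff[OF iw arr_id[OF Y] gf] id_right[OF iw] by simp
  also have "(idm Y + w) \<cdot> (g \<cdot> f) = g \<cdot> f + w \<cdot> (g \<cdot> f)"
    using add_cmp[OF arr_id[OF Y] w gf] id_left[OF gf] by simp
  finally have D: "(idm Y + w) \<cdot> (idm Y - g \<cdot> f) = idm Y" using B by simp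
  show ?thesis unfolding inv_arr_def using C D iw gf Y by blast
qed

section \<open>The Jacobson radical\<close>

lemma rad_iff: "X \<in> Obj T \<Longrightarrow> Y \<in> Obj T \<Longrightarrow> f \<in> radical T X Y \<longleftrightarrow> rad X Y f"
  by (auto simp: radical_def rad_def arr_def inv_arr_iff)

lemma rad_cmp_right:
  assumes "rad X Y f" "arr Y Z g"
  shows "rad X Z (f \<cdot> g)"
  unfolding rad_def
proof (intro conjI allI impI)
  have f: "arr X Y f" using assms by (simp add: rad_def)
  thus "arr X Z (f \<cdot> g)" using assms by auto
  fix h assume h: "arr Z X h"
  show "inv_arr X X (idm X - f \<cdot> g \<cdot> h)"
    using assms h assoc[OF f assms(2) h] by (auto simp: rad_def)
qed

lemma rad_cmp_left:
  assumes "rad X Y f" "arr W X g"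
  shows "rad W Y (g \<cdot> f)"
  unfolding rad_def
proof (intro conjI allI impI)
  have f: "arr X Y f" using assms by (simp add: rad_def)
  thus "arr W Y (g \<cdot> f)" using assms by auto
  fix h assume h: "arr Y W h"
  have "inv_arr X X (idm X - f \<cdot> (h \<cdot> g))" using assms h by (auto simp: rad_def)
  hence "inv_arr X X (idm X - (f \<cdot> h) \<cdot> g)" using assoc[OF f h assms(2)] by simp
  hence "inv_arr W W (idm W - g \<cdot> (f \<cdot> h))" using inv_one_minus_swap[OF arr_cmp[OF f h] assms(2)] by simp
  thus "inv_arr W W (idm W - g \<cdot> f \<cdot> h)" using assoc[OF assms(2) f h] by simp
qed

text \<open>With \<open>u\<close> inverse to 1 - fg one has (1 - f'gu)(1 - fg) = 1 - (f + f')g, a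
  product of invertible endomorphisms.\<close>

lemma rad_add:
  assumes f: "rad X Y f" and f': "rad X Y f'"
  shows "rad X Y (f + f')"
  unfolding rad_def
proof (intro conjI allI impI)
  have a: "arr X Y f" "arr X Y f'" using f f' by (auto simp: rad_def)
  thus "arr X Y (f + f')" by auto
  have X: "X \<in> Obj T" using a by (auto dest: arrD)
  fix g assume g: "arr Y X g"
  from f g obtain u where u: "arr X X u" "(idm X - f \<cdot> g) \<cdot> u = idm X" "u \<cdot> (idm X - f \<cdot> g) = idm X"
    by (auto simp: inv_arr_def rad_def)
  have e: "arr X X (idm X - f \<cdot> g)" using a g X by auto
  have gu: "arr Y X (g \<cdot> u)" using g u(1) by auto
  have i1: "inv_arr X X (idm X - f \<cdot> g)" using f g by (auto simp: rad_def)
  have i2: "inv_arr X X (idm X - f' \<cdot> (g \<cdot> u))" using f' gu by (auto simp: rad_def)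
  have "(idm X - f' \<cdot> (g \<cdot> u)) \<cdot> (idm X - f \<cdot> g)
      = (idm X - f \<cdot> g) - (f' \<cdot> (g \<cdot> u)) \<cdot> (idm X - f \<cdot> g)"
    using diff_cmp[OF arr_id[OF X] arr_cmp[OF a(2) gu] e] id_left[OF e] by simp
  also have "(f' \<cdot> (g \<cdot> u)) \<cdot> (idm X - f \<cdot> g) = f' \<cdot> (g \<cdot> (u \<cdot> (idm X - f \<cdot> g)))"
    using assoc[OF a(2) gu e] assoc[OF g u(1) e] by simp
  also have "\<dots> = f' \<cdot> g" using u id_right[OF g] by simp
  finally have "(idm X - f' \<cdot> (g \<cdot> u)) \<cdot> (idm X - f \<cdot> g) = idm X - (f + f') \<cdot> g"
    using add_cmp[OF a g] by (simp add: algebra_simps)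
  thus "inv_arr X X (idm X - (f + f') \<cdot> g)" using inv_cmp[OF i2 i1] by simp
qed

lemma rad_zero: "X \<in> Obj T \<Longrightarrow> Y \<in> Obj T \<Longrightarrow> rad X Y 0"
  by (auto simp: rad_def inv_id)

lemma rad_sum: "X \<in> Obj T \<Longrightarrow> Y \<in> Obj T \<Longrightarrow> (\<And>i. i \<in> I \<Longrightarrow> rad X Y (f i)) \<Longrightarrow> rad X Y (\<Sum>i\<in>I. f i)"
  by (induct I rule: infinite_finite_induct) (auto simp: rad_zero rad_add)

section \<open>Retracts and local endomorphism rings\<close>

lemma retract_Obj: "retract A X \<Longrightarrow> A \<in> Obj T" "retract A X \<Longrightarrow> X \<in> Obj T"
  by (auto simp: retract_def dest: arrD)

lemma retract_trans:
  assumes "retract A B" "retract B C"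
  shows "retract A C"
proof -
  from assms obtain s t s' t' where a: "arr A B s" "arr B A t" "s \<cdot> t = idm A"
    "arr B C s'" "arr C B t'" "s' \<cdot> t' = idm B" by (auto simp: retract_def)
  have "(s \<cdot> s') \<cdot> (t' \<cdot> t) = s \<cdot> ((s' \<cdot> t') \<cdot> t)"
    using assoc[OF a(1) a(4) arr_cmp[OF a(5) a(2)]] assoc[OF a(4) a(5) a(2)] by simp
  also have "\<dots> = idm A" using a(3,6) id_left[OF a(2)] by simp
  finally show ?thesis unfolding retract_def using a by blast
qed

lemma iso_retract: "iso T A B \<Longrightarrow> retract A B"
  by (auto simp: retract_def elim!: isoE)

lemma retract_of_inv:
  assumes s: "arr A B s" and t: "arr B A t" and i: "inv_arr A A (s \<cdot> t)"
  shows "retract A B"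
proof -
  obtain u where u: "arr A A u" "(s \<cdot> t) \<cdot> u = idm A" using i by (auto simp: inv_arr_def)
  hence "s \<cdot> (t \<cdot> u) = idm A" using assoc[OF s t u(1)] by simp
  thus ?thesis unfolding retract_def using s t u by blast
qed

lemma localI_sum:
  assumes "local_end T A" "arr A A f" "arr A A g" "inv_arr A A (f + g)"
  shows "inv_arr A A f \<or> inv_arr A A g"
  using assms unfolding local_end_def by (metis arr_def inv_arr_iff)

lemma local_Obj: "local_end T A \<Longrightarrow> A \<in> Obj T" by (simp add: local_end_def)
lemma local_nz: "local_end T A \<Longrightarrow> idm A \<noteq> 0" by (simp add: local_end_def)

lemma local_not_inv_zero: "local_end T A \<Longrightarrow> \<not> inv_arr A A 0"
  by (auto simp: inv_arr_def local_end_def)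

lemma local_sum:
  assumes l: "local_end T A" and a: "\<And>i. i \<in> I \<Longrightarrow> arr A A (f i)" and i: "inv_arr A A (\<Sum>i\<in>I. f i)"
  shows "\<exists>i\<in>I. inv_arr A A (f i)"
  using a i
proof (induct I rule: infinite_finite_induct)
  case (insert i I)
  have "inv_arr A A (f i + sum f I)" using insert by simp
  hence "inv_arr A A (f i) \<or> inv_arr A A (sum f I)"
    using insert l by (intro localI_sum) (auto intro!: arr_sum dest: local_Obj)
  thus ?case using insert by auto
qed (use local_not_inv_zero[OF l] in simp_all)

lemma local_inv_or: "local_end T A \<Longrightarrow> arr A A f \<Longrightarrow> inv_arr A A f \<or> inv_arr A A (idm A - f)"
  by (rule localI_sum) (auto intro!: inv_id dest: local_Obj)

text \<open>The idempotent ts is the identity: 1 - ts is annihilated by the nonzero map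
  \<open>s\<close>, hence not invertible, so locality makes ts invertible, and an invertible
  idempotent is the identity.\<close>

lemma local_split:
  assumes l: "local_end T B" and a: "arr A B s" "arr B A t" "s \<cdot> t = idm A" and nz: "idm A \<noteq> 0"
  shows "t \<cdot> s = idm B"
proof -
  have B: "arr B B (idm B)" using l by (auto dest: local_Obj)
  have ts: "arr B B (t \<cdot> s)" using a by auto
  have "s \<cdot> (idm B - t \<cdot> s) = s - (s \<cdot> t) \<cdot> s"
    using cmp_diff[OF a(1) B ts] id_right[OF a(1)] assoc[OF a(1,2,1)] by simp
  hence z: "s \<cdot> (idm B - t \<cdot> s) = 0" using a id_left by simp
  have "\<not> inv_arr B B (idm B - t \<cdot> s)"
  proof
    assume "inv_arr B B (idm B - t \<cdot> s)"
    then obtain u where u: "arr B B u" "(idm B - t \<cdot> s) \<cdot> u = idm B" by (auto simp: inv_arr_def)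
    have d: "arr B B (idm B - t \<cdot> s)" using B ts by auto
    have "s = s \<cdot> ((idm B - t \<cdot> s) \<cdot> u)" using u id_right[OF a(1)] by simp
    also have "\<dots> = 0" using assoc[OF a(1) d u(1)] z u by simp
    finally show False using a nz by auto
  qed
  hence "inv_arr B B (t \<cdot> s)" using local_inv_or[OF l ts] by auto
  then obtain u where u: "arr B B u" "(t \<cdot> s) \<cdot> u = idm B" unfolding inv_arr_def by blast
  have "(t \<cdot> s) \<cdot> (t \<cdot> s) = t \<cdot> s"
    using a assoc[OF a(2) a(1) ts] assoc[OF a(1,2,1)] id_left[OF a(1)] by simp
  hence "(t \<cdot> s) \<cdot> ((t \<cdot> s) \<cdot> u) = (t \<cdot> s) \<cdot> u" using assoc[OF ts ts u(1)] by simp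
  thus "t \<cdot> s = idm B" using u id_right[OF ts] by simp
qed

lemma local_retract_iso: "local_end T B \<Longrightarrow> retract A B \<Longrightarrow> idm A \<noteq> 0 \<Longrightarrow> iso T A B"
  using local_split isoI unfolding retract_def by metis

lemma local_iso_of_retract: "local_end T A \<Longrightarrow> local_end T B \<Longrightarrow> retract A B \<Longrightarrow> iso T A B"
  by (rule local_retract_iso) (auto dest: local_nz)

text \<open>An invertible composite A -> B -> A would make A a retract of B; otherwise locality
  makes its complement to the identity invertible.\<close>

lemma rad_from_local:
  assumes l: "local_end T A" and n: "\<not> retract A B" and f: "arr A B f"
  shows "rad A B f"
  unfolding rad_def
proof (intro conjI allI impI f)
  fix g assume g: "arr B A g"
  thus "inv_arr A A (idm A - f \<cdot> g)"
    using local_inv_or[OF l, of "f \<cdot> g"] retract_of_inv[OF f g] n f by blast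
qed

lemma rad_to_local:
  assumes l: "local_end T A" and n: "\<not> retract A B" and f: "arr B A f"
  shows "rad B A f"
  unfolding rad_def
proof (intro conjI allI impI f)
  fix g assume g: "arr A B g"
  have "inv_arr A A (idm A - g \<cdot> f)"
    using local_inv_or[OF l, of "g \<cdot> f"] retract_of_inv[OF g f] n f g by blast
  thus "inv_arr B B (idm B - f \<cdot> g)" by (rule inv_one_minus_swap[OF g f])
qed

lemma rad_local_end:
  assumes l: "local_end T A" and f: "arr A A f" and n: "\<not> inv_arr A A f"
  shows "rad A A f"
  unfolding rad_def
proof (intro conjI allI impI f)
  fix g assume g: "arr A A g"
  show "inv_arr A A (idm A - f \<cdot> g)"
  proof (rule ccontr)
    assume "\<not> inv_arr A A (idm A - f \<cdot> g)"
    hence "inv_arr A A (f \<cdot> g)" using local_inv_or[OF l, of "f \<cdot> g"] f g by blast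
    then obtain v where v: "arr A A v" "(f \<cdot> g) \<cdot> v = idm A" by (auto simp: inv_arr_def)
    have gv: "arr A A (g \<cdot> v)" using g v by auto
    have "f \<cdot> (g \<cdot> v) = idm A" using assoc[OF f g v(1)] v by simp
    moreover from this have "(g \<cdot> v) \<cdot> f = idm A" using local_split[OF l f gv] local_nz[OF l] by simp
    ultimately show False using n f gv by (auto simp: inv_arr_def)
  qed
qed

lemma inv_cmp_retract_iso:
  assumes "local_end T A" "local_end T B" "arr A B f" "\<not> rad A B f"
  shows "iso T A B"
  using assms rad_from_local local_iso_of_retract by blast

lemma hom0_retract_left: "hom0 B Y \<Longrightarrow> retract A B \<Longrightarrow> hom0 A Y"
  unfolding hom0_def
proof (intro allI impI)
  fix f assume h: "\<forall>f. arr B Y f \<longrightarrow> f = 0" "retract A B" and f: "arr A Y f"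
  from h obtain s t where a: "arr A B s" "arr B A t" "s \<cdot> t = idm A" by (auto simp: retract_def)
  have "f = s \<cdot> (t \<cdot> f)" using assoc[OF a(1,2) f] a id_left[OF f] by simp
  moreover have "t \<cdot> f = 0" using h a f by blast
  ultimately show "f = 0" using a by simp
qed

lemma hom0_retract_right: "hom0 Y B \<Longrightarrow> retract A B \<Longrightarrow> hom0 Y A"
  unfolding hom0_def
proof (intro allI impI)
  fix f assume h: "\<forall>f. arr Y B f \<longrightarrow> f = 0" "retract A B" and f: "arr Y A f"
  from h obtain s t where a: "arr A B s" "arr B A t" "s \<cdot> t = idm A" by (auto simp: retract_def)
  have "f = (f \<cdot> s) \<cdot> t" using assoc[OF f a(1,2)] a id_right[OF f] by simp
  moreover have "f \<cdot> s = 0" using h a f by blast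
  ultimately show "f = 0" using a by simp
qed

lemma hom0_iso_left: "iso T A B \<Longrightarrow> hom0 A Y \<longleftrightarrow> hom0 B Y"
  using hom0_retract_left iso_retract iso_sym by blast
lemma hom0_iso_right: "iso T A B \<Longrightarrow> hom0 Y A \<longleftrightarrow> hom0 Y B"
  using hom0_retract_right iso_retract iso_sym by blast

lemma retract_iso_left: "iso T A B \<Longrightarrow> retract A Y \<longleftrightarrow> retract B Y"
  using iso_retract iso_sym retract_trans by meson
lemma retract_iso_right: "iso T A B \<Longrightarrow> retract Y A \<longleftrightarrow> retract Y B"
  using iso_retract iso_sym retract_trans by meson

subsection \<open>Direct sums\<close>

lemma dsvE:
  assumes "direct_sum_via T Xs S \<iota> \<pi>"
  shows "S \<in> Obj T" "\<And>i. i < length Xs \<Longrightarrow> arr (Xs ! i) S (\<iota> i)"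
    "\<And>i. i < length Xs \<Longrightarrow> arr S (Xs ! i) (\<pi> i)"
    "\<And>i. i < length Xs \<Longrightarrow> \<iota> i \<cdot> \<pi> i = idm (Xs ! i)"
    "\<And>i j. i < length Xs \<Longrightarrow> j < length Xs \<Longrightarrow> i \<noteq> j \<Longrightarrow> \<iota> i \<cdot> \<pi> j = 0"
    "(\<Sum>i<length Xs. \<pi> i \<cdot> \<iota> i) = idm S"
  using assms by (auto simp: direct_sum_via_def arr_def)

lemma ds_retract:
  assumes "direct_sum T Xs S" "A \<in> set Xs"
  shows "retract A S"
proof -
  obtain i where "i < length Xs" "A = Xs ! i" using assms by (auto simp: in_set_conv_nth)
  moreover obtain \<iota> \<pi> where "direct_sum_via T Xs S \<iota> \<pi>" using assms by (auto simp: direct_sum_def)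
  ultimately show ?thesis using dsvE(2,3,4) unfolding retract_def by metis
qed

lemma ds_expand_left:
  assumes d: "direct_sum_via T Xs S \<iota> \<pi>" and h: "arr S Y h"
  shows "h = (\<Sum>i<length Xs. \<pi> i \<cdot> (\<iota> i \<cdot> h))"
proof -
  note e = dsvE[OF d]
  have "h = idm S \<cdot> h" using id_left[OF h] by simp
  also have "\<dots> = (\<Sum>i<length Xs. (\<pi> i \<cdot> \<iota> i) \<cdot> h)"
    unfolding e(6)[symmetric] using e h by (intro sum_cmp[of _ S S]) auto
  also have "\<dots> = (\<Sum>i<length Xs. \<pi> i \<cdot> (\<iota> i \<cdot> h))"
    using e h by (intro sum.cong refl assoc) auto
  finally show ?thesis .
qed

lemma hom0_ds_left:
  assumes d: "direct_sum T Xs S" and z: "\<And>A. A \<in> set Xs \<Longrightarrow> hom0 A Y"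
  shows "hom0 S Y"
  unfolding hom0_def
proof (intro allI impI)
  fix h assume h: "arr S Y h"
  from d obtain \<iota> \<pi> where d: "direct_sum_via T Xs S \<iota> \<pi>" by (auto simp: direct_sum_def)
  note e = dsvE[OF d]
  have "\<pi> i \<cdot> (\<iota> i \<cdot> h) = 0" if "i < length Xs" for i
  proof -
    have "\<iota> i \<cdot> h = 0" using z[of "Xs ! i"] e(2)[OF that] h that by (auto simp: hom0_def)
    thus ?thesis using e(3)[OF that] by simp
  qed
  thus "h = 0" using ds_expand_left[OF d h] by simp
qed

text \<open>The identity of A is a sum of endomorphisms factoring through the individual summands,
  and locality makes one of them invertible.\<close>

lemma local_retract_ds:
  assumes l: "local_end T A" and d: "direct_sum T Xs S" and r: "retract A S"
  shows "\<exists>B\<in>set Xs. retract A B"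
proof -
  from d obtain \<iota> \<pi> where d: "direct_sum_via T Xs S \<iota> \<pi>" by (auto simp: direct_sum_def)
  note e = dsvE[OF d]
  from r obtain s t where a: "arr A S s" "arr S A t" "s \<cdot> t = idm A" by (auto simp: retract_def)
  have "t = (\<Sum>i<length Xs. \<pi> i \<cdot> (\<iota> i \<cdot> t))" by (rule ds_expand_left[OF d a(2)])
  hence "idm A = s \<cdot> (\<Sum>i<length Xs. \<pi> i \<cdot> (\<iota> i \<cdot> t))" using a by simp
  also have "\<dots> = (\<Sum>i<length Xs. s \<cdot> (\<pi> i \<cdot> (\<iota> i \<cdot> t)))"
    using a e l by (intro cmp_sum[of _ S A]) (auto dest: local_Obj)
  also have "\<dots> = (\<Sum>i<length Xs. (s \<cdot> \<pi> i) \<cdot> (\<iota> i \<cdot> t))"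
    by (intro sum.cong refl assoc[symmetric]) (use a e in auto)
  finally have "inv_arr A A (\<Sum>i<length Xs. (s \<cdot> \<pi> i) \<cdot> (\<iota> i \<cdot> t))"
    using inv_id l local_Obj by metis
  moreover have "arr A A ((s \<cdot> \<pi> i) \<cdot> (\<iota> i \<cdot> t))" if "i < length Xs" for i
    using a e[of] that by (meson arr_cmp)
  ultimately obtain i where i: "i < length Xs" "inv_arr A A ((s \<cdot> \<pi> i) \<cdot> (\<iota> i \<cdot> t))"
    using local_sum[OF l, of "{..<length Xs}" "\<lambda>i. (s \<cdot> \<pi> i) \<cdot> (\<iota> i \<cdot> t)"] by auto
  have "retract A (Xs ! i)"
    by (rule retract_of_inv[OF _ _ i(2)]) (use a e i in auto)
  thus ?thesis using i by auto
qed

end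

subsection \<open>Equivalences\<close>

context linear_category
begin

text \<open>An autoequivalence whose action on morphisms depends on the source and target objects; unlike
  records of type \<open>endofunctor\<close> these are closed under taking quasi-inverses.\<close>

definition eqv :: "('o \<Rightarrow> 'o) \<Rightarrow> ('o \<Rightarrow> 'o \<Rightarrow> 'm \<Rightarrow> 'm) \<Rightarrow> bool" where
  "eqv G \<Phi> \<longleftrightarrow> (\<forall>X. X \<in> Obj T \<longrightarrow> G X \<in> Obj T) \<and>
     (\<forall>X Y f. arr X Y f \<longrightarrow> arr (G X) (G Y) (\<Phi> X Y f)) \<and>
     (\<forall>X Y f g. arr X Y f \<longrightarrow> arr X Y g \<longrightarrow> \<Phi> X Y (f + g) = \<Phi> X Y f + \<Phi> X Y g) \<and>
     (\<forall>X. X \<in> Obj T \<longrightarrow> \<Phi> X X (idm X) = idm (G X)) \<and>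
     (\<forall>X Y Z f g. arr X Y f \<longrightarrow> arr Y Z g \<longrightarrow> \<Phi> X Z (f \<cdot> g) = \<Phi> X Y f \<cdot> \<Phi> Y Z g) \<and>
     (\<forall>X Y g. X \<in> Obj T \<longrightarrow> Y \<in> Obj T \<longrightarrow> arr (G X) (G Y) g \<longrightarrow> (\<exists>f. arr X Y f \<and> \<Phi> X Y f = g)) \<and>
     (\<forall>X Y f. arr X Y f \<longrightarrow> \<Phi> X Y f = 0 \<longrightarrow> f = 0) \<and>
     (\<forall>Y. Y \<in> Obj T \<longrightarrow> (\<exists>X. X \<in> Obj T \<and> iso T (G X) Y))"

context
  fixes G \<Phi> assumes e: "eqv G \<Phi>"
begin

lemma eqv_Obj: "X \<in> Obj T \<Longrightarrow> G X \<in> Obj T"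
  and eqv_arr: "arr X Y f \<Longrightarrow> arr (G X) (G Y) (\<Phi> X Y f)"
  and eqv_add: "arr X Y f \<Longrightarrow> arr X Y g \<Longrightarrow> \<Phi> X Y (f + g) = \<Phi> X Y f + \<Phi> X Y g"
  and eqv_id: "X \<in> Obj T \<Longrightarrow> \<Phi> X X (idm X) = idm (G X)"
  and eqv_cmp: "arr X Y f \<Longrightarrow> arr Y Z g \<Longrightarrow> \<Phi> X Z (f \<cdot> g) = \<Phi> X Y f \<cdot> \<Phi> Y Z g"
  and eqv_full: "X \<in> Obj T \<Longrightarrow> Y \<in> Obj T \<Longrightarrow> arr (G X) (G Y) h \<Longrightarrow> \<exists>f. arr X Y f \<and> \<Phi> X Y f = h"
  and eqv_ker: "arr X Y f \<Longrightarrow> \<Phi> X Y f = 0 \<Longrightarrow> f = 0"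
  and eqv_ess: "Y \<in> Obj T \<Longrightarrow> \<exists>X. X \<in> Obj T \<and> iso T (G X) Y"
  by (insert e[unfolded eqv_def], elim conjE, metis)+

lemma eqv_zero: "X \<in> Obj T \<Longrightarrow> Y \<in> Obj T \<Longrightarrow> \<Phi> X Y 0 = 0"
  using eqv_add[of X Y 0 0] by simp

lemma eqv_uminus: "arr X Y f \<Longrightarrow> \<Phi> X Y (- f) = - \<Phi> X Y f"
  using eqv_add[of X Y f "- f"] eqv_zero[of X Y] by (simp add: arr_uminus arrD add_eq_0_iff)

lemma eqv_faithful: "arr X Y f \<Longrightarrow> arr X Y g \<Longrightarrow> \<Phi> X Y f = \<Phi> X Y g \<Longrightarrow> f = g"
  using eqv_ker[of X Y "f - g"] eqv_add[of X Y f "- g"] eqv_uminus[of X Y g]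
  by (simp add: arr_uminus arr_diff)

lemma eqv_inv: "inv_arr X Y f \<Longrightarrow> inv_arr (G X) (G Y) (\<Phi> X Y f)"
  unfolding inv_arr_def by (metis eqv_arr eqv_cmp eqv_id arrD(1,2))

lemma eqv_inv_reflect:
  assumes f: "arr X Y f" and i: "inv_arr (G X) (G Y) (\<Phi> X Y f)"
  shows "inv_arr X Y f"
proof -
  have X: "X \<in> Obj T" "Y \<in> Obj T" using f by (auto dest: arrD)
  from i obtain g where g: "arr (G Y) (G X) g" "\<Phi> X Y f \<cdot> g = idm (G X)" "g \<cdot> \<Phi> X Y f = idm (G Y)"
    by (auto simp: inv_arr_def)
  then obtain h where h: "arr Y X h" "\<Phi> Y X h = g" using eqv_full X by blast
  have "\<Phi> X X (f \<cdot> h) = \<Phi> X X (idm X)" using eqv_cmp[OF f h(1)] g h X by (simp add: eqv_id)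
  hence 1: "f \<cdot> h = idm X" by (rule eqv_faithful[rotated 2]) (use f h X in auto)
  have "\<Phi> Y Y (h \<cdot> f) = \<Phi> Y Y (idm Y)" using eqv_cmp[OF h(1) f] g h X by (simp add: eqv_id)
  hence "h \<cdot> f = idm Y" by (rule eqv_faithful[rotated 2]) (use f h X in auto)
  thus ?thesis using 1 f h by (auto simp: inv_arr_def)
qed

lemma eqv_iso: "iso T X Y \<Longrightarrow> iso T (G X) (G Y)"
  unfolding iso_iff using eqv_inv by blast

lemma eqv_iso_iff: "X \<in> Obj T \<Longrightarrow> Y \<in> Obj T \<Longrightarrow> iso T (G X) (G Y) \<longleftrightarrow> iso T X Y"
  unfolding iso_iff using eqv_inv eqv_inv_reflect eqv_full inv_arr_arr by metis

lemma eqv_hom0: "X \<in> Obj T \<Longrightarrow> Y \<in> Obj T \<Longrightarrow> hom0 (G X) (G Y) \<longleftrightarrow> hom0 X Y"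
  unfolding hom0_def using eqv_full eqv_arr eqv_ker eqv_zero by metis

lemma eqv_retract: "X \<in> Obj T \<Longrightarrow> Y \<in> Obj T \<Longrightarrow> retract (G X) (G Y) \<longleftrightarrow> retract X Y"
proof
  assume X: "X \<in> Obj T" "Y \<in> Obj T" and "retract (G X) (G Y)"
  then obtain s t where a: "arr (G X) (G Y) s" "arr (G Y) (G X) t" "s \<cdot> t = idm (G X)"
    by (auto simp: retract_def)
  obtain s' t' where b: "arr X Y s'" "arr Y X t'" "\<Phi> X Y s' = s" "\<Phi> Y X t' = t"
    using eqv_full[OF X a(1)] eqv_full[OF X(2,1) a(2)] by blast
  have "\<Phi> X X (s' \<cdot> t') = \<Phi> X X (idm X)" using eqv_cmp[OF b(1,2)] a b X eqv_id by simp
  hence "s' \<cdot> t' = idm X" by (rule eqv_faithful[rotated 2]) (use b X in auto)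
  thus "retract X Y" using b by (auto simp: retract_def)
next
  assume X: "X \<in> Obj T" "Y \<in> Obj T" and "retract X Y"
  then obtain s t where a: "arr X Y s" "arr Y X t" "s \<cdot> t = idm X"
    by (auto simp: retract_def)
  have "\<Phi> X Y s \<cdot> \<Phi> Y X t = idm (G X)" using eqv_cmp[OF a(1,2)] a X eqv_id by simp
  thus "retract (G X) (G Y)" using a eqv_arr unfolding retract_def by blast
qed

lemma eqv_local: assumes X: "X \<in> Obj T" shows "local_end T (G X) \<longleftrightarrow> local_end T X"
proof -
  have nz: "idm (G X) = 0 \<longleftrightarrow> idm X = 0"
    using eqv_id[OF X] eqv_ker[OF arr_id[OF X]] eqv_zero[OF X X] by metis
  have i: "inv_arr (G X) (G X) (\<Phi> X X f) \<longleftrightarrow> inv_arr X X f" if "arr X X f" for f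
    using that eqv_inv eqv_inv_reflect by blast
  show ?thesis
  proof
    assume l: "local_end T (G X)"
    have "inv_arr X X f \<or> inv_arr X X g" if "arr X X f" "arr X X g" "inv_arr X X (f + g)" for f g
      using localI_sum[OF l, of "\<Phi> X X f" "\<Phi> X X g"] that i eqv_add[OF that(1,2)] eqv_arr eqv_inv
      by metis
    thus "local_end T X" using l nz X by (auto simp: local_end_def arr_def inv_arr_iff)
  next
    assume l: "local_end T X"
    have "inv_arr (G X) (G X) f \<or> inv_arr (G X) (G X) g"
      if fg: "arr (G X) (G X) f" "arr (G X) (G X) g" "inv_arr (G X) (G X) (f + g)" for f g
    proof -
      obtain f' g' where *: "arr X X f'" "\<Phi> X X f' = f" "arr X X g'" "\<Phi> X X g' = g"
        using eqv_full[OF X X] fg by metis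
      show ?thesis using localI_sum[OF l, of f' g'] * i eqv_add[of X X f' g'] fg(3) arr_add by metis
    qed
    thus "local_end T (G X)" using l nz X eqv_Obj[OF X] by (auto simp: local_end_def arr_def inv_arr_iff)
  qed
qed

end

lemma eqv_ident: "eqv (\<lambda>X. X) (\<lambda>X Y f. f)"
  unfolding eqv_def using iso_refl by blast

lemma eqv_comp:
  assumes "eqv G \<Phi>" "eqv H \<Psi>"
  shows "eqv (\<lambda>X. G (H X)) (\<lambda>X Y f. \<Phi> (H X) (H Y) (\<Psi> X Y f))"
proof -
  note [intro] = eqv_Obj[OF assms(1)] eqv_Obj[OF assms(2)] eqv_arr[OF assms(1)] eqv_arr[OF assms(2)]
  have ess: "\<exists>X. X \<in> Obj T \<and> iso T (G (H X)) Y" if "Y \<in> Obj T" for Y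
    using eqv_ess[OF assms(1) that] eqv_ess[OF assms(2)] eqv_iso[OF assms(1)] iso_trans by meson
  have full: "\<exists>f. arr X Y f \<and> \<Phi> (H X) (H Y) (\<Psi> X Y f) = g"
    if o: "X \<in> Obj T" "Y \<in> Obj T" and g: "arr (G (H X)) (G (H Y)) g" for X Y g
  proof -
    obtain f where f: "arr (H X) (H Y) f" "\<Phi> (H X) (H Y) f = g"
      using eqv_full[OF assms(1) _ _ g] o eqv_Obj[OF assms(2)] by blast
    thus ?thesis using eqv_full[OF assms(2) o f(1)] by blast
  qed
  show ?thesis unfolding eqv_def
  proof (intro conjI allI impI)
    fix X Y Z f g assume "arr X Y f" "arr Y Z g"
    thus "\<Phi> (H X) (H Z) (\<Psi> X Z (f \<cdot> g)) = \<Phi> (H X) (H Y) (\<Psi> X Y f) \<cdot> \<Phi> (H Y) (H Z) (\<Psi> Y Z g)"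
      using eqv_cmp[OF assms(1)] eqv_cmp[OF assms(2)] eqv_arr[OF assms(2)] by metis
  next
    fix X Y f g assume "arr X Y f" "arr X Y g"
    thus "\<Phi> (H X) (H Y) (\<Psi> X Y (f + g)) = \<Phi> (H X) (H Y) (\<Psi> X Y f) + \<Phi> (H X) (H Y) (\<Psi> X Y g)"
      using eqv_add[OF assms(1)] eqv_add[OF assms(2)] eqv_arr[OF assms(2)] by metis
  next
    fix X assume "X \<in> Obj T"
    thus "\<Phi> (H X) (H X) (\<Psi> X X (idm X)) = idm (G (H X))"
      using eqv_id[OF assms(1)] eqv_id[OF assms(2)] eqv_Obj[OF assms(2)] by metis
  next
    fix X Y f assume "arr X Y f" "\<Phi> (H X) (H Y) (\<Psi> X Y f) = 0"
    thus "f = 0" using eqv_ker[OF assms(1)] eqv_ker[OF assms(2)] eqv_arr[OF assms(2)] by metis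
  qed (use ess full in auto)
qed

text \<open>Any choice of objects H Y with G (H Y) isomorphic to Y extends to a functor: a morphism
  is conjugated by the chosen isomorphisms and pulled back along the fully faithful G. Functoriality
  is the uniqueness of this preimage.\<close>

lemma eqv_inverse:
  assumes G: "eqv G \<Phi>" and H: "\<And>Y. Y \<in> Obj T \<Longrightarrow> H Y \<in> Obj T \<and> iso T (G (H Y)) Y"
  shows "\<exists>\<Psi>. eqv H \<Psi>"
proof -
  have "\<forall>Y. \<exists>p q. Y \<in> Obj T \<longrightarrow> arr (G (H Y)) Y p \<and> arr Y (G (H Y)) q \<and> p \<cdot> q = idm (G (H Y)) \<and> q \<cdot> p = idm Y"
    using H by (meson isoE)
  then obtain p q where pq: "\<And>Y. Y \<in> Obj T \<Longrightarrow> arr (G (H Y)) Y (p Y) \<and> arr Y (G (H Y)) (q Y) \<and>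
     p Y \<cdot> q Y = idm (G (H Y)) \<and> q Y \<cdot> p Y = idm Y" by metis
  have p: "arr (G (H Y)) Y (p Y)" and q: "arr Y (G (H Y)) (q Y)" and pq1: "p Y \<cdot> q Y = idm (G (H Y))"
    and qp: "q Y \<cdot> p Y = idm Y" and HO: "H Y \<in> Obj T" if "Y \<in> Obj T" for Y using pq H that by blast+
  define L where "L X Y f = (p X \<cdot> f) \<cdot> q Y" for X Y f
  have L: "arr (G (H X)) (G (H Y)) (L X Y f)" if "arr X Y f" for X Y f
    unfolding L_def using p[of X] q[of Y] that by (meson arr_cmp arrD)
  have expand: "f = (q X \<cdot> L X Y f) \<cdot> p Y" if f: "arr X Y f" for X Y f
  proof -
    have o: "X \<in> Obj T" "Y \<in> Obj T" using f by (auto dest: arrD)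
    have "q X \<cdot> L X Y f = (q X \<cdot> p X) \<cdot> (f \<cdot> q Y)"
      unfolding L_def using assoc[OF p[OF o(1)] f q[OF o(2)]]
        assoc[OF q[OF o(1)] p[OF o(1)] arr_cmp[OF f q[OF o(2)]]] by simp
    also have "\<dots> = f \<cdot> q Y" using qp[OF o(1)] id_left[OF arr_cmp[OF f q[OF o(2)]]] by simp
    finally show ?thesis using assoc[OF f q p] o qp id_right[OF f] by simp
  qed
  define \<Psi> where "\<Psi> X Y f = (SOME g. arr (H X) (H Y) g \<and> \<Phi> (H X) (H Y) g = L X Y f)" for X Y f
  have \<Psi>: "arr (H X) (H Y) (\<Psi> X Y f) \<and> \<Phi> (H X) (H Y) (\<Psi> X Y f) = L X Y f" if "arr X Y f" for X Y f
    unfolding \<Psi>_def by (rule someI_ex) (rule eqv_full[OF G HO HO L], insert that, auto dest: arrD)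
  have uniq: "\<Psi> X Y f = g" if "arr X Y f" "arr (H X) (H Y) g" "\<Phi> (H X) (H Y) g = L X Y f" for X Y f g
    using eqv_faithful[OF G, of "H X" "H Y" "\<Psi> X Y f" g] \<Psi>[OF that(1)] that by simp
  have "eqv H \<Psi>" unfolding eqv_def
  proof (intro conjI allI impI)
    fix X Y f g assume fg: "arr X Y f" "arr X Y g"
    have o: "X \<in> Obj T" "Y \<in> Obj T" using fg by (auto dest: arrD)
    have "L X Y (f + g) = L X Y f + L X Y g"
      unfolding L_def using cmp_add[OF p[OF o(1)] fg] fg
        add_cmp[OF arr_cmp[OF p[OF o(1)] fg(1)] arr_cmp[OF p[OF o(1)] fg(2)] q[OF o(2)]] by simp
    thus "\<Psi> X Y (f + g) = \<Psi> X Y f + \<Psi> X Y g"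
      using \<Psi> fg by (intro uniq) (auto simp: eqv_add[OF G] arr_add)
  next
    fix X assume X: "X \<in> Obj T"
    have "L X X (idm X) = idm (G (H X))" unfolding L_def using id_right[OF p[OF X]] pq1[OF X] by simp
    thus "\<Psi> X X (idm X) = idm (H X)"
      using X by (intro uniq) (auto simp: eqv_id[OF G] HO)
  next
    fix X Y Z f g assume fg: "arr X Y f" "arr Y Z g"
    have o: "X \<in> Obj T" "Y \<in> Obj T" "Z \<in> Obj T" using fg by (auto dest: arrD)
    have pf: "arr (G (H X)) Y (p X \<cdot> f)" and gq: "arr Y (G (H Z)) (g \<cdot> q Z)"
      using p[OF o(1)] q[OF o(3)] fg by (auto intro: arr_cmp)
    have "L X Y f \<cdot> L Y Z g = (p X \<cdot> f) \<cdot> (q Y \<cdot> (p Y \<cdot> (g \<cdot> q Z)))"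
      unfolding L_def using assoc[OF p[OF o(2)] fg(2) q[OF o(3)]]
        assoc[OF pf q[OF o(2)] arr_cmp[OF p[OF o(2)] gq]] by simp
    also have "q Y \<cdot> (p Y \<cdot> (g \<cdot> q Z)) = g \<cdot> q Z"
      using assoc[OF q[OF o(2)] p[OF o(2)] gq] qp[OF o(2)] id_left[OF gq] by simp
    also have "(p X \<cdot> f) \<cdot> (g \<cdot> q Z) = L X Z (f \<cdot> g)"
      unfolding L_def using assoc[OF p[OF o(1)] fg(1) gq] assoc[OF fg q[OF o(3)]]
        assoc[OF p[OF o(1)] arr_cmp[OF fg] q[OF o(3)]] by simp
    finally show "\<Psi> X Z (f \<cdot> g) = \<Psi> X Y f \<cdot> \<Psi> Y Z g"
      using \<Psi>[OF fg(1)] \<Psi>[OF fg(2)] fg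
      by (intro uniq) (auto simp: eqv_cmp[OF G, of "H X" "H Y" _ "H Z"] intro: arr_cmp)
  next
    fix X Y g assume o: "X \<in> Obj T" "Y \<in> Obj T" and g: "arr (H X) (H Y) g"
    have Gg: "arr (G (H X)) (G (H Y)) (\<Phi> (H X) (H Y) g)" by (rule eqv_arr[OF G g])
    define f where "f = (q X \<cdot> \<Phi> (H X) (H Y) g) \<cdot> p Y"
    have qg: "arr X (G (H Y)) (q X \<cdot> \<Phi> (H X) (H Y) g)" using q[OF o(1)] Gg by auto
    have f: "arr X Y f" unfolding f_def using qg p[OF o(2)] by auto
    have "p X \<cdot> f = (p X \<cdot> (q X \<cdot> \<Phi> (H X) (H Y) g)) \<cdot> p Y"
      unfolding f_def using assoc[OF p[OF o(1)] qg p[OF o(2)]] by simp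
    also have "p X \<cdot> (q X \<cdot> \<Phi> (H X) (H Y) g) = \<Phi> (H X) (H Y) g"
      using assoc[OF p[OF o(1)] q[OF o(1)] Gg] pq1[OF o(1)] id_left[OF Gg] by simp
    finally have "L X Y f = \<Phi> (H X) (H Y) g" unfolding L_def
      using assoc[OF Gg p[OF o(2)] q[OF o(2)]] pq1[OF o(2)] id_right[OF Gg] by simp
    thus "\<exists>f. arr X Y f \<and> \<Psi> X Y f = g" using f g uniq by metis
  next
    fix X Y f assume f: "arr X Y f" and z: "\<Psi> X Y f = 0"
    have o: "X \<in> Obj T" "Y \<in> Obj T" using f by (auto dest: arrD)
    have "L X Y f = 0" using \<Psi>[OF f] z eqv_zero[OF G HO HO] o by metis
    thus "f = 0" using expand[OF f] p[OF o(2)] q[OF o(1)] by simp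
  next
    fix Y assume Y: "Y \<in> Obj T"
    have GY: "G Y \<in> Obj T" using eqv_Obj[OF G Y] .
    have "iso T (G (H (G Y))) (G Y)" using H GY by blast
    hence "iso T (H (G Y)) Y" using eqv_iso_iff[OF G HO[OF GY] Y] by simp
    thus "\<exists>X. X \<in> Obj T \<and> iso T (H X) Y" using GY by blast
  qed (use HO \<Psi> in auto)
  thus ?thesis by blast
qed

section \<open>Integer powers of equivalences\<close>

lemma eqv_funpow: "eqv G \<Phi> \<Longrightarrow> \<exists>\<Psi>. eqv (G ^^ k) \<Psi>"
proof (induct k)
  case 0 thus ?case using eqv_ident by (auto simp: id_def)
next
  case (Suc k)
  then obtain \<Psi> where "eqv (G ^^ k) \<Psi>" by blast
  from eqv_comp[OF Suc(2) this] show ?case by (auto simp: o_def)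
qed

lemma quasi_inverse:
  assumes "eqv G \<Phi>" "Y \<in> Obj T"
  shows "quasi_inverse T G Y \<in> Obj T" "iso T (G (quasi_inverse T G Y)) Y"
proof -
  have "\<exists>X. X \<in> Obj T \<and> iso T (G X) Y" using eqv_ess[OF assms] by blast
  from someI_ex[OF this] show "quasi_inverse T G Y \<in> Obj T" "iso T (G (quasi_inverse T G Y)) Y"
    by (auto simp: quasi_inverse_def)
qed

lemma eqv_int_power:
  assumes "eqv G \<Phi>"
  shows "\<exists>\<Psi>. eqv (int_power T G l) \<Psi>"
proof (cases "l \<ge> 0")
  case True thus ?thesis using eqv_funpow[OF assms] by (simp add: int_power_def)
next
  case False
  obtain \<Psi> where "eqv (quasi_inverse T G) \<Psi>"
    using eqv_inverse[OF assms, of "quasi_inverse T G"] quasi_inverse[OF assms] by blast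
  thus ?thesis using False eqv_funpow by (simp add: int_power_def)
qed

lemma int_power_Suc:
  assumes e: "eqv G \<Phi>" and X: "X \<in> Obj T"
  shows "iso T (int_power T G (l + 1) X) (G (int_power T G l X))"
proof (cases "l \<ge> 0")
  case True
  hence "int_power T G (l + 1) X = G (int_power T G l X)"
    by (simp add: int_power_def nat_add_distrib)
  moreover have "int_power T G l X \<in> Obj T" using eqv_int_power[OF e, of l] eqv_Obj X by blast
  ultimately show ?thesis using iso_refl eqv_Obj[OF e] by simp
next
  case False
  define k where "k = nat (- l - 1)"
  have l: "nat (- l) = Suc k" "- l - 1 = int k" using False by (auto simp: k_def)
  have 1: "int_power T G (l + 1) X = (quasi_inverse T G ^^ k) X"
  proof (cases k)
    \<comment> \<open>Here l = -1, and the exponent l + 1 already falls under the nonnegative branch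
      of \<open>int_power\<close>.\<close>
    case 0 hence "l + 1 = 0" using l by simp
    thus ?thesis using 0 by (simp add: int_power_def)
  next
    case (Suc j)
    hence "\<not> l + 1 \<ge> 0" "nat (- (l + 1)) = k" using l by auto
    thus ?thesis by (simp add: int_power_def)
  qed
  have 2: "int_power T G l X = quasi_inverse T G ((quasi_inverse T G ^^ k) X)"
    using False l by (simp add: int_power_def)
  obtain \<Psi> where \<Psi>: "eqv (quasi_inverse T G) \<Psi>"
    using eqv_inverse[OF e, of "quasi_inverse T G"] quasi_inverse[OF e] by blast
  have "(quasi_inverse T G ^^ k) X \<in> Obj T" using eqv_funpow[OF \<Psi>, of k] eqv_Obj X by blast
  thus ?thesis unfolding 1 2 using quasi_inverse(2)[OF e] iso_sym by blast
qed

lemma int_power_add: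
  assumes e: "eqv G \<Phi>" and X: "X \<in> Obj T"
  shows "iso T (int_power T G (k + l) X) (int_power T G k (int_power T G l X))"
proof -
  let ?P = "int_power T G"
  have O: "?P j Y \<in> Obj T" if "Y \<in> Obj T" for j Y using eqv_int_power[OF e, of j] eqv_Obj that by blast
  note S = int_power_Suc[OF e]
  show ?thesis
  proof (induct k rule: int_induct[of _ 0])
    case base thus ?case using O X by (simp add: int_power_def iso_refl)
  next
    case (step1 i)
    have "iso T (?P (i + 1 + l) X) (G (?P (i + l) X))" using S[OF X, of "i + l"] by (simp add: algebra_simps)
    also have "iso T (G (?P (i + l) X)) (G (?P i (?P l X)))" using step1 eqv_iso[OF e] by blast
    also have "iso T (G (?P i (?P l X))) (?P (i + 1) (?P l X))" using S[OF O[OF X], of i] iso_sym by blast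
    finally show ?case .
  next
    case (step2 i)
    have "iso T (G (?P (i - 1 + l) X)) (?P (i + l) X)"
      using S[OF X, of "i - 1 + l"] iso_sym by (simp add: algebra_simps)
    also note step2(2)
    also have "iso T (?P i (?P l X)) (G (?P (i - 1) (?P l X)))" using S[OF O[OF X], of "i - 1"] by simp
    finally show ?case using eqv_iso_iff[OF e] O X by blast
  qed
qed

lemma eqv_endofunctor:
  assumes "autoequivalence T F"
  shows "eqv (fobj F) (\<lambda>X Y. fmor F)"
proof -
  note a = assms[unfolded autoequivalence_def linear_functor_def]
  have b: "bij_betw (fmor F) (Hom T X Y) (Hom T (fobj F X) (fobj F Y))" if "X \<in> Obj T" "Y \<in> Obj T" for X Y
    using a that by blast
  have z: "fmor F 0 = 0" if "X \<in> Obj T" "Y \<in> Obj T" for X Y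
  proof -
    have "0 \<in> Hom T X Y" using zero_Hom that by blast
    hence "fmor F (0 + 0) = fmor F 0 + fmor F 0" using a that by blast
    thus ?thesis by simp
  qed
  have "f = 0" if "arr X Y f" "fmor F f = 0" for X Y f
  proof -
    have "inj_on (fmor F) (Hom T X Y)" using b[of X Y] that by (auto simp: bij_betw_def arr_def)
    thus ?thesis using that z zero_Hom unfolding arr_def inj_on_def by metis
  qed
  moreover have "\<exists>f. arr X Y f \<and> fmor F f = g"
    if "X \<in> Obj T" "Y \<in> Obj T" "arr (fobj F X) (fobj F Y) g" for X Y g
    using bij_betw_imp_surj_on[OF b[OF that(1,2)]] that(1,2) arrD(3)[OF that(3)]
    by (auto simp: arr_def) (metis imageE)
  ultimately show ?thesis unfolding eqv_def using a by (auto simp: arr_def)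
qed

end

subsection \<open>Krull-Schmidt decompositions\<close>

context krull_schmidt_category
begin

lemma ks_via:
  assumes "X \<in> Obj T"
  obtains Xs \<iota> \<pi> where "direct_sum_via T Xs X \<iota> \<pi>" "\<And>A. A \<in> set Xs \<Longrightarrow> local_end T A"
  using krull_schmidt[OF assms] unfolding direct_sum_def by blast

text \<open>A morphism outside the radical is an isomorphism on some indecomposable. Splitting the
  source into local objects reduces the claim to the definition of a local ring.\<close>

lemma rad_of_local:
  assumes f: "arr X Y f"
    and n: "\<And>A s t. local_end T A \<Longrightarrow> arr A X s \<Longrightarrow> arr Y A t \<Longrightarrow> \<not> inv_arr A A (s \<cdot> (f \<cdot> t))"
  shows "rad X Y f"
proof -
  have o: "X \<in> Obj T" "Y \<in> Obj T" using f by (auto dest: arrD)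
  obtain Xs \<iota> \<pi> where d: "direct_sum_via T Xs X \<iota> \<pi>" and l: "\<And>A. A \<in> set Xs \<Longrightarrow> local_end T A"
    using ks_via[OF o(1)] by blast
  note e = dsvE[OF d]
  have r: "rad X Y (\<pi> i \<cdot> (\<iota> i \<cdot> f))" if i: "i < length Xs" for i
  proof -
    have l: "local_end T (Xs ! i)" using l i by auto
    have a: "arr (Xs ! i) Y (\<iota> i \<cdot> f)" using e(2)[OF i] f by auto
    have "rad (Xs ! i) Y (\<iota> i \<cdot> f)"
      unfolding rad_def
    proof (intro conjI allI impI a)
      fix g assume g: "arr Y (Xs ! i) g"
      have "\<not> inv_arr (Xs ! i) (Xs ! i) ((\<iota> i \<cdot> f) \<cdot> g)"
        using n[OF l e(2)[OF i] g] assoc[OF e(2)[OF i] f g] by simp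
      thus "inv_arr (Xs ! i) (Xs ! i) (idm (Xs ! i) - \<iota> i \<cdot> f \<cdot> g)"
        using local_inv_or[OF l arr_cmp[OF a g]] by blast
    qed
    thus ?thesis using rad_cmp_left e(3)[OF i] by blast
  qed
  have "rad X Y (\<Sum>i<length Xs. \<pi> i \<cdot> (\<iota> i \<cdot> f))" by (rule rad_sum) (use o r in auto)
  thus ?thesis using ds_expand_left[OF d f] by simp
qed

lemma hom0_local_left:
  assumes "X \<in> Obj T" "\<And>A. local_end T A \<Longrightarrow> retract A X \<Longrightarrow> hom0 A Y"
  shows "hom0 X Y"
  using krull_schmidt[OF assms(1)] assms(2) hom0_ds_left ds_retract by metis

lemma finite_local_retracts: "X \<in> Obj T \<Longrightarrow> finite {isoclass T A | A. local_end T A \<and> retract A X}"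
proof -
  assume "X \<in> Obj T"
  from krull_schmidt[OF this] obtain Xs where d: "direct_sum T Xs X" and l: "\<forall>A\<in>set Xs. local_end T A"
    by blast
  have "{isoclass T A | A. local_end T A \<and> retract A X} \<subseteq> isoclass T ` set Xs"
  proof safe
    fix A assume A: "local_end T A" "retract A X"
    from local_retract_ds[OF A(1) d A(2)] obtain B where "B \<in> set Xs" "retract A B" by blast
    thus "isoclass T A \<in> isoclass T ` set Xs"
      using local_iso_of_retract[OF A(1)] l isoclass_eq[OF local_Obj[OF A(1)]] by blast
  qed
  thus ?thesis using finite_subset by blast
qed

lemma zero_object_exists: obtains Z where "zero_object T Z"
proof -
  from ex_direct_sum[of "[]"] obtain Z where "direct_sum T [] Z" by auto
  thus ?thesis using that by (auto simp: direct_sum_def direct_sum_via_def zero_object_def)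
qed

lemma zero_object_hom0: "zero_object T Z \<Longrightarrow> X \<in> Obj T \<Longrightarrow> hom0 X Z" "zero_object T Z \<Longrightarrow> X \<in> Obj T \<Longrightarrow> hom0 Z X"
  unfolding hom0_def zero_object_def using id_left id_right cmp_zero' zero_cmp' by metis+

end

subsection \<open>Triangles\<close>

context triangulated_category
begin

abbreviation \<Sigma> :: "'o \<Rightarrow> 'o" where "\<Sigma> \<equiv> fobj (Shift T)"
abbreviation \<Sigma>m :: "'m \<Rightarrow> 'm" where "\<Sigma>m \<equiv> fmor (Shift T)"

lemmas eqvS = eqv_endofunctor[OF Shift_autoequivalence]

text \<open>What is retained of a triangle: exactness of (W, -) and (-, W) at the middle object. Any
  equivalence preserves it (\<open>ex3_eqv\<close>), so iterated shifts of triangles can be used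
  without tracking signs.\<close>

definition ex3 :: "'o \<Rightarrow> 'o \<Rightarrow> 'o \<Rightarrow> 'm \<Rightarrow> 'm \<Rightarrow> bool" where
  "ex3 A B C u v \<longleftrightarrow> arr A B u \<and> arr B C v \<and> u \<cdot> v = 0 \<and>
    (\<forall>W f. arr W B f \<longrightarrow> f \<cdot> v = 0 \<longrightarrow> (\<exists>g. arr W A g \<and> f = g \<cdot> u)) \<and>
    (\<forall>W f. arr B W f \<longrightarrow> u \<cdot> f = 0 \<longrightarrow> (\<exists>g. arr C W g \<and> f = v \<cdot> g))"

lemma ex3D:
  assumes "ex3 A B C u v"
  shows "arr A B u" "arr B C v" "u \<cdot> v = 0"
    "\<And>W f. arr W B f \<Longrightarrow> f \<cdot> v = 0 \<Longrightarrow> \<exists>g. arr W A g \<and> f = g \<cdot> u"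
    "\<And>W f. arr B W f \<Longrightarrow> u \<cdot> f = 0 \<Longrightarrow> \<exists>g. arr C W g \<and> f = v \<cdot> g"
  using assms unfolding ex3_def by blast+

lemma Tri_arr:
  assumes "Tri T X Y Z u v w"
  shows "arr X Y u" "arr Y Z v" "arr Z (\<Sigma> X) w"
  using Tri_typed[OF assms] eqv_Obj[OF eqvS] by (auto simp: arr_def)

lemma Tri_rot: "Tri T X Y Z u v w \<Longrightarrow> Tri T Y Z (\<Sigma> X) v w (- \<Sigma>m u)"
  using Tri_rotate Tri_typed by blast

lemma \<Sigma>_uminus: "arr X Y f \<Longrightarrow> \<Sigma>m (- f) = - \<Sigma>m f"
  using eqv_uminus[OF eqvS] .

lemma Tri_mor:
  assumes "Tri T X Y Z u v w" "Tri T X' Y' Z' u' v' w'" "arr X X' f" "arr Y Y' g" "u \<cdot> g = f \<cdot> u'"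
  shows "\<exists>h. arr Z Z' h \<and> v \<cdot> h = g \<cdot> v' \<and> w \<cdot> \<Sigma>m f = h \<cdot> w'"
  using Tri_morphism[OF assms(1,2) _ _ assms(5)] assms Tri_arr arr_def by metis

lemma Tri_comp_zero:
  assumes t: "Tri T X Y Z u v w" shows "u \<cdot> v = 0"
proof -
  obtain Z0 where Z0: "zero_object T Z0" by (rule zero_object_exists)
  have X: "X \<in> Obj T" using Tri_typed[OF t] by blast
  note a = Tri_arr[OF t]
  obtain h where "arr Z0 Z h" "0 \<cdot> h = u \<cdot> v"
    using Tri_mor[OF Tri_ident[OF X Z0] t arr_id[OF X] a(1)] by auto
  thus ?thesis by simp
qed

text \<open>Both lifting properties come from completing a morphism of triangles. The partners are
  rotations of the identity triangle of W: W -> 0 -> W[1] for maps into the middle object, 0 -> W ->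
  W for maps out of it.\<close>

lemma Tri_ex3: assumes t: "Tri T X Y Z u v w" shows "ex3 X Y Z u v"
  unfolding ex3_def
proof (intro conjI allI impI)
  note a = Tri_arr[OF t]
  show "arr X Y u" "arr Y Z v" by (fact a)+
  show "u \<cdot> v = 0" by (rule Tri_comp_zero[OF t])
  obtain Z0 where Z0: "zero_object T Z0" by (rule zero_object_exists)
  hence Z0O: "Z0 \<in> Obj T" by (simp add: zero_object_def)
  note So = eqv_Obj[OF eqvS] and SO = eqv_arr[OF eqvS]
  fix W f
  {
    assume f: "arr W Y f" and z: "f \<cdot> v = 0"
    have W: "W \<in> Obj T" using f by (auto dest: arrD)
    have t1: "Tri T W Z0 (\<Sigma> W) 0 0 (- \<Sigma>m (idm W))" by (rule Tri_rot[OF Tri_ident[OF W Z0]])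
    have "\<exists>h. arr (\<Sigma> W) (\<Sigma> X) h \<and> 0 \<cdot> h = 0 \<cdot> w \<and> - \<Sigma>m (idm W) \<cdot> \<Sigma>m f = h \<cdot> - \<Sigma>m u"
      by (rule Tri_mor[OF t1 Tri_rot[OF t] f])
        (use Z0O W z arrD(2)[OF a(2)] cmp_zero'[OF arr_zero[OF W Z0O]] in auto)
    then obtain h where h: "arr (\<Sigma> W) (\<Sigma> X) h" "- \<Sigma>m (idm W) \<cdot> \<Sigma>m f = h \<cdot> - \<Sigma>m u" by blast
    have "\<Sigma>m (idm W) \<cdot> \<Sigma>m f = h \<cdot> \<Sigma>m u"
      using h uminus_cmp[OF SO[OF arr_id[OF W]] SO[OF f]] cmp_uminus[OF h(1) SO[OF a(1)]] by simp
    hence e: "\<Sigma>m f = h \<cdot> \<Sigma>m u" using eqv_id[OF eqvS W] id_left[OF SO[OF f]] by simp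
    obtain g where g: "arr W X g" "\<Sigma>m g = h" using eqv_full[OF eqvS W arrD(1)[OF a(1)] h(1)] by blast
    have "\<Sigma>m f = \<Sigma>m (g \<cdot> u)" using e g eqv_cmp[OF eqvS g(1) a(1)] by simp
    hence "f = g \<cdot> u" using eqv_faithful[OF eqvS f arr_cmp[OF g(1) a(1)]] by simp
    thus "\<exists>g. arr W X g \<and> f = g \<cdot> u" using g by blast
  }
  {
    assume f: "arr Y W f" and z: "u \<cdot> f = 0"
    have W: "W \<in> Obj T" using f by (auto dest: arrD)
    have SZ: "zero_object T (\<Sigma> Z0)"
      using Z0 So[OF Z0O] eqv_id[OF eqvS Z0O] eqv_zero[OF eqvS Z0O Z0O] by (simp add: zero_object_def)
    have "Tri T Z0 W W 0 (idm W) 0"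
      using Tri_rotate[OF Z0O W W, of 0 "idm W" 0] Tri_ident[OF W SZ] eqv_zero[OF eqvS Z0O W] Z0O W So
      by (auto simp: zero_Hom ident_Hom)
    then obtain h where h: "arr Z W h" "v \<cdot> h = f \<cdot> idm W"
      using Tri_mor[OF t _ _ f, of Z0 W 0 "idm W" 0 0] z a Z0O W by (auto dest: arrD)
    thus "\<exists>g. arr Z W g \<and> f = v \<cdot> g" using id_right[OF f] by auto
  }
qed

lemma Tri_ex3_2: "Tri T X Y Z u v w \<Longrightarrow> ex3 Y Z (\<Sigma> X) v w"
  using Tri_ex3 Tri_rot by blast

text \<open>Removes the sign that rotating a triangle puts on its last map.\<close>

lemma ex3_uminus: assumes "ex3 A B C u v" shows "ex3 A B C u (- v)"
proof -
  note d = ex3D[OF assms]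
  have n: "f \<cdot> - v = - (f \<cdot> v)" if "arr W B f" for W f using cmp_uminus[OF that d(2)] .
  have m: "v \<cdot> g = - v \<cdot> - g" if "arr C W g" for W g
    using uminus_cmp[OF d(2) arr_uminus[OF that]] cmp_uminus[OF d(2) that] by simp
  show ?thesis unfolding ex3_def
  proof (intro conjI allI impI)
    show "arr A B u" "arr B C (- v)" by (rule d(1), rule arr_uminus[OF d(2)])
    show "u \<cdot> - v = 0" using d(3) n[OF d(1)] by simp
    fix W f
    show "\<exists>g. arr W A g \<and> f = g \<cdot> u" if "arr W B f" "f \<cdot> - v = 0"
      using d(4)[OF that(1)] that(2) n[OF that(1)] by simp
    show "\<exists>g. arr C W g \<and> f = - v \<cdot> g" if f: "arr B W f" "u \<cdot> f = 0"
    proof -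
      obtain g where "arr C W g" "f = v \<cdot> g" using d(5)[OF f] by blast
      thus ?thesis using m[of W g] arr_uminus[of C W g] by auto
    qed
  qed
qed

lemma Tri_ex3_3: assumes "Tri T X Y Z u v w" shows "ex3 Z (\<Sigma> X) (\<Sigma> Y) w (\<Sigma>m u)"
  using ex3_uminus[OF Tri_ex3[OF Tri_rot[OF Tri_rot[OF assms]]]] by simp

text \<open>The test object W need not be a value of G. It is replaced by an isomorphic G V; there
  fullness and faithfulness move the lifting problem back to the original sequence.\<close>

lemma ex3_eqv:
  assumes G: "eqv G \<Phi>" and x: "ex3 A B C u v"
  shows "ex3 (G A) (G B) (G C) (\<Phi> A B u) (\<Phi> B C v)"
  unfolding ex3_def
proof (intro conjI allI impI)
  note d = ex3D[OF x]
  have o: "A \<in> Obj T" "B \<in> Obj T" "C \<in> Obj T" using d by (auto dest: arrD)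
  show a: "arr (G A) (G B) (\<Phi> A B u)" "arr (G B) (G C) (\<Phi> B C v)" using eqv_arr[OF G] d by blast+
  show "\<Phi> A B u \<cdot> \<Phi> B C v = 0" using eqv_cmp[OF G d(1,2)] d(3) eqv_zero[OF G] o by simp
  fix W f
  {
    assume f: "arr W (G B) f" and z: "f \<cdot> \<Phi> B C v = 0"
    obtain V where V: "V \<in> Obj T" "iso T (G V) W" using eqv_ess[OF G arrD(1)[OF f]] by blast
    then obtain p q where p: "arr (G V) W p" "arr W (G V) q" "q \<cdot> p = idm W" by (auto elim: isoE)
    obtain f' where f': "arr V B f'" "\<Phi> V B f' = p \<cdot> f"
      using eqv_full[OF G V(1) o(2) arr_cmp[OF p(1) f]] by blast
    have "\<Phi> V C (f' \<cdot> v) = 0" using eqv_cmp[OF G f'(1) d(2)] f' assoc[OF p(1) f a(2)] z p by simp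
    hence "f' \<cdot> v = 0" using eqv_ker[OF G arr_cmp[OF f'(1) d(2)]] by simp
    then obtain g where g: "arr V A g" "f' = g \<cdot> u" using d(4) f' by blast
    have e: "\<Phi> V A g \<cdot> \<Phi> A B u = p \<cdot> f" using eqv_cmp[OF G g(1) d(1)] g f' by simp
    have Gg: "arr (G V) (G A) (\<Phi> V A g)" by (rule eqv_arr[OF G g(1)])
    have "f = q \<cdot> (p \<cdot> f)" using assoc[OF p(2,1) f] p id_left[OF f] by simp
    also have "\<dots> = (q \<cdot> \<Phi> V A g) \<cdot> \<Phi> A B u" using e assoc[OF p(2) Gg a(1)] by simp
    finally show "\<exists>g. arr W (G A) g \<and> f = g \<cdot> \<Phi> A B u" using p Gg by blast
  }
  {
    assume f: "arr (G B) W f" and z: "\<Phi> A B u \<cdot> f = 0"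
    obtain V where V: "V \<in> Obj T" "iso T (G V) W" using eqv_ess[OF G arrD(2)[OF f]] by blast
    then obtain p q where p: "arr (G V) W p" "arr W (G V) q" "q \<cdot> p = idm W" by (auto elim: isoE)
    obtain f' where f': "arr B V f'" "\<Phi> B V f' = f \<cdot> q"
      using eqv_full[OF G o(2) V(1) arr_cmp[OF f p(2)]] by blast
    have "\<Phi> A V (u \<cdot> f') = 0" using eqv_cmp[OF G d(1) f'(1)] f' assoc[OF a(1) f p(2)] z p by simp
    hence "u \<cdot> f' = 0" using eqv_ker[OF G arr_cmp[OF d(1) f'(1)]] by simp
    then obtain g where g: "arr C V g" "f' = v \<cdot> g" using d(5) f' by blast
    have e: "\<Phi> B C v \<cdot> \<Phi> C V g = f \<cdot> q" using eqv_cmp[OF G d(2) g(1)] g f' by simp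
    have Gg: "arr (G C) (G V) (\<Phi> C V g)" by (rule eqv_arr[OF G g(1)])
    have "f = (f \<cdot> q) \<cdot> p" using assoc[OF f p(2,1)] p id_right[OF f] by simp
    also have "\<dots> = \<Phi> B C v \<cdot> (\<Phi> C V g \<cdot> p)" using e assoc[OF a(2) Gg p(1)] by simp
    finally show "\<exists>g. arr (G C) W g \<and> f = \<Phi> B C v \<cdot> g" using p Gg by blast
  }
qed

section \<open>Vanishing along triangles, five lemmas, splittings and minimality\<close>

lemma ex3_hom0_right: assumes "ex3 A B C u v" "hom0 W A" "hom0 W C" shows "hom0 W B"
  unfolding hom0_def
proof (intro allI impI)
  note d = ex3D[OF assms(1)]
  fix f assume f: "arr W B f"
  have "f \<cdot> v = 0" using f d assms by (auto simp: hom0_def)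
  then obtain g where g: "arr W A g" "f = g \<cdot> u" using d f by blast
  moreover have "g = 0" using g assms by (auto simp: hom0_def)
  ultimately show "f = 0" using d by auto
qed

lemma ex3_hom0_left: assumes "ex3 A B C u v" "hom0 A W" "hom0 C W" shows "hom0 B W"
  unfolding hom0_def
proof (intro allI impI)
  note d = ex3D[OF assms(1)]
  fix f assume f: "arr B W f"
  have "u \<cdot> f = 0" using f d assms by (auto simp: hom0_def)
  then obtain g where g: "arr C W g" "f = v \<cdot> g" using d f by blast
  moreover have "g = 0" using g assms by (auto simp: hom0_def)
  ultimately show "f = 0" using d by auto
qed

text \<open>The difference k = 1 - e is killed by v, hence factors through w, and kw = 0. So kk = 0,
  and 1 + k is the inverse.\<close>

lemma five_id:
  assumes t: "Tri T X Y Z u v w" and e: "arr Z Z e" and v: "v \<cdot> e = v" and w: "e \<cdot> w = w"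
  shows "inv_arr Z Z e"
proof -
  note a = Tri_arr[OF t]
  have Z: "arr Z Z (idm Z)" using e by (auto dest: arrD)
  define k where "k = idm Z - e"
  have k: "arr Z Z k" using e Z by (auto simp: k_def)
  have "v \<cdot> k = 0" using cmp_diff[OF a(2) Z e] v id_right[OF a(2)] by (simp add: k_def)
  then obtain h where h: "arr (\<Sigma> X) Z h" "k = w \<cdot> h" using ex3D(5)[OF Tri_ex3_2[OF t] k] by blast
  have "k \<cdot> w = 0" using diff_cmp[OF Z e a(3)] w id_left[OF a(3)] by (simp add: k_def)
  hence kk: "k \<cdot> k = 0" using h assoc[OF k a(3) h(1)] by simp
  have e': "e = idm Z - k" by (simp add: k_def)
  have ik: "arr Z Z (idm Z + k)" using Z k by auto
  have "e \<cdot> (idm Z + k) = idm Z"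
    using diff_cmp[OF Z k ik] cmp_add[OF k Z k] id_left[OF ik] id_right[OF k] kk by (simp add: e')
  moreover have "(idm Z + k) \<cdot> e = idm Z"
    using add_cmp[OF Z k e] id_left[OF e] cmp_diff[OF k Z k] id_right[OF k] kk by (simp add: e')
  ultimately show ?thesis using ik e by (auto simp: inv_arr_def)
qed

text \<open>The inverses of f and g extend to a morphism of triangles backwards with third component
  \<open>k\<close>; both hk and kh fix the two maps at the third object, so \<open>five_id\<close>
  applies to them.\<close>

lemma five3:
  assumes t: "Tri T X Y Z u v w" and t': "Tri T X' Y' Z' u' v' w'"
    and f: "inv_arr X X' f" and g: "inv_arr Y Y' g" and h: "arr Z Z' h"
    and s1: "u \<cdot> g = f \<cdot> u'" and s2: "v \<cdot> h = g \<cdot> v'" and s3: "w \<cdot> \<Sigma>m f = h \<cdot> w'"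
  shows "inv_arr Z Z' h"
proof -
  note a = Tri_arr[OF t] and a' = Tri_arr[OF t']
  from f obtain f' where f: "arr X X' f" "arr X' X f'" "f \<cdot> f' = idm X" "f' \<cdot> f = idm X'"
    by (auto simp: inv_arr_def)
  from g obtain g' where g: "arr Y Y' g" "arr Y' Y g'" "g \<cdot> g' = idm Y" "g' \<cdot> g = idm Y'"
    by (auto simp: inv_arr_def)
  have o: "X \<in> Obj T" "X' \<in> Obj T" using f by (auto dest: arrD)
  have "u' \<cdot> g' = (f' \<cdot> f) \<cdot> (u' \<cdot> g')" using f id_left[OF arr_cmp[OF a'(1) g(2)]] by simp
  also have "\<dots> = f' \<cdot> ((f \<cdot> u') \<cdot> g')"
    using assoc[OF f(2,1) arr_cmp[OF a'(1) g(2)]] assoc[OF f(1) a'(1) g(2)] by simp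
  also have "\<dots> = f' \<cdot> (u \<cdot> (g \<cdot> g'))" using s1 assoc[OF a(1) g(1,2)] by simp
  also have "\<dots> = f' \<cdot> u" using g id_right[OF a(1)] by simp
  finally obtain k where k: "arr Z' Z k" "v' \<cdot> k = g' \<cdot> v" "w' \<cdot> \<Sigma>m f' = k \<cdot> w"
    using Tri_mor[OF t' t f(2) g(2)] by blast
  have Sf: "arr (\<Sigma> X) (\<Sigma> X') (\<Sigma>m f)" "arr (\<Sigma> X') (\<Sigma> X) (\<Sigma>m f')" using f eqv_arr[OF eqvS] by blast+
  have Sff: "\<Sigma>m f \<cdot> \<Sigma>m f' = idm (\<Sigma> X)" "\<Sigma>m f' \<cdot> \<Sigma>m f = idm (\<Sigma> X')"
    using eqv_cmp[OF eqvS f(1,2)] eqv_cmp[OF eqvS f(2,1)] f eqv_id[OF eqvS] o by auto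
  have "inv_arr Z Z (h \<cdot> k)"
  proof (rule five_id[OF t])
    show "v \<cdot> (h \<cdot> k) = v"
      using assoc[OF a(2) h k(1)] s2 assoc[OF g(1) a'(2) k(1)] k(2) assoc[OF g(1,2) a(2)] g
        id_left[OF a(2)] by simp
    show "(h \<cdot> k) \<cdot> w = w"
      using assoc[OF h k(1) a(3)] k(3) assoc[OF h a'(3) Sf(2)] s3 assoc[OF a(3) Sf(1,2)] Sff
        id_right[OF a(3)] by simp
  qed (use h k in auto)
  moreover have "inv_arr Z' Z' (k \<cdot> h)"
  proof (rule five_id[OF t'])
    show "v' \<cdot> (k \<cdot> h) = v'"
      using assoc[OF a'(2) k(1) h] s2 assoc[OF g(2) a(2) h] k(2) assoc[OF g(2,1) a'(2)] g
        id_left[OF a'(2)] by simp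
    show "(k \<cdot> h) \<cdot> w' = w'"
      using assoc[OF k(1) h a'(3)] k(3) assoc[OF k(1) a(3) Sf(1)] s3 assoc[OF a'(3) Sf(2,1)] Sff
        id_right[OF a'(3)] by simp
  qed (use h k in auto)
  ultimately show ?thesis using inv_of_two_sided[OF h k(1)] by blast
qed

lemma five1:
  assumes t: "Tri T X Y Z u v w" and t': "Tri T X' Y' Z' u' v' w'"
    and f: "arr X X' f" and g: "inv_arr Y Y' g" and h: "inv_arr Z Z' h"
    and s1: "u \<cdot> g = f \<cdot> u'" and s2: "v \<cdot> h = g \<cdot> v'" and s3: "w \<cdot> \<Sigma>m f = h \<cdot> w'"
  shows "inv_arr X X' f"
proof -
  note a = Tri_arr[OF t] and a' = Tri_arr[OF t'] and S = eqv_arr[OF eqvS]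
  have g': "arr Y Y' g" using g by (rule inv_arr_arr)
  have "\<Sigma>m u \<cdot> \<Sigma>m g = \<Sigma>m f \<cdot> \<Sigma>m u'"
    using eqv_cmp[OF eqvS a(1) g'] eqv_cmp[OF eqvS f a'(1)] s1 by simp
  hence s: "- \<Sigma>m u \<cdot> \<Sigma>m g = \<Sigma>m f \<cdot> - \<Sigma>m u'"
    using uminus_cmp[OF S[OF a(1)] S[OF g']] cmp_uminus[OF S[OF f] S[OF a'(1)]] by simp
  have "inv_arr (\<Sigma> X) (\<Sigma> X') (\<Sigma>m f)"
    by (rule five3[OF Tri_rot[OF t] Tri_rot[OF t'] g h S[OF f] s2 s3 s])
  thus ?thesis using eqv_inv_reflect[OF eqvS f] by blast
qed

text \<open>The complement is the cone B of the split monomorphism \<open>s\<close>. The connecting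
  map w composed with the split monomorphism s[1] is zero, so w = 0 and the projection onto B has a
  section.\<close>

lemma complement:
  assumes s: "arr A X s" and t: "arr X A t" and st: "s \<cdot> t = idm A"
  shows "\<exists>B q p. direct_sum_via T [A, B] X (\<lambda>i. if i = 0 then s else q) (\<lambda>i. if i = 0 then t else p)"
proof -
  have o: "A \<in> Obj T" "X \<in> Obj T" using s by (auto dest: arrD)
  obtain B p w where tr: "Tri T A X B s p w" using Tri_cone[OF o arrD(3)[OF s]] by blast
  note a = Tri_arr[OF tr] and S = eqv_arr[OF eqvS]
  have B: "B \<in> Obj T" using a by (auto dest: arrD)
  have "w = w \<cdot> (\<Sigma>m s \<cdot> \<Sigma>m t)"
    using eqv_cmp[OF eqvS s t] st eqv_id[OF eqvS o(1)] id_right[OF a(3)] by simp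
  also have "\<dots> = 0" using assoc[OF a(3) S[OF s] S[OF t]] ex3D(3)[OF Tri_ex3_3[OF tr]] S[OF t] by simp
  finally have w: "w = 0" .
  have "idm B \<cdot> w = 0" using w arr_id[OF B] by simp
  then obtain r where r: "arr B X r" "idm B = r \<cdot> p"
    using ex3D(4)[OF Tri_ex3_2[OF tr] arr_id[OF B]] by blast
  have ts: "arr X X (t \<cdot> s)" using s t by auto
  \<comment> \<open>The section \<open>r\<close> is corrected by its component in A, so that
    \<open>q\<close> followed by \<open>t\<close> becomes zero.\<close>
  define q where "q = r - r \<cdot> (t \<cdot> s)"
  have q: "arr B X q" using r ts by (auto simp: q_def)
  have tst: "(t \<cdot> s) \<cdot> t = t" using assoc[OF t s t] st id_right[OF t] by simp
  have tsp: "(t \<cdot> s) \<cdot> p = 0" using assoc[OF t s a(2)] ex3D(3)[OF Tri_ex3[OF tr]] t by simp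
  have qt: "q \<cdot> t = 0" using diff_cmp[OF r(1) arr_cmp[OF r(1) ts] t] assoc[OF r(1) ts t] tst by (simp add: q_def)
  have qp: "q \<cdot> p = idm B"
    using diff_cmp[OF r(1) arr_cmp[OF r(1) ts] a(2)] assoc[OF r(1) ts a(2)] tsp r by (simp add: q_def)
  have sp: "s \<cdot> p = 0" using ex3D(3)[OF Tri_ex3[OF tr]] .
  have pq: "arr X X (p \<cdot> q)" using a q by auto
  define d where "d = idm X - t \<cdot> s - p \<cdot> q"
  have i: "arr X X (idm X)" using o by auto
  have d: "arr X X d" using i ts pq by (auto simp: d_def)
  have "d \<cdot> p = 0"
    using diff_cmp[OF arr_diff[OF i ts] pq a(2)] diff_cmp[OF i ts a(2)] tsp assoc[OF a(2) q a(2)] qp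
      id_left[OF a(2)] id_right[OF a(2)] by (simp add: d_def)
  then obtain v where v: "arr X A v" "d = v \<cdot> s" using ex3D(4)[OF Tri_ex3[OF tr] d] by blast
  have "d \<cdot> t = 0"
    using diff_cmp[OF arr_diff[OF i ts] pq t] diff_cmp[OF i ts t] tst assoc[OF a(2) q t] qt a(2)
      id_left[OF t] by (simp add: d_def)
  moreover have "d \<cdot> t = v" using v assoc[OF v(1) s t] st id_right[OF v(1)] by simp
  ultimately have "d = 0" using v s by simp
  hence e: "t \<cdot> s + p \<cdot> q = idm X" by (simp add: d_def algebra_simps)
  show ?thesis
  proof (intro exI)
    show "direct_sum_via T [A, B] X (\<lambda>i. if i = 0 then s else q) (\<lambda>i. if i = 0 then t else p)"
      using o B s t q a(2) st qp qt sp e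
      by (auto simp: direct_sum_via_def arr_def less_Suc_eq lessThan_Suc add.commute)
  qed
qed

text \<open>Turns minimality, defined by summands, into the form used in practice: an endomorphism
  killed by f is radical. Otherwise some local A has an invertible composite through e, and
  \<open>s \<cdot> e\<close> embeds A as a summand of X on which f vanishes.\<close>

lemma right_minimal_inv:
  assumes m: "right_minimal T X Y f" and o: "X \<in> Obj T" "Y \<in> Obj T" and e: "arr X X e" and z: "e \<cdot> f = 0"
  shows "inv_arr X X (idm X - e)"
proof -
  have f: "arr X Y f" using m o by (auto simp: right_minimal_def arr_def)
  have "rad X X e"
  proof (rule rad_of_local[OF e], rule notI)
    fix A s t assume l: "local_end T A" and s: "arr A X s" and t: "arr X A t"
      and i: "inv_arr A A (s \<cdot> (e \<cdot> t))"
    then obtain u where u: "arr A A u" "(s \<cdot> (e \<cdot> t)) \<cdot> u = idm A" by (auto simp: inv_arr_def)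
    have s': "arr A X (s \<cdot> e)" and t': "arr X A (t \<cdot> u)" using s t e u by auto
    have "(s \<cdot> e) \<cdot> (t \<cdot> u) = idm A"
      using assoc[OF s e t'] assoc[OF e t u(1)] assoc[OF s arr_cmp[OF e t] u(1)] u by simp
    from complement[OF s' t' this] obtain B q p where
      "direct_sum_via T [A, B] X (\<lambda>i. if i = 0 then s \<cdot> e else q) (\<lambda>i. if i = 0 then t \<cdot> u else p)" by blast
    moreover have "(s \<cdot> e) \<cdot> f = 0" using assoc[OF s e f] z s by simp
    moreover have "\<not> zero_object T A" using local_nz[OF l] by (simp add: zero_object_def)
    ultimately show False using m unfolding right_minimal_def by fastforce
  qed
  thus ?thesis using id_right[OF e] arr_id[OF o(1)] unfolding rad_def by metis
qed

lemma left_minimal_inv: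
  assumes m: "left_minimal T X Y f" and o: "X \<in> Obj T" "Y \<in> Obj T" and e: "arr Y Y e" and z: "f \<cdot> e = 0"
  shows "inv_arr Y Y (idm Y - e)"
proof -
  have f: "arr X Y f" using m o by (auto simp: left_minimal_def arr_def)
  have "rad Y Y e"
  proof (rule rad_of_local[OF e], rule notI)
    fix A s t assume l: "local_end T A" and s: "arr A Y s" and t: "arr Y A t"
      and i: "inv_arr A A (s \<cdot> (e \<cdot> t))"
    then obtain u where u: "arr A A u" "u \<cdot> (s \<cdot> (e \<cdot> t)) = idm A" by (auto simp: inv_arr_def)
    have s': "arr A Y (u \<cdot> s)" and t': "arr Y A (e \<cdot> t)" using s t e u by auto
    have "(u \<cdot> s) \<cdot> (e \<cdot> t) = idm A" using assoc[OF u(1) s t'] u by simp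
    from complement[OF s' t' this] obtain B q p where
      "direct_sum_via T [A, B] Y (\<lambda>i. if i = 0 then u \<cdot> s else q) (\<lambda>i. if i = 0 then e \<cdot> t else p)" by blast
    moreover have "f \<cdot> (e \<cdot> t) = 0" using assoc[OF f e t] z t by simp
    moreover have "\<not> zero_object T A" using local_nz[OF l] by (simp add: zero_object_def)
    ultimately show False using m unfolding left_minimal_def by fastforce
  qed
  thus ?thesis using id_right[OF e] arr_id[OF o(2)] unfolding rad_def by metis
qed

end

subsection \<open>Subcategories and their indecomposables\<close>

context triangulated_category
begin

lemma local_iso:
  assumes i: "iso T A X" and l: "local_end T A" shows "local_end T X"
proof -
  \<comment> \<open>Renaming A to X on objects is a quasi-inverse of the identity functor, hence an
    equivalence, and equivalences preserve locality.\<close>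
  have "\<exists>\<Psi>. eqv (\<lambda>Y. if Y = A then X else Y) \<Psi>"
    using i iso_refl iso_sym iso_Obj by (intro eqv_inverse[OF eqv_ident]) auto
  then obtain \<Psi> where "eqv (\<lambda>Y. if Y = A then X else Y) \<Psi>" by blast
  from eqv_local[OF this local_Obj[OF l]] l show ?thesis by simp
qed

lemma indecomposable_iff_local: "indecomposable T X \<longleftrightarrow> local_end T X"
proof
  assume l: "local_end T X"
  have "zero_object T Y \<or> zero_object T Z" if d: "direct_sum T [Y, Z] X" for Y Z
  proof (rule ccontr)
    assume n: "\<not> (zero_object T Y \<or> zero_object T Z)"
    from d obtain \<iota> \<pi> where d: "direct_sum_via T [Y, Z] X \<iota> \<pi>" by (auto simp: direct_sum_def)
    note e = dsvE[OF d]
    have 0: "arr Y X (\<iota> 0)" "arr X Y (\<pi> 0)" "\<iota> 0 \<cdot> \<pi> 0 = idm Y"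
      and 1: "arr Z X (\<iota> 1)" "arr X Z (\<pi> 1)" "\<iota> 1 \<cdot> \<pi> 1 = idm Z" "\<iota> 1 \<cdot> \<pi> 0 = 0"
      using e(2-4)[of 0] e(2-4)[of 1] e(5)[of 1 0] by auto
    have o: "Y \<in> Obj T" "Z \<in> Obj T" using 0 1 by (auto dest: arrD)
    have "\<pi> 0 \<cdot> \<iota> 0 = idm X" using local_split[OF l 0] n o by (auto simp: zero_object_def)
    hence "\<iota> 1 = (\<iota> 1 \<cdot> \<pi> 0) \<cdot> \<iota> 0" using assoc[OF 1(1) 0(2,1)] id_right[OF 1(1)] by simp
    hence "idm Z = 0" using 1 0 by auto
    thus False using n o by (simp add: zero_object_def)
  qed
  thus "indecomposable T X" using l by (auto simp: indecomposable_def zero_object_def local_end_def)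
next
  assume i: "indecomposable T X"
  hence X: "X \<in> Obj T" "idm X \<noteq> 0" by (auto simp: indecomposable_def zero_object_def)
  obtain Xs \<iota> \<pi> where d: "direct_sum_via T Xs X \<iota> \<pi>" and l: "\<And>A. A \<in> set Xs \<Longrightarrow> local_end T A"
    using ks_via[OF X(1)] by blast
  have "Xs \<noteq> []" using dsvE(6)[OF d] X by auto
  then obtain A where A: "A \<in> set Xs" by (meson last_in_set)
  have r: "retract A X" using ds_retract[of Xs X A] d A by (auto simp: direct_sum_def)
  then obtain s t where st: "arr A X s" "arr X A t" "s \<cdot> t = idm A" by (auto simp: retract_def)
  from complement[OF st] obtain B q p where
    d2: "direct_sum_via T [A, B] X (\<lambda>i. if i = 0 then s else q) (\<lambda>i. if i = 0 then t else p)" by blast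
  have "\<not> zero_object T A" using l[OF A] by (auto simp: zero_object_def dest: local_nz)
  moreover have "direct_sum T [A, B] X" using d2 by (auto simp: direct_sum_def)
  ultimately have B: "zero_object T B" using i unfolding indecomposable_def by blast
  note e = dsvE[OF d2]
  have p: "arr X B p" and q: "arr B X q" using e(3)[of 1] e(2)[of 1] by auto
  have "p = 0" using zero_object_hom0(1)[OF B X(1)] p by (auto simp: hom0_def)
  hence "t \<cdot> s = idm X" using e(6) q by (simp add: lessThan_Suc)
  hence "iso T A X" using st by (intro isoI)
  thus "local_end T X" using l[OF A] local_iso by blast
qed

context
  fixes D assumes D: "subcategory T D"
begin

lemma sub_Obj: "Y \<in> D \<Longrightarrow> Y \<in> Obj T"
  using D unfolding subcategory_def by (elim conjE) (rule subsetD)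
lemma sub_iso: "Y \<in> D \<Longrightarrow> iso T Y Z \<Longrightarrow> Z \<in> D"
  using D unfolding subcategory_def by metis
lemma sub_sum: "set Xs \<subseteq> D \<Longrightarrow> direct_sum T Xs Y \<Longrightarrow> Y \<in> D"
  using D unfolding subcategory_def by blast

lemma sub_retract: assumes "Y \<in> D" "retract A Y" shows "A \<in> D"
proof -
  obtain s t where st: "arr A Y s" "arr Y A t" "s \<cdot> t = idm A" using assms by (auto simp: retract_def)
  from complement[OF st] obtain B where "direct_sum T [A, B] Y" by (auto simp: direct_sum_def)
  thus ?thesis using D assms unfolding subcategory_def by blast
qed

lemma sub_zero: "\<exists>Z\<in>D. zero_object T Z"
proof -
  obtain Z where Z: "direct_sum T [] Z" using ex_direct_sum[of "[]"] by auto
  hence "Z \<in> D" by (intro sub_sum[of "[]"]) auto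
  thus ?thesis using Z by (auto simp: direct_sum_def direct_sum_via_def zero_object_def)
qed

lemma sub_local: "Y \<in> Obj T \<Longrightarrow> (\<And>A. local_end T A \<Longrightarrow> retract A Y \<Longrightarrow> A \<in> D) \<Longrightarrow> Y \<in> D"
  using krull_schmidt[of Y] sub_sum ds_retract by (metis subsetI)

lemma sub_ind: "local_end T A \<Longrightarrow> isoclass T A \<in> ind T D \<longleftrightarrow> A \<in> D"
proof
  assume l: "local_end T A" and "isoclass T A \<in> ind T D"
  then obtain B where "B \<in> D" "isoclass T A = isoclass T B" by (auto simp: ind_def)
  thus "A \<in> D" using isoclass_eq[OF local_Obj[OF l]] iso_sym sub_iso by blast
qed (auto simp: ind_def indecomposable_iff_local)

end

section \<open>Subcategories determined by their indecomposables\<close>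

lemma ind_local: "c \<in> ind T D \<Longrightarrow> \<exists>A\<in>D. local_end T A \<and> c = isoclass T A"
  by (auto simp: ind_def indecomposable_iff_local)

lemma ind_local_mem:
  "subcategory T D \<Longrightarrow> c \<in> ind T D \<longleftrightarrow> (\<exists>A. local_end T A \<and> A \<in> D \<and> c = isoclass T A)"
  by (auto simp: ind_def indecomposable_iff_local)

text \<open>Described by indecomposable summands rather than by sums, so that membership is tested
  on local objects. It is inverse to \<open>ind\<close> by \<open>ind_addcl\<close> and
  \<open>addcl_ind\<close>.\<close>

definition addcl :: "'o set set \<Rightarrow> 'o set" where
  "addcl F = {Y \<in> Obj T. \<forall>A. local_end T A \<longrightarrow> retract A Y \<longrightarrow> isoclass T A \<in> F}"

lemma addcl_local: "local_end T A \<Longrightarrow> A \<in> addcl F \<longleftrightarrow> isoclass T A \<in> F"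
proof
  assume l: "local_end T A"
  show "isoclass T A \<in> F" if "A \<in> addcl F"
    using that l iso_retract[OF iso_refl] local_Obj[OF l] by (auto simp: addcl_def)
  show "A \<in> addcl F" if "isoclass T A \<in> F"
  proof -
    have "isoclass T B \<in> F" if B: "local_end T B" "retract B A" for B
      using local_iso_of_retract[OF B(1) l B(2)] isoclass_eq[OF local_Obj[OF B(1)], of A] \<open>isoclass T A \<in> F\<close>
      by simp
    thus ?thesis using local_Obj[OF l] by (auto simp: addcl_def)
  qed
qed

lemma subcategory_addcl: "subcategory T (addcl F)"
  unfolding subcategory_def
proof (intro conjI ballI allI impI)
  show "addcl F \<subseteq> Obj T" by (auto simp: addcl_def)
next
  fix X Y assume "X \<in> addcl F" "iso T X Y"
  thus "Y \<in> addcl F" using retract_iso_right[of X Y] iso_Obj by (auto simp: addcl_def)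
next
  fix Xs S assume "set Xs \<subseteq> addcl F \<and> direct_sum T Xs S"
  hence Xs: "set Xs \<subseteq> addcl F" and d: "direct_sum T Xs S" by auto
  have S: "S \<in> Obj T" using d by (auto simp: direct_sum_def direct_sum_via_def)
  have "isoclass T A \<in> F" if "local_end T A" "retract A S" for A
    using local_retract_ds[OF that(1) d that(2)] Xs that(1) by (auto simp: addcl_def)
  thus "S \<in> addcl F" using S by (auto simp: addcl_def)
next
  fix X Y S assume "S \<in> addcl F \<and> direct_sum T [X, Y] S"
  hence S: "S \<in> addcl F" and d: "direct_sum T [X, Y] S" by auto
  have "retract X S" using ds_retract[OF d] by auto
  thus "X \<in> addcl F" using S retract_trans retract_Obj unfolding addcl_def by blast
qed

lemma ind_addcl:
  assumes "\<And>c. c \<in> F \<Longrightarrow> \<exists>A. local_end T A \<and> c = isoclass T A"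
  shows "ind T (addcl F) = F"
proof (intro set_eqI iffI)
  fix c assume "c \<in> F"
  thus "c \<in> ind T (addcl F)" using assms[of c] addcl_local ind_local_mem[OF subcategory_addcl] by metis
next
  fix c assume "c \<in> ind T (addcl F)"
  thus "c \<in> F" using addcl_local ind_local_mem[OF subcategory_addcl] by metis
qed

lemma addcl_ind: assumes D: "subcategory T D" shows "addcl (ind T D) = D"
proof
  show "addcl (ind T D) \<subseteq> D" using sub_local[OF D] sub_ind[OF D] by (auto simp: addcl_def)
  show "D \<subseteq> addcl (ind T D)"
    using sub_retract[OF D] sub_ind[OF D] sub_Obj[OF D] by (auto simp: addcl_def)
qed

subsection \<open>Approximations\<close>

lemma right_approximation_iff:
  assumes D: "subcategory T D" and W: "W \<in> Obj T"
  shows "right_approximation T D A W p \<longleftrightarrow>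
    A \<in> D \<and> arr A W p \<and> (\<forall>Z h. Z \<in> D \<longrightarrow> arr Z W h \<longrightarrow> (\<exists>g. arr Z A g \<and> h = g \<cdot> p))"
proof
  assume a: "right_approximation T D A W p"
  hence "A \<in> D" "arr A W p" using sub_Obj[OF D] W by (auto simp: right_approximation_def arr_def)
  moreover have "\<exists>g. arr Z A g \<and> h = g \<cdot> p" if "Z \<in> D" "arr Z W h" for Z h
  proof -
    have "h \<in> (\<lambda>h. h \<cdot> p) ` Hom T Z A" using a that by (auto simp: right_approximation_def arr_def)
    thus ?thesis using sub_Obj[OF D] \<open>A \<in> D\<close> that(1) by (auto simp: arr_def)
  qed
  ultimately show "A \<in> D \<and> arr A W p \<and> (\<forall>Z h. Z \<in> D \<longrightarrow> arr Z W h \<longrightarrow> (\<exists>g. arr Z A g \<and> h = g \<cdot> p))"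
    by blast
next
  assume a: "A \<in> D \<and> arr A W p \<and> (\<forall>Z h. Z \<in> D \<longrightarrow> arr Z W h \<longrightarrow> (\<exists>g. arr Z A g \<and> h = g \<cdot> p))"
  have "(\<lambda>h. h \<cdot> p) ` Hom T Z A = Hom T Z W" if Z: "Z \<in> D" for Z
  proof
    have o: "Z \<in> Obj T" "A \<in> Obj T" using Z a sub_Obj[OF D] by auto
    show "(\<lambda>h. h \<cdot> p) ` Hom T Z A \<subseteq> Hom T Z W"
      using a o W cmp_Hom[of Z A W _ p] by (auto simp: arr_def)
    show "Hom T Z W \<subseteq> (\<lambda>h. h \<cdot> p) ` Hom T Z A"
    proof
      fix h assume "h \<in> Hom T Z W"
      hence "arr Z W h" using o W by (simp add: arr_def)
      then obtain g where "arr Z A g" "h = g \<cdot> p" using a Z by blast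
      thus "h \<in> (\<lambda>h. h \<cdot> p) ` Hom T Z A" by (auto simp: arr_def)
    qed
  qed
  thus "right_approximation T D A W p" using a by (auto simp: right_approximation_def arr_def)
qed

lemma left_approximation_iff:
  assumes D: "subcategory T D" and W: "W \<in> Obj T"
  shows "left_approximation T D W A p \<longleftrightarrow>
    A \<in> D \<and> arr W A p \<and> (\<forall>Z h. Z \<in> D \<longrightarrow> arr W Z h \<longrightarrow> (\<exists>g. arr A Z g \<and> h = p \<cdot> g))"
proof
  assume a: "left_approximation T D W A p"
  hence "A \<in> D" "arr W A p" using sub_Obj[OF D] W by (auto simp: left_approximation_def arr_def)
  moreover have "\<exists>g. arr A Z g \<and> h = p \<cdot> g" if "Z \<in> D" "arr W Z h" for Z h
  proof -
    have "h \<in> (\<lambda>h. p \<cdot> h) ` Hom T A Z" using a that by (auto simp: left_approximation_def arr_def)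
    thus ?thesis using sub_Obj[OF D] \<open>A \<in> D\<close> that(1) by (auto simp: arr_def)
  qed
  ultimately show "A \<in> D \<and> arr W A p \<and> (\<forall>Z h. Z \<in> D \<longrightarrow> arr W Z h \<longrightarrow> (\<exists>g. arr A Z g \<and> h = p \<cdot> g))"
    by blast
next
  assume a: "A \<in> D \<and> arr W A p \<and> (\<forall>Z h. Z \<in> D \<longrightarrow> arr W Z h \<longrightarrow> (\<exists>g. arr A Z g \<and> h = p \<cdot> g))"
  have "(\<lambda>h. p \<cdot> h) ` Hom T A Z = Hom T W Z" if Z: "Z \<in> D" for Z
  proof
    have o: "Z \<in> Obj T" "A \<in> Obj T" using Z a sub_Obj[OF D] by auto
    show "(\<lambda>h. p \<cdot> h) ` Hom T A Z \<subseteq> Hom T W Z"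
      using a o W cmp_Hom[of W A Z p] by (auto simp: arr_def)
    show "Hom T W Z \<subseteq> (\<lambda>h. p \<cdot> h) ` Hom T A Z"
    proof
      fix h assume "h \<in> Hom T W Z"
      hence "arr W Z h" using o W by (simp add: arr_def)
      then obtain g where "arr A Z g" "h = p \<cdot> g" using a Z by blast
      thus "h \<in> (\<lambda>h. p \<cdot> h) ` Hom T A Z" by (auto simp: arr_def)
    qed
  qed
  thus "left_approximation T D W A p" using a by (auto simp: left_approximation_def arr_def)
qed

lemma right_approximation_local:
  assumes D: "subcategory T D" and A: "A \<in> D" and p: "arr A W p"
    and l: "\<And>Z h. local_end T Z \<Longrightarrow> Z \<in> D \<Longrightarrow> arr Z W h \<Longrightarrow> \<exists>g. arr Z A g \<and> h = g \<cdot> p"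
  shows "right_approximation T D A W p"
proof -
  have W: "W \<in> Obj T" using p by (auto dest: arrD)
  have "\<exists>g. arr Z A g \<and> h = g \<cdot> p" if Z: "Z \<in> D" and h: "arr Z W h" for Z h
  proof -
    obtain Xs \<iota> \<pi> where d: "direct_sum_via T Xs Z \<iota> \<pi>" and lo: "\<And>A. A \<in> set Xs \<Longrightarrow> local_end T A"
      using ks_via[OF sub_Obj[OF D Z]] by blast
    note e = dsvE[OF d]
    have "\<exists>g. arr (Xs ! i) A g \<and> \<iota> i \<cdot> h = g \<cdot> p" if i: "i < length Xs" for i
    proof (rule l)
      show "local_end T (Xs ! i)" using lo i by auto
      show "Xs ! i \<in> D"
        using sub_retract[OF D Z] ds_retract[of Xs Z "Xs ! i"] d i by (auto simp: direct_sum_def)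
      show "arr (Xs ! i) W (\<iota> i \<cdot> h)" using e(2)[OF i] h by auto
    qed
    then obtain g where g: "\<And>i. i < length Xs \<Longrightarrow> arr (Xs ! i) A (g i) \<and> \<iota> i \<cdot> h = g i \<cdot> p" by metis
    have a: "arr Z A (\<pi> i \<cdot> g i)" if "i < length Xs" for i using e(3)[OF that] g[OF that] by blast
    have o: "Z \<in> Obj T" "A \<in> Obj T" using Z A sub_Obj[OF D] by auto
    have "h = (\<Sum>i<length Xs. \<pi> i \<cdot> (\<iota> i \<cdot> h))" by (rule ds_expand_left[OF d h])
    also have "\<dots> = (\<Sum>i<length Xs. (\<pi> i \<cdot> g i) \<cdot> p)"
    proof (intro sum.cong refl)
      fix i assume "i \<in> {..<length Xs}"
      hence i: "i < length Xs" by simp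
      have gi: "arr (Xs ! i) A (g i)" using g[OF i] by blast
      show "\<pi> i \<cdot> (\<iota> i \<cdot> h) = (\<pi> i \<cdot> g i) \<cdot> p" using g[OF i] assoc[OF e(3)[OF i] gi p] by simp
    qed
    also have "\<dots> = (\<Sum>i<length Xs. \<pi> i \<cdot> g i) \<cdot> p"
      using a p o by (intro sum_cmp[symmetric, of _ Z A]) auto
    finally have "h = (\<Sum>i<length Xs. \<pi> i \<cdot> g i) \<cdot> p" .
    moreover have "arr Z A (\<Sum>i<length Xs. \<pi> i \<cdot> g i)" by (rule arr_sum) (use a o in auto)
    ultimately show ?thesis by blast
  qed
  thus ?thesis using right_approximation_iff[OF D W] A p by blast
qed

text \<open>The direct sum of the sources, with the given maps as components, does it. This is how
  approximations are later assembled from finitely many pieces.\<close>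

lemma dominate_finite:
  assumes D: "subcategory T D" and W: "W \<in> Obj T" and f: "finite P"
    and P: "\<And>A f. (A, f) \<in> P \<Longrightarrow> A \<in> D \<and> arr A W f"
  shows "\<exists>A p. A \<in> D \<and> arr A W p \<and> (\<forall>A' f. (A', f) \<in> P \<longrightarrow> (\<exists>u. arr A' A u \<and> f = u \<cdot> p))"
  using f P
proof (induct P rule: finite_induct)
  case empty
  obtain Z where Z: "Z \<in> D" using sub_zero[OF D] by blast
  thus ?case using W sub_Obj[OF D] by (intro exI[of _ Z] exI[of _ 0]) auto
next
  case (insert x P)
  obtain B f where x: "x = (B, f)" by fastforce
  have f: "B \<in> D" "arr B W f" using insert.prems[of B f] x by auto
  obtain A p where p: "A \<in> D" "arr A W p" "\<forall>A' f. (A', f) \<in> P \<longrightarrow> (\<exists>u. arr A' A u \<and> f = u \<cdot> p)"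
    using insert.hyps(3) insert.prems by (metis insertI2)
  have o: "A \<in> Obj T" "B \<in> Obj T" using f p sub_Obj[OF D] by auto
  obtain S where S: "direct_sum T [A, B] S" using ex_direct_sum[of "[A, B]"] o by auto
  then obtain \<iota> \<pi> where d: "direct_sum_via T [A, B] S \<iota> \<pi>" by (auto simp: direct_sum_def)
  have SD: "S \<in> D" by (rule sub_sum[OF D _ S]) (use f p in auto)
  note e = dsvE[OF d]
  have a: "arr A S (\<iota> 0)" "arr S A (\<pi> 0)" "\<iota> 0 \<cdot> \<pi> 0 = idm A" "\<iota> 0 \<cdot> \<pi> 1 = 0"
    and b: "arr B S (\<iota> 1)" "arr S B (\<pi> 1)" "\<iota> 1 \<cdot> \<pi> 1 = idm B" "\<iota> 1 \<cdot> \<pi> 0 = 0"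
    using e(2-4)[of 0] e(2-4)[of 1] e(5)[of 0 1] e(5)[of 1 0] by auto
  define q where "q = \<pi> 0 \<cdot> p + \<pi> 1 \<cdot> f"
  have p0: "arr S W (\<pi> 0 \<cdot> p)" and f1: "arr S W (\<pi> 1 \<cdot> f)" using a b p f by auto
  have q: "arr S W q" unfolding q_def using p0 f1 by auto
  have "\<iota> 0 \<cdot> q = p"
    unfolding q_def using cmp_add[OF a(1) p0 f1] assoc[OF a(1,2) p(2)] assoc[OF a(1) b(2) f(2)] a(3,4)
      id_left[OF p(2)] f by simp
  hence "\<exists>u. arr A' S u \<and> g = u \<cdot> q" if g: "(A', g) \<in> P" for A' g
  proof -
    obtain u where u: "arr A' A u" "g = u \<cdot> p" using p(3) g by blast
    hence "g = (u \<cdot> \<iota> 0) \<cdot> q" using assoc[OF u(1) a(1) q] \<open>\<iota> 0 \<cdot> q = p\<close> by simp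
    thus ?thesis using u a by blast
  qed
  moreover have "\<iota> 1 \<cdot> q = f"
    unfolding q_def using cmp_add[OF b(1) p0 f1] assoc[OF b(1,2) f(2)] assoc[OF b(1) a(2) p(2)] b(3,4)
      id_left[OF f(2)] p by simp
  hence "\<exists>u. arr B S u \<and> f = u \<cdot> q" using b by blast
  ultimately show ?case using SD q x by (intro exI[of _ S] exI[of _ q]) blast
qed

text \<open>The maps factoring through \<open>p\<close> form a subspace, so generators suffice.
  Together with finite-dimensional Hom-spaces it replaces all maps from one object by finitely
  many.\<close>

lemma factor_span:
  assumes Hs: "Hom T Z W = module.span (smul T) B" and o: "Z \<in> Obj T" and p: "arr A W p"
    and B: "\<And>b. b \<in> B \<Longrightarrow> \<exists>u. arr Z A u \<and> b = u \<cdot> p" and h: "arr Z W h"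
  shows "\<exists>u. arr Z A u \<and> h = u \<cdot> p"
proof -
  interpret vector_space "smul T" by (rule ambient)
  have A: "A \<in> Obj T" "W \<in> Obj T" using p by (auto dest: arrD)
  let ?U = "{h. \<exists>u. arr Z A u \<and> h = u \<cdot> p}"
  have "subspace ?U"
  proof (rule subspaceI)
    show "0 \<in> ?U" using o A p by (auto intro!: exI[of _ 0])
    fix x y assume "x \<in> ?U" "y \<in> ?U"
    then obtain u v where "arr Z A u" "x = u \<cdot> p" "arr Z A v" "y = v \<cdot> p" by blast
    thus "x + y \<in> ?U" using add_cmp[of Z A u v W p] p by (auto intro!: exI[of _ "u + v"])
  next
    fix c x assume "x \<in> ?U"
    then obtain u where "arr Z A u" "x = u \<cdot> p" by blast
    thus "smul T c x \<in> ?U" using smul_cmp[of Z A u W p c] p by (auto intro!: exI[of _ "smul T c u"])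
  qed
  moreover have "B \<subseteq> ?U" using B by blast
  ultimately have "span B \<subseteq> ?U" by (intro span_minimal)
  thus ?thesis using h Hs by (auto simp: arr_def)
qed

subsection \<open>Iterated shifts\<close>

text \<open>Nonnegative shifts as strict powers of the shift functor, with an explicit action on
  morphisms. Negative shifts, whose values are arbitrary choices, are moved to the other argument by
  \<open>hom0_shift_neg\<close>.\<close>

definition sh :: "nat \<Rightarrow> 'o \<Rightarrow> 'o" where "sh j = \<Sigma> ^^ j"
definition shm :: "nat \<Rightarrow> 'm \<Rightarrow> 'm" where "shm j = \<Sigma>m ^^ j"

lemma sh_0 [simp]: "sh 0 X = X" and sh_Suc: "sh (Suc j) X = \<Sigma> (sh j X)"
  and shm_0 [simp]: "shm 0 f = f" and shm_Suc: "shm (Suc j) f = \<Sigma>m (shm j f)"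
  and sh_Suc': "sh (Suc j) X = sh j (\<Sigma> X)" and shm_Suc': "shm (Suc j) f = shm j (\<Sigma>m f)"
  by (simp_all add: sh_def shm_def funpow_swap1)

lemma sh_sh: "sh i (sh j X) = sh (i + j) X"
  by (simp add: sh_def funpow_add)

lemma eqv_sh: "eqv (sh j) (\<lambda>X Y. shm j)"
proof (induct j)
  case 0 thus ?case using eqv_ident by (simp add: sh_def shm_def id_def)
next
  case (Suc j)
  from eqv_comp[OF eqvS this] show ?case by (simp add: sh_Suc[abs_def] shm_Suc[abs_def])
qed

lemmas sh_Obj = eqv_Obj[OF eqv_sh] and sh_arr = eqv_arr[OF eqv_sh] and sh_hom0 = eqv_hom0[OF eqv_sh]
  and sh_cmp = eqv_cmp[OF eqv_sh] and sh_iso = eqv_iso[OF eqv_sh] and sh_ex3 = ex3_eqv[OF eqv_sh]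
  and sh_full = eqv_full[OF eqv_sh] and sh_ess = eqv_ess[OF eqv_sh]

lemma sh_hom0_add: "A \<in> Obj T \<Longrightarrow> B \<in> Obj T \<Longrightarrow> hom0 (sh i A) (sh (i + j) B) \<longleftrightarrow> hom0 A (sh j B)"
  using sh_hom0[of A "sh j B" i] sh_Obj by (simp add: sh_sh)

lemma sh_hom0_le: "A \<in> Obj T \<Longrightarrow> B \<in> Obj T \<Longrightarrow> i \<le> j \<Longrightarrow> hom0 (sh i A) (sh j B) \<longleftrightarrow> hom0 A (sh (j - i) B)"
  using sh_hom0_add[of A B i "j - i"] by simp

lemma sh_retract: "A \<in> Obj T \<Longrightarrow> B \<in> Obj T \<Longrightarrow> retract (sh i A) (sh i B) \<longleftrightarrow> retract A B"
  by (rule eqv_retract[OF eqv_sh])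

lemma shift_Obj: "X \<in> Obj T \<Longrightarrow> shift T l X \<in> Obj T"
  using eqv_int_power[OF eqvS] eqv_Obj unfolding shift_def by blast

lemma shift_nonneg: "shift T (int i) X = sh i X"
  by (simp add: shift_def int_power_def sh_def)

lemma shift_neg: "X \<in> Obj T \<Longrightarrow> iso T (sh i (shift T (- int i) X)) X"
  using int_power_add[OF eqvS, of X "int i" "- int i"] iso_sym
  by (simp add: shift_def int_power_def sh_def)

lemma hom0_shift_neg:
  assumes "A \<in> Obj T" "B \<in> Obj T" shows "hom0 (shift T (- int i) A) B \<longleftrightarrow> hom0 A (sh i B)"
  using sh_hom0[OF shift_Obj[OF assms(1)] assms(2), of i "- int i"] hom0_iso_left[OF shift_neg[OF assms(1)], of i] by simp

lemma n_cluster_tilting_iff: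
  "n_cluster_tilting T n D \<longleftrightarrow> subcategory T D \<and> functorially_finite T D \<and>
    (\<forall>Y\<in>Obj T. Y \<in> D \<longleftrightarrow> (\<forall>j\<in>{1..<n}. \<forall>A\<in>D. hom0 A (sh j Y))) \<and>
    (\<forall>Y\<in>Obj T. Y \<in> D \<longleftrightarrow> (\<forall>j\<in>{1..<n}. \<forall>A\<in>D. hom0 Y (sh j A)))"
proof (cases "subcategory T D")
  case True
  note o = sub_Obj[OF True]
  have r: "(Y \<in> right_perp T (shift T (- int j) ` D)) \<longleftrightarrow> (\<forall>A\<in>D. hom0 A (sh j Y))" if "Y \<in> Obj T" for Y j
    using that o shift_Obj hom0_iff hom0_shift_neg by (auto simp: right_perp_def)
  have l: "(Y \<in> left_perp T (shift T (int j) ` D)) \<longleftrightarrow> (\<forall>A\<in>D. hom0 Y (sh j A))" if "Y \<in> Obj T" for Y j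
    using that o sh_Obj hom0_iff by (auto simp: left_perp_def shift_nonneg)
  have 1: "D = Obj T \<inter> (\<Inter>i\<in>{1..<n}. right_perp T (shift T (- int i) ` D)) \<longleftrightarrow>
    (\<forall>Y\<in>Obj T. Y \<in> D \<longleftrightarrow> (\<forall>j\<in>{1..<n}. \<forall>A\<in>D. hom0 A (sh j Y)))"
    using r o by (simp add: set_eq_iff) metis
  have 2: "D = Obj T \<inter> (\<Inter>i\<in>{1..<n}. left_perp T (shift T (int i) ` D)) \<longleftrightarrow>
    (\<forall>Y\<in>Obj T. Y \<in> D \<longleftrightarrow> (\<forall>j\<in>{1..<n}. \<forall>A\<in>D. hom0 Y (sh j A)))"
    using l o by (simp add: set_eq_iff) metis
  show ?thesis unfolding n_cluster_tilting_def 1 2 by blast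
qed (simp add: n_cluster_tilting_def)

text \<open>Iterated from \<open>m = 0\<close>, this step exhibits any object as a successive extension of objects of
  \<open>D\<close>, \<open>D[1]\<close>, \<open>\<dots>\<close>, \<open>D[n-1]\<close>.\<close>

lemma filtration_step:
  assumes D: "subcategory T D" and rigid: "\<And>A B j. A \<in> D \<Longrightarrow> B \<in> D \<Longrightarrow> 0 < j \<Longrightarrow> j < n \<Longrightarrow> hom0 A (sh j B)"
    and app: "\<And>Y. Y \<in> Obj T \<Longrightarrow> \<exists>A p. right_approximation T D A Y p"
    and V: "V \<in> Obj T" and z: "\<And>p A. p < m \<Longrightarrow> A \<in> D \<Longrightarrow> hom0 (sh p A) V" and m: "Suc m < n"
  obtains U V' u v w where "U \<in> D" "ex3 (sh m U) V V' u v" "ex3 V V' (sh (Suc m) U) v w"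
    "\<forall>p A. p < Suc m \<longrightarrow> A \<in> D \<longrightarrow> hom0 (sh p A) V'"
proof -
  obtain W where W: "W \<in> Obj T" "iso T (sh m W) V" using sh_ess[OF V] by blast
  obtain f g where fg: "arr (sh m W) V f" "arr V (sh m W) g" "f \<cdot> g = idm (sh m W)" "g \<cdot> f = idm V"
    using isoE[OF W(2)] by blast
  obtain U p where "right_approximation T D U W p" using app[OF W(1)] by blast
  hence U: "U \<in> D" and p: "arr U W p" and fac: "\<And>Z h. Z \<in> D \<Longrightarrow> arr Z W h \<Longrightarrow> \<exists>g. arr Z U g \<and> h = g \<cdot> p"
    using right_approximation_iff[OF D W(1)] by blast+
  have Uo: "U \<in> Obj T" using U sub_Obj[OF D] by blast
  have u: "arr (sh m U) V (shm m p \<cdot> f)" using sh_arr[OF p, of m] fg by auto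
  obtain V' v w where t: "Tri T (sh m U) V V' (shm m p \<cdot> f) v w"
    using Tri_cone[OF arrD(1)[OF u] V arrD(3)[OF u]] by blast
  have e1: "ex3 (sh m U) V V' (shm m p \<cdot> f) v" by (rule Tri_ex3[OF t])
  have e2: "ex3 V V' (sh (Suc m) U) v w" using Tri_ex3_2[OF t] by (simp add: sh_Suc)
  note x = ex3D[OF e2]
  have "hom0 (sh r A) V'" if r: "r < Suc m" and A: "A \<in> D" for r A
  proof -
    have Ao: "A \<in> Obj T" using sub_Obj[OF D A] .
    \<comment> \<open>Since 0 < m + 1 - r < n, rigidity excludes maps A[r] -> U[m+1]. A map A[r] ->
      V' therefore comes from V, where it is zero for r < m and factors through the shifted
      approximation for r = m.\<close>
    have "hom0 A (sh (Suc m - r) U)" using rigid[OF A U, of "Suc m - r"] m r by simp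
    hence h0: "hom0 (sh r A) (sh (Suc m) U)" using sh_hom0_le[OF Ao Uo, of r "Suc m"] r by simp
    show ?thesis
    proof (cases "r = m")
      case True
      show ?thesis unfolding hom0_def
      proof (intro allI impI)
        fix h assume h: "arr (sh r A) V' h"
        have "h \<cdot> w = 0" using h h0 x(2) by (auto simp: hom0_def)
        then obtain k where k: "arr (sh m A) V k" "h = k \<cdot> v" using x(4)[OF h] True by blast
        obtain k' where k': "arr A W k'" "shm m k' = k \<cdot> g" using sh_full[OF Ao W(1) arr_cmp[OF k(1) fg(2)]] by blast
        obtain l where l: "arr A U l" "k' = l \<cdot> p" using fac[OF A k'(1)] by blast
        have sl: "arr (sh m A) (sh m U) (shm m l)" using sh_arr[OF l(1)] .
        have "k = shm m k' \<cdot> f" using k' assoc[OF k(1) fg(2,1)] fg id_right[OF k(1)] by simp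
        also have "\<dots> = shm m l \<cdot> (shm m p \<cdot> f)"
          using l sh_cmp[OF l(1) p, of m] assoc[OF sl sh_arr[OF p] fg(1)] by simp
        finally have "h = shm m l \<cdot> ((shm m p \<cdot> f) \<cdot> v)" using k assoc[OF sl u x(1)] by simp
        thus "h = 0" using ex3D(3)[OF e1] sl by simp
      qed
    next
      case False
      thus ?thesis using ex3_hom0_right[OF e2 _ h0] z[OF _ A] r by simp
    qed
  qed
  thus thesis using that[OF U e1 e2] by blast
qed

text \<open>Write V as A[n-1]. Then (B, A[j]) is (B[n-1-j], V), and n-1-j runs through the exponents
  below n-1 as j runs from 1 to n-1; maximality puts A into D.\<close>

lemma filtration_end:
  assumes D: "subcategory T D" and V: "V \<in> Obj T"
    and max: "\<And>Y. Y \<in> Obj T \<Longrightarrow> Y \<in> D \<longleftrightarrow> (\<forall>j\<in>{1..<n}. \<forall>A\<in>D. hom0 A (sh j Y))"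
    and z: "\<And>p A. p < n - 1 \<Longrightarrow> A \<in> D \<Longrightarrow> hom0 (sh p A) V"
  shows "\<exists>A\<in>D. iso T (sh (n - 1) A) V"
proof -
  obtain A where A: "A \<in> Obj T" "iso T (sh (n - 1) A) V" using sh_ess[OF V] by blast
  have "A \<in> D"
    unfolding max[OF A(1)]
  proof (intro ballI)
    fix j B assume j: "j \<in> {1..<n}" and B: "B \<in> D"
    have "hom0 (sh (n - 1 - j) B) V" using z[OF _ B, of "n - 1 - j"] j by auto
    hence "hom0 (sh (n - 1 - j) B) (sh (n - 1) A)" using hom0_iso_right[OF A(2)] by blast
    moreover have "n - 1 - (n - 1 - j) = j" using j by auto
    ultimately show "hom0 B (sh j A)"
      using sh_hom0_le[OF sub_Obj[OF D B] A(1), of "n - 1 - j" "n - 1"] by simp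
  qed
  thus ?thesis using A by blast
qed

text \<open>Left approximations come for free: splitting off the layers \<open>D[m]\<close>, \<open>m < n - 1\<close>, of \<open>W[n-1]\<close>,
  which have no nonzero maps to \<open>D[n-1]\<close>, leaves an object of \<open>D[n-1]\<close>.\<close>

lemma left_approximation_exists:
  assumes D: "subcategory T D" and n: "n \<ge> 1"
    and app: "\<And>Y. Y \<in> Obj T \<Longrightarrow> \<exists>A p. right_approximation T D A Y p"
    and max: "\<And>Y. Y \<in> Obj T \<Longrightarrow> Y \<in> D \<longleftrightarrow> (\<forall>j\<in>{1..<n}. \<forall>A\<in>D. hom0 A (sh j Y))"
    and W: "W \<in> Obj T"
  shows "\<exists>A p. left_approximation T D W A p"
proof -
  have rigid: "hom0 A (sh j B)" if "A \<in> D" "B \<in> D" "0 < j" "j < n" for A B j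
    using max[of B] sub_Obj[OF D] that by auto
  let ?V = "sh (n - 1) W"
  have V: "?V \<in> Obj T" using sh_Obj W by blast
  have "m < n \<Longrightarrow> \<exists>V f. arr ?V V f \<and> (\<forall>p A. p < m \<longrightarrow> A \<in> D \<longrightarrow> hom0 (sh p A) V) \<and>
    (\<forall>B h. B \<in> D \<longrightarrow> arr ?V (sh (n - 1) B) h \<longrightarrow> (\<exists>k. arr V (sh (n - 1) B) k \<and> h = f \<cdot> k))" for m
  proof (induct m)
    case 0 thus ?case using V id_left by (intro exI[of _ ?V] exI[of _ "idm ?V"]) fastforce
  next
    case (Suc m)
    then obtain V f where f: "arr ?V V f" "\<And>p A. p < m \<Longrightarrow> A \<in> D \<Longrightarrow> hom0 (sh p A) V"
      and fac: "\<And>B h. B \<in> D \<Longrightarrow> arr ?V (sh (n - 1) B) h \<Longrightarrow> \<exists>k. arr V (sh (n - 1) B) k \<and> h = f \<cdot> k"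
      by auto
    obtain U V' u v w where U: "U \<in> D" and e: "ex3 (sh m U) V V' u v"
      and "ex3 V V' (sh (Suc m) U) v w" and z: "\<forall>p A. p < Suc m \<longrightarrow> A \<in> D \<longrightarrow> hom0 (sh p A) V'"
      by (rule filtration_step[OF D rigid app arrD(2)[OF f(1)] f(2) Suc(2)])
    note d = ex3D[OF e]
    have "\<exists>k. arr V' (sh (n - 1) B) k \<and> h = (f \<cdot> v) \<cdot> k" if B: "B \<in> D" "arr ?V (sh (n - 1) B) h" for B h
    proof -
      obtain k where k: "arr V (sh (n - 1) B) k" "h = f \<cdot> k" using fac[OF B] by blast
      \<comment> \<open>The difference n - 1 - m lies strictly between 0 and n because m + 1 < n;
        hence \<open>u\<close> followed by \<open>k\<close> is zero and \<open>k\<close> descends to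
        V'.\<close>
      have "hom0 (sh m U) (sh (n - 1) B)"
        using sh_hom0_le[of U B m "n - 1"] rigid[OF U B(1), of "n - 1 - m"] Suc(2) sub_Obj[OF D] U B by auto
      hence "u \<cdot> k = 0" using d(1) k by (auto simp: hom0_def)
      then obtain k' where k': "arr V' (sh (n - 1) B) k'" "k = v \<cdot> k'" using d(5) k by blast
      thus ?thesis using assoc[OF f(1) d(2) k'(1)] k by auto
    qed
    thus ?case using z arr_cmp[OF f(1) d(2)] by blast
  qed
  from this[of "n - 1"] n obtain V f where f: "arr ?V V f" "\<And>p A. p < n - 1 \<Longrightarrow> A \<in> D \<Longrightarrow> hom0 (sh p A) V"
      and fac: "\<And>B h. B \<in> D \<Longrightarrow> arr ?V (sh (n - 1) B) h \<Longrightarrow> \<exists>k. arr V (sh (n - 1) B) k \<and> h = f \<cdot> k"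
    by auto
  obtain A where AD: "A \<in> D" and A: "A \<in> Obj T" "iso T (sh (n - 1) A) V"
    using filtration_end[OF D arrD(2)[OF f(1)] max f(2)] sub_Obj[OF D] by metis
  obtain a b where ab: "arr (sh (n - 1) A) V a" "arr V (sh (n - 1) A) b" "b \<cdot> a = idm V"
    using isoE[OF A(2)] by blast
  obtain p where p: "arr W A p" "shm (n - 1) p = f \<cdot> b" using sh_full[OF W A(1) arr_cmp[OF f(1) ab(2)]] by blast
  have "\<exists>g. arr A Z g \<and> h = p \<cdot> g" if Z: "Z \<in> D" and h: "arr W Z h" for Z h
  proof -
    obtain k where k: "arr V (sh (n - 1) Z) k" "shm (n - 1) h = f \<cdot> k" using fac[OF Z sh_arr[OF h]] by blast
    obtain g where g: "arr A Z g" "shm (n - 1) g = a \<cdot> k"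
      using sh_full[OF A(1) sub_Obj[OF D Z] arr_cmp[OF ab(1) k(1)]] by blast
    have "shm (n - 1) (p \<cdot> g) = (f \<cdot> b) \<cdot> (a \<cdot> k)" using sh_cmp[OF p(1) g(1)] p g by simp
    also have "\<dots> = f \<cdot> k"
      using assoc[OF f(1) ab(2) arr_cmp[OF ab(1) k(1)]] assoc[OF ab(2,1) k(1)] ab id_left[OF k(1)] by simp
    finally have "h = p \<cdot> g" using eqv_faithful[OF eqv_sh h arr_cmp[OF p(1) g(1)], of "n - 1"] k by simp
    thus ?thesis using g by blast
  qed
  thus ?thesis using left_approximation_iff[OF D W] AD p by blast
qed

end

subsection \<open>Serre duality\<close>

locale serre_category = triangulated_category T
  for T :: "('k::field, 'o, 'm::ab_group_add, 'z) tricat_scheme" (structure) +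
  fixes S :: "('o, 'm) endofunctor" and n :: nat
  assumes serre: "serre_functor T S"
begin

definition N :: "int \<Rightarrow> 'o \<Rightarrow> 'o" where "N l = int_power T (serre_n T S n) l"

lemmas eqvF = eqv_endofunctor[OF conjunct1[OF serre[unfolded serre_functor_def]]]

lemma eqv_serre_n: "\<exists>\<Phi>. eqv (serre_n T S n) \<Phi>"
proof -
  obtain \<Psi> where "eqv (shift T (- int n)) \<Psi>" using eqv_int_power[OF eqvS] unfolding shift_def by blast
  from eqv_comp[OF eqvF this] show ?thesis unfolding serre_n_def[abs_def] by blast
qed

lemma eqv_N: "\<exists>\<Phi>. eqv (N l) \<Phi>"
  using eqv_serre_n eqv_int_power unfolding N_def by blast

lemma N_Obj: "Y \<in> Obj T \<Longrightarrow> N l Y \<in> Obj T"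
  using eqv_N[of l] eqv_Obj by blast
lemma N_iso: "iso T Y Z \<Longrightarrow> iso T (N l Y) (N l Z)"
  using eqv_N[of l] eqv_iso by blast
lemma N_local: "Y \<in> Obj T \<Longrightarrow> local_end T (N l Y) \<longleftrightarrow> local_end T Y"
  using eqv_N[of l] eqv_local by blast
lemma N_0 [simp]: "N 0 Y = Y"
  by (simp add: N_def int_power_def)
lemma N_add: "Y \<in> Obj T \<Longrightarrow> iso T (N (k + l) Y) (N k (N l Y))"
  using eqv_serre_n int_power_add unfolding N_def by blast
lemma N_1: "N 1 Y = serre_n T S n Y"
  by (simp add: N_def int_power_def)

lemma N_inv: "Y \<in> Obj T \<Longrightarrow> iso T (N l (N (- l) Y)) Y"
  using N_add[of Y l "- l"] iso_sym by simp
lemma N_inv': "Y \<in> Obj T \<Longrightarrow> iso T (N (- l) (N l Y)) Y"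
  using N_inv[of Y "- l"] by simp

lemma N_iso_swap: "Y \<in> Obj T \<Longrightarrow> Z \<in> Obj T \<Longrightarrow> iso T (N l Y) Z \<longleftrightarrow> iso T Y (N (- l) Z)"
  using N_iso[of "N l Y" Z "- l"] N_iso[of Y "N (- l) Z" l] N_inv[of Z l] N_inv'[of Y l] iso_trans iso_sym
  by meson

lemma N_retract: "Y \<in> Obj T \<Longrightarrow> Z \<in> Obj T \<Longrightarrow> retract (N l Y) (N l Z) \<longleftrightarrow> retract Y Z"
  using eqv_N[of l] eqv_retract by blast

lemma N_retract_swap: "Y \<in> Obj T \<Longrightarrow> Z \<in> Obj T \<Longrightarrow> retract (N l Y) Z \<longleftrightarrow> retract Y (N (- l) Z)"
  using N_retract[of Y "N (- l) Z" l] retract_iso_right[OF N_inv[of Z l]] N_Obj by simp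

lemma orbit_iff: "Y \<in> Obj T \<Longrightarrow> isoclass T Y \<in> serre_orbit T S n X \<longleftrightarrow> (\<exists>l. iso T Y (N l X))"
  using isoclass_eq unfolding serre_orbit_def N_def by auto

text \<open>Naturality writes the pairing as a trace: \<open>\<eta> A B h g\<close> equals
  \<open>\<eta> A A (idm A)\<close> at hg. If every hg were zero, h would have the same image under
  the injective \<open>\<eta> A B\<close> as the zero map.\<close>

lemma serre_nondegenerate:
  assumes h: "arr A B h" and nz: "h \<noteq> 0"
  shows "\<exists>g. arr B (fobj S A) g \<and> h \<cdot> g \<noteq> 0"
proof (rule ccontr)
  assume no: "\<not> ?thesis"
  have o: "A \<in> Obj T" "B \<in> Obj T" using h by (auto dest: arrD)
  have SA: "fobj S A \<in> Obj T" using eqv_Obj[OF eqvF o(1)] .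
  from serre obtain \<eta> where
    H1: "\<forall>X\<in>Obj T. \<forall>Y\<in>Obj T. bij_betw (\<eta> X Y) (Hom T X Y) (dual_space T (Hom T Y (fobj S X))) \<and>
      (\<forall>f\<in>Hom T X Y. \<forall>g\<in>Hom T Y (fobj S X).
         (\<forall>f'\<in>Hom T X Y. \<eta> X Y (f + f') g = \<eta> X Y f g + \<eta> X Y f' g) \<and>
         (\<forall>c. \<eta> X Y (smul T c f) g = c * \<eta> X Y f g))" and
    H2: "\<forall>X\<in>Obj T. \<forall>X'\<in>Obj T. \<forall>Y\<in>Obj T. \<forall>Y'\<in>Obj T.
      \<forall>a\<in>Hom T X' X. \<forall>f\<in>Hom T X Y. \<forall>b\<in>Hom T Y Y'. \<forall>g\<in>Hom T Y' (fobj S X').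
        \<eta> X' Y' (a \<cdot> f \<cdot> b) g = \<eta> X Y f (b \<cdot> g \<cdot> fmor S a)"
    unfolding serre_functor_def by (elim conjE exE) (rule that)
  have bij: "bij_betw (\<eta> X Y) (Hom T X Y) (dual_space T (Hom T Y (fobj S X)))"
    if "X \<in> Obj T" "Y \<in> Obj T" for X Y using H1 that by blast
  have lin: "\<eta> X Y (f + f') g = \<eta> X Y f g + \<eta> X Y f' g"
    if "X \<in> Obj T" "Y \<in> Obj T" "f \<in> Hom T X Y" "g \<in> Hom T Y (fobj S X)" "f' \<in> Hom T X Y" for X Y f g f'
    using H1 that by blast
  have dual: "\<eta> A Y f \<in> dual_space T (Hom T Y (fobj S A))" if "Y \<in> Obj T" "arr A Y f" for Y f
    using bij_betwE[OF bij[OF o(1) that(1)]] that(2) by (auto simp: arr_def)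
  have z: "\<eta> A B h g = 0" if g: "arr B (fobj S A) g" for g
  proof -
    have "\<eta> A B h g = \<eta> A B (idm A \<cdot> idm A \<cdot> h) g" using id_left[OF h] id_left[OF arr_id[OF o(1)]] by simp
    also have "\<dots> = \<eta> A A (idm A) (h \<cdot> g \<cdot> fmor S (idm A))"
      using H2[rule_format, OF o(1) o(1) o(1) o(2) ident_Hom[OF o(1)] ident_Hom[OF o(1)]
          arrD(3)[OF h] arrD(3)[OF g]] .
    also have "h \<cdot> g \<cdot> fmor S (idm A) = 0"
      using no g eqv_id[OF eqvF o(1)] cmp_zero'[of A "fobj S A"] zero_cmp'[OF arr_id[OF SA]] by auto
    also have "\<eta> A A (idm A) 0 = 0"
    proof -
      have "\<eta> A A (idm A) (0 + 0) = \<eta> A A (idm A) 0 + \<eta> A A (idm A) 0"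
        using dual[OF o(1) arr_id[OF o(1)]] zero_Hom[OF o(1) SA] unfolding dual_space_def by blast
      thus ?thesis by (metis add_0 add_cancel_right_right)
    qed
    finally show ?thesis .
  qed
  have z0: "\<eta> A B 0 g = 0" if g: "arr B (fobj S A) g" for g
    using lin[OF o, of 0 g 0] zero_Hom[OF o] arrD(3)[OF g] by (metis add_0 add_cancel_right_right)
  have "\<eta> A B h = \<eta> A B 0"
  proof
    fix g
    show "\<eta> A B h g = \<eta> A B 0 g"
    proof (cases "g \<in> Hom T B (fobj S A)")
      case True
      hence "arr B (fobj S A) g" using o SA by (simp add: arr_def)
      thus ?thesis using z z0 by simp
    next
      case False
      \<comment> \<open>Outside the Hom-space both functionals take the default value 0 of
        \<open>dual_space\<close>.\<close>
      thus ?thesis using dual[OF o(2) h] dual[OF o(2) arr_zero[OF o]] by (auto simp: dual_space_def)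
    qed
  qed
  hence "h = 0"
    using bij_betw_imp_inj_on[OF bij[OF o]] arrD(3)[OF h] zero_Hom[OF o] by (auto dest: inj_onD)
  thus False using nz by simp
qed

text \<open>By definition \<open>N 1 A\<close> is the Serre functor applied to the chosen A[-n];
  naming that object A' allows the duality of A' to be applied literally.\<close>

lemma serre_n_desuspend:
  assumes A: "A \<in> Obj T"
  obtains A' where "A' \<in> Obj T" "iso T (sh n A') A" "N 1 A = fobj S A'"
  using that[of "shift T (- int n) A"] shift_Obj[OF A] shift_neg[OF A] by (simp add: N_1 serre_n_def)

text \<open>Serre duality pairs \<open>(A, B)\<close> with \<open>(B, \<SS>\<^sub>n A[n])\<close>; in this form no natural isomorphism between
  \<open>\<SS> \<circ> [1]\<close> and \<open>[1] \<circ> \<SS>\<close> is needed.\<close>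

lemma serre_n_nondegenerate:
  assumes h: "arr A B h" and nz: "h \<noteq> 0"
  shows "\<exists>g. arr B (sh n (N 1 A)) g \<and> h \<cdot> g \<noteq> 0"
proof -
  have o: "A \<in> Obj T" "B \<in> Obj T" using h by (auto dest: arrD)
  obtain A' where A': "A' \<in> Obj T" "iso T (sh n A') A" and N: "N 1 A = fobj S A'"
    by (rule serre_n_desuspend[OF o(1)])
  obtain B' where B': "B' \<in> Obj T" "iso T (sh n B') B" using sh_ess[OF o(2)] by blast
  obtain s s' where s: "arr (sh n A') A s" "arr A (sh n A') s'" "s' \<cdot> s = idm A" using isoE[OF A'(2)] by metis
  obtain t t' where t: "arr (sh n B') B t" "arr B (sh n B') t'" "t' \<cdot> t = idm B" using isoE[OF B'(2)] by metis
  have ht: "arr A (sh n B') (h \<cdot> t')" using h t by auto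
  obtain k where k: "arr A' B' k" "shm n k = s \<cdot> (h \<cdot> t')"
    using sh_full[OF A'(1) B'(1) arr_cmp[OF s(1) ht]] by blast
  have h_eq: "h = (s' \<cdot> shm n k) \<cdot> t"
  proof -
    have "s' \<cdot> shm n k = h \<cdot> t'" using k assoc[OF s(2,1) ht] s id_left[OF ht] by simp
    thus ?thesis using assoc[OF h t(2,1)] t id_right[OF h] by simp
  qed
  have "k \<noteq> 0" using h_eq nz s t eqv_zero[OF eqv_sh A'(1) B'(1), of n] by auto
  then obtain g where g: "arr B' (fobj S A') g" "k \<cdot> g \<noteq> 0" using serre_nondegenerate[OF k(1)] by blast
  have Sg: "arr (sh n B') (sh n (N 1 A)) (shm n g)" using sh_arr[OF g(1)] N by simp
  have "shm n (k \<cdot> g) \<noteq> 0" using eqv_ker[OF eqv_sh arr_cmp[OF k(1) g(1)], of n] g by blast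
  moreover have "shm n (k \<cdot> g) = s \<cdot> (h \<cdot> (t' \<cdot> shm n g))"
    using sh_cmp[OF k(1) g(1), of n] k assoc[OF s(1) ht Sg] assoc[OF h t(2) Sg] by simp
  ultimately have "h \<cdot> (t' \<cdot> shm n g) \<noteq> 0" using s by auto
  thus ?thesis using t Sg by blast
qed

text \<open>The reverse detection. After desuspension g is a nonzero map from B' to the Serre
  translate of A'; duality continues it to the Serre translate of B', and the continuing map is the
  image of a nonzero A' -> B' because the Serre functor is full.\<close>

lemma serre_n_nonzero:
  assumes g: "arr B (sh n (N 1 A)) g" and nz: "g \<noteq> 0" and A: "A \<in> Obj T"
  shows "\<not> hom0 A B"
proof -
  have B: "B \<in> Obj T" using g by (auto dest: arrD)
  obtain A' where A': "A' \<in> Obj T" "iso T (sh n A') A" and N: "N 1 A = fobj S A'"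
    by (rule serre_n_desuspend[OF A])
  obtain B' where B': "B' \<in> Obj T" "iso T (sh n B') B" using sh_ess[OF B] by blast
  have SA: "fobj S A' \<in> Obj T" using eqv_Obj[OF eqvF A'(1)] .
  have "\<not> hom0 (sh n B') (sh n (fobj S A'))" using g nz N hom0_iso_left[OF B'(2)] by (auto simp: hom0_def)
  hence "\<not> hom0 B' (fobj S A')" using sh_hom0[OF B'(1) SA] by simp
  then obtain k where k: "arr B' (fobj S A') k" "k \<noteq> 0" by (auto simp: hom0_def)
  then obtain j where j: "arr (fobj S A') (fobj S B') j" "k \<cdot> j \<noteq> 0" using serre_nondegenerate by blast
  have "j \<noteq> 0" using j k by auto
  hence "\<not> hom0 A' B'" using j eqv_hom0[OF eqvF A'(1) B'(1)] by (auto simp: hom0_def)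
  hence "\<not> hom0 (sh n A') (sh n B')" using sh_hom0[OF A'(1) B'(1)] by simp
  thus ?thesis using hom0_iso_left[OF A'(2)] hom0_iso_right[OF B'(2)] by blast
qed

lemma hom0_serre: "A \<in> Obj T \<Longrightarrow> B \<in> Obj T \<Longrightarrow> hom0 A B \<longleftrightarrow> hom0 B (sh n (N 1 A))"
  using serre_n_nondegenerate serre_n_nonzero unfolding hom0_def by (metis cmp_zero')

lemma hom0_serre_sh:
  assumes "A \<in> Obj T" "B \<in> Obj T" "j \<le> n"
  shows "hom0 A (sh j B) \<longleftrightarrow> hom0 B (sh (n - j) (N 1 A))"
  using hom0_serre[OF assms(1) sh_Obj[OF assms(2)]] sh_hom0_le[OF assms(2) N_Obj[OF assms(1)] assms(3)] by simp

text \<open>Duality applied twice, with exponents j and n - j; hence the bound on j. For vanishing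
  questions it replaces an isomorphism between the composites of \<open>\<SS>\<^sub>n\<close> and
  the shift.\<close>

lemma hom0_N1:
  assumes "A \<in> Obj T" "B \<in> Obj T" "j \<le> n"
  shows "hom0 (N 1 A) (sh j (N 1 B)) \<longleftrightarrow> hom0 A (sh j B)"
  using hom0_serre_sh[OF assms] hom0_serre_sh[OF assms(2) N_Obj[OF assms(1)], of "n - j"] assms(3) by simp

lemma hom0_iso_sh:
  assumes "iso T A A'" "iso T B B'"
  shows "hom0 A (sh j B) \<longleftrightarrow> hom0 A' (sh j B')"
  using hom0_iso_left[OF assms(1)] hom0_iso_right[OF sh_iso[OF assms(2)]] by blast

lemma hom0_N:
  assumes A: "A \<in> Obj T" and B: "B \<in> Obj T" and j: "j \<le> n"
  shows "hom0 (N l A) (sh j (N l B)) \<longleftrightarrow> hom0 A (sh j B)"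
proof (induct l rule: int_induct[of _ 0])
  case base show ?case by simp
next
  case (step1 i)
  have "hom0 (N (i + 1) A) (sh j (N (i + 1) B)) \<longleftrightarrow> hom0 (N 1 (N i A)) (sh j (N 1 (N i B)))"
    using hom0_iso_sh[OF N_add[OF A, of 1 i] N_add[OF B, of 1 i]] by (simp add: add.commute)
  thus ?case using hom0_N1[OF N_Obj[OF A] N_Obj[OF B] j] step1 by simp
next
  case (step2 i)
  have "hom0 (N i A) (sh j (N i B)) \<longleftrightarrow> hom0 (N 1 (N (i - 1) A)) (sh j (N 1 (N (i - 1) B)))"
    using hom0_iso_sh[OF N_add[OF A, of 1 "i - 1"] N_add[OF B, of 1 "i - 1"]] by simp
  thus ?case using hom0_N1[OF N_Obj[OF A] N_Obj[OF B] j] step2 by simp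
qed

lemma hom0_N_left:
  assumes A: "A \<in> Obj T" and B: "B \<in> Obj T" and j: "j \<le> n"
  shows "hom0 (N l A) (sh j B) \<longleftrightarrow> hom0 A (sh j (N (- l) B))"
  using hom0_N[OF A N_Obj[OF B] j, of l "- l"] hom0_iso_sh[OF iso_refl[OF N_Obj[OF A]] N_inv[OF B]] by simp

subsection \<open>Cluster tilting subcategories\<close>

definition ct :: "'o set \<Rightarrow> bool" where "ct = n_cluster_tilting T n"

lemma ct_sub: "ct D \<Longrightarrow> subcategory T D"
  by (simp add: ct_def n_cluster_tilting_def)

lemma ct_right: "ct D \<Longrightarrow> Y \<in> Obj T \<Longrightarrow> \<exists>A p. right_approximation T D A Y p"
  by (simp add: ct_def n_cluster_tilting_def functorially_finite_def)

lemma ct_mem: "ct D \<Longrightarrow> Y \<in> Obj T \<Longrightarrow> Y \<in> D \<longleftrightarrow> (\<forall>j\<in>{1..<n}. \<forall>A\<in>D. hom0 A (sh j Y))"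
  by (simp add: ct_def n_cluster_tilting_iff)

lemma ct_mem': "ct D \<Longrightarrow> Y \<in> Obj T \<Longrightarrow> Y \<in> D \<longleftrightarrow> (\<forall>j\<in>{1..<n}. \<forall>A\<in>D. hom0 Y (sh j A))"
  unfolding ct_def n_cluster_tilting_iff by blast

lemma ct_rigid: "ct D \<Longrightarrow> A \<in> D \<Longrightarrow> B \<in> D \<Longrightarrow> 0 < j \<Longrightarrow> j < n \<Longrightarrow> hom0 A (sh j B)"
  using ct_mem[of D B] sub_Obj[OF ct_sub] by auto

text \<open>The substitution of n - j for j permutes 1, ..., n-1, so duality matches the two whole
  ranges.\<close>

lemma hom0_serre_range:
  assumes D: "subcategory T D" and Y: "Y \<in> Obj T"
  shows "(\<forall>j\<in>{1..<n}. \<forall>A\<in>D. hom0 A (sh j Y)) \<longleftrightarrow> (\<forall>j\<in>{1..<n}. \<forall>A\<in>D. hom0 Y (sh j (N 1 A)))"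
proof -
  have *: "hom0 A (sh j Y) \<longleftrightarrow> hom0 Y (sh (n - j) (N 1 A))" if "A \<in> D" "j \<in> {1..<n}" for A j
    using hom0_serre_sh[of A Y j] sub_Obj[OF D] Y that by auto
  have r: "n - j \<in> {1..<n}" "n - (n - j) = j" if "j \<in> {1..<n}" for j using that by auto
  show ?thesis using * r by metis
qed

text \<open>Membership of Z is right orthogonality to D. By duality this is left orthogonality of Z
  to the translate of D, equivalently of \<open>N (-1) Z\<close> to D, which is membership of
  \<open>N (-1) Z\<close>.\<close>

lemma ct_N: assumes D: "ct D" and Y: "Y \<in> D" shows "N l Y \<in> D"
proof -
  note sub = ct_sub[OF D]
  have 1: "N (-1) Z \<in> D \<longleftrightarrow> Z \<in> D" if Z: "Z \<in> Obj T" for Z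
  proof -
    have "Z \<in> D \<longleftrightarrow> (\<forall>j\<in>{1..<n}. \<forall>A\<in>D. hom0 Z (sh j (N 1 A)))"
      using ct_mem[OF D Z] hom0_serre_range[OF sub Z] by simp
    also have "\<dots> \<longleftrightarrow> (\<forall>j\<in>{1..<n}. \<forall>A\<in>D. hom0 (N (-1) Z) (sh j A))"
    proof -
      have "hom0 (N (-1) Z) (sh j A) \<longleftrightarrow> hom0 Z (sh j (N 1 A))" if "A \<in> D" "j \<in> {1..<n}" for A j
        using hom0_N_left[of Z A j "-1"] Z sub_Obj[OF sub] that by auto
      thus ?thesis by simp
    qed
    also have "\<dots> \<longleftrightarrow> N (-1) Z \<in> D" using ct_mem'[OF D N_Obj[OF Z]] by simp
    finally show ?thesis by simp
  qed
  have Yo: "Y \<in> Obj T" using sub_Obj[OF sub Y] .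
  show ?thesis
  proof (induct l rule: int_induct[of _ 0])
    case base thus ?case using Y by simp
  next
    case (step1 i)
    have "iso T (N i Y) (N (-1) (N (i + 1) Y))" using N_add[OF Yo, of "-1" "i + 1"] by simp
    hence "N (-1) (N (i + 1) Y) \<in> D" using step1 sub_iso[OF sub] by blast
    thus ?case using 1 N_Obj[OF Yo] by blast
  next
    case (step2 i)
    have "iso T (N (-1) (N i Y)) (N (i - 1) Y)" using N_add[OF Yo, of "-1" i] iso_sym by (simp add: add.commute)
    moreover have "N (-1) (N i Y) \<in> D" using step2 1 N_Obj[OF Yo] by blast
    ultimately show ?case using sub_iso[OF sub] by blast
  qed
qed

text \<open>The left-hand conditions are deduced: duality and stability under \<open>N\<close> give
  left orthogonality, and \<open>left_approximation_exists\<close> gives left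
  approximations.\<close>

lemma ctI:
  assumes D: "subcategory T D" and n: "n \<ge> 1"
    and st: "\<And>Y l. Y \<in> D \<Longrightarrow> N l Y \<in> D"
    and app: "\<And>Y. Y \<in> Obj T \<Longrightarrow> \<exists>A p. right_approximation T D A Y p"
    and max: "\<And>Y. Y \<in> Obj T \<Longrightarrow> Y \<in> D \<longleftrightarrow> (\<forall>j\<in>{1..<n}. \<forall>A\<in>D. hom0 A (sh j Y))"
  shows "ct D"
proof -
  have "Y \<in> D \<longleftrightarrow> (\<forall>j\<in>{1..<n}. \<forall>A\<in>D. hom0 Y (sh j A))" if Y: "Y \<in> Obj T" for Y
  proof -
    have "(\<forall>j\<in>{1..<n}. \<forall>A\<in>D. hom0 Y (sh j (N 1 A))) \<longleftrightarrow> (\<forall>j\<in>{1..<n}. \<forall>A\<in>D. hom0 Y (sh j A))"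
    proof (intro iffI ballI)
      fix j A assume h: "\<forall>j\<in>{1..<n}. \<forall>A\<in>D. hom0 Y (sh j (N 1 A))" and j: "j \<in> {1..<n}" and A: "A \<in> D"
      have "hom0 Y (sh j (N 1 (N (-1) A)))" using h j st[OF A] by blast
      thus "hom0 Y (sh j A)" using hom0_iso_sh[OF iso_refl[OF Y] N_inv[of A 1]] sub_Obj[OF D A] by simp
    qed (use st in blast)
    thus ?thesis using max[OF Y] hom0_serre_range[OF D Y] by simp
  qed
  moreover have "functorially_finite T D"
    using app left_approximation_exists[OF D n app max] by (simp add: functorially_finite_def)
  ultimately show ?thesis using D max by (simp add: ct_def n_cluster_tilting_iff)
qed

end

subsection \<open>Auslander-Reiten angles\<close>

context triangulated_category
begin

text \<open>The differences of cc' and c'c from the identities are killed by f and f', so minimality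
  makes both composites invertible.\<close>

lemma right_minimal_iso:
  assumes m: "right_minimal T B Z f" and m': "right_minimal T B' Z' f'"
    and f: "arr B Z f" and f': "arr B' Z' f'" and c: "arr B B' c" and c': "arr B' B c'"
    and h: "arr Z Z' h" and h': "arr Z' Z h'" and hh: "h \<cdot> h' = idm Z" "h' \<cdot> h = idm Z'"
    and s: "f \<cdot> h = c \<cdot> f'" and s': "f' \<cdot> h' = c' \<cdot> f"
  shows "inv_arr B B' c"
proof -
  have o: "B \<in> Obj T" "Z \<in> Obj T" "B' \<in> Obj T" "Z' \<in> Obj T" using f f' by (auto dest: arrD)
  have cc: "arr B B (c \<cdot> c')" and cc': "arr B' B' (c' \<cdot> c)" using c c' by auto
  have "(c \<cdot> c') \<cdot> f = (f \<cdot> h) \<cdot> h'" using assoc[OF c c' f] s s' assoc[OF c f' h'] by simp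
  also have "\<dots> = f" using assoc[OF f h h'] hh id_right[OF f] by simp
  finally have "(idm B - c \<cdot> c') \<cdot> f = 0"
    using diff_cmp[OF arr_id[OF o(1)] cc f] id_left[OF f] by simp
  hence "inv_arr B B (idm B - (idm B - c \<cdot> c'))"
    using right_minimal_inv[OF m o(1,2)] cc o by blast
  hence 1: "inv_arr B B (c \<cdot> c')" by simp
  have "(c' \<cdot> c) \<cdot> f' = (f' \<cdot> h') \<cdot> h" using assoc[OF c' c f'] s s' assoc[OF c' f h] by simp
  also have "\<dots> = f'" using assoc[OF f' h' h] hh id_right[OF f'] by simp
  finally have "(idm B' - c' \<cdot> c) \<cdot> f' = 0"
    using diff_cmp[OF arr_id[OF o(3)] cc' f'] id_left[OF f'] by simp
  hence "inv_arr B' B' (idm B' - (idm B' - c' \<cdot> c))"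
    using right_minimal_inv[OF m' o(3,4)] cc' o by blast
  hence 2: "inv_arr B' B' (c' \<cdot> c)" by simp
  show ?thesis using inv_of_two_sided[OF c c' 1 2] .
qed

lemma left_minimal_iso:
  assumes m: "left_minimal T Z B f" and f: "arr Z B f" and c: "arr B B c" and c': "arr B B c'"
    and h: "arr Z Z h" and h': "arr Z Z h'" and hh: "h \<cdot> h' = idm Z" "h' \<cdot> h = idm Z"
    and s: "h \<cdot> f = f \<cdot> c" and s': "h' \<cdot> f = f \<cdot> c'"
  shows "inv_arr B B c"
proof -
  have o: "B \<in> Obj T" "Z \<in> Obj T" using f by (auto dest: arrD)
  have cc: "arr B B (c \<cdot> c')" and cc': "arr B B (c' \<cdot> c)" using c c' by auto
  have "f \<cdot> (c \<cdot> c') = h \<cdot> (h' \<cdot> f)" using assoc[OF f c c'] s s' assoc[OF h f c'] by simp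
  also have "\<dots> = f" using assoc[OF h h' f] hh id_left[OF f] by simp
  finally have "f \<cdot> (idm B - c \<cdot> c') = 0"
    using cmp_diff[OF f arr_id[OF o(1)] cc] id_right[OF f] by simp
  hence "inv_arr B B (idm B - (idm B - c \<cdot> c'))"
    using left_minimal_inv[OF m o(2,1)] cc o by blast
  hence 1: "inv_arr B B (c \<cdot> c')" by simp
  have "f \<cdot> (c' \<cdot> c) = h' \<cdot> (h \<cdot> f)" using assoc[OF f c' c] s s' assoc[OF h' f c] by simp
  also have "\<dots> = f" using assoc[OF h' h f] hh id_left[OF f] by simp
  finally have "f \<cdot> (idm B - c' \<cdot> c) = 0"
    using cmp_diff[OF f arr_id[OF o(1)] cc'] id_right[OF f] by simp
  hence "inv_arr B B (idm B - (idm B - c' \<cdot> c))"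
    using left_minimal_inv[OF m o(2,1)] cc' o by blast
  hence 2: "inv_arr B B (c' \<cdot> c)" by simp
  show ?thesis using inv_of_two_sided[OF c c' 1 2] .
qed

lemma sink_mapD:
  assumes C: "subcategory T C" and s: "sink_map T C B Y f"
  shows "B \<in> C" "rad B Y f" "right_minimal T B Y f"
    "\<And>Z h. Z \<in> C \<Longrightarrow> rad Z Y h \<Longrightarrow> \<exists>g. arr Z B g \<and> h = g \<cdot> f"
proof -
  have BY: "B \<in> C" "Y \<in> C" using s by (auto simp: sink_map_def)
  note o = sub_Obj[OF C]
  show "B \<in> C" by (fact BY)
  show "rad B Y f" using s rad_iff[OF o[OF BY(1)] o[OF BY(2)]] by (simp add: sink_map_def)
  show "right_minimal T B Y f" using s by (simp add: sink_map_def)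
  fix Z h assume Z: "Z \<in> C" and h: "rad Z Y h"
  hence "h \<in> (\<lambda>h. h \<cdot> f) ` Hom T Z B"
    using s rad_iff[OF o[OF Z] o[OF BY(2)]] unfolding sink_map_def by blast
  thus "\<exists>g. arr Z B g \<and> h = g \<cdot> f" using o[OF Z] o[OF BY(1)] by (auto simp: arr_def)
qed

lemma source_mapD:
  assumes C: "subcategory T C" and s: "source_map T C Y B f"
  shows "B \<in> C" "rad Y B f" "left_minimal T Y B f"
    "\<And>Z h. Z \<in> C \<Longrightarrow> rad Y Z h \<Longrightarrow> \<exists>g. arr B Z g \<and> h = f \<cdot> g"
proof -
  have BY: "B \<in> C" "Y \<in> C" using s by (auto simp: source_map_def)
  note o = sub_Obj[OF C]
  show "B \<in> C" by (fact BY)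
  show "rad Y B f" using s rad_iff[OF o[OF BY(2)] o[OF BY(1)]] by (simp add: source_map_def)
  show "left_minimal T Y B f" using s by (simp add: source_map_def)
  fix Z h assume Z: "Z \<in> C" and h: "rad Y Z h"
  hence "h \<in> (\<lambda>h. f \<cdot> h) ` Hom T B Z"
    using s rad_iff[OF o[OF BY(2)] o[OF Z]] unfolding source_map_def by blast
  thus "\<exists>g. arr B Z g \<and> h = f \<cdot> g" using o[OF Z] o[OF BY(1)] by (auto simp: arr_def)
qed

end

locale ar_angle = serre_category T S n
  for T :: "('k::field, 'o, 'm::ab_group_add, 'z) tricat_scheme" (structure)
    and S :: "('o, 'm) endofunctor" and n :: nat +
  fixes C :: "'o set" and X :: 'o and Xs Cs :: "nat \<Rightarrow> 'o" and a b :: "nat \<Rightarrow> 'm"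
  assumes n1: "n \<ge> 1" and C: "ct C" and local_X: "local_end T X"
    and AR: "AR_angle T n C X Xs Cs a b"
begin

lemmas subC = ct_sub[OF C]
lemmas C_Obj = sub_Obj[OF subC]

text \<open>The angle asserts only existence of its connecting maps X_i -> X_{i+1}[1]; one choice is
  fixed for all later use.\<close>

definition d :: "nat \<Rightarrow> 'm" where
  "d i = (SOME w. Tri T (Xs (Suc i)) (Cs i) (Xs i) (b (Suc i)) (a i) w)"

lemma X0 [simp]: "Xs 0 = X" and X0_C: "X \<in> C" and Xn_C: "Xs n \<in> C" and Cs_C: "i < n \<Longrightarrow> Cs i \<in> C"
  using AR by (auto simp: AR_angle_def)

lemma tri: "i < n \<Longrightarrow> Tri T (Xs (Suc i)) (Cs i) (Xs i) (b (Suc i)) (a i) (d i)"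
  using AR unfolding AR_angle_def angle_def d_def by (metis someI_ex)

lemma X_Obj: "i \<le> n \<Longrightarrow> Xs i \<in> Obj T"
  using Tri_typed[OF tri[of i]] C_Obj[OF Xn_C] by (cases "i = n") auto
lemma Cs_Obj: "i < n \<Longrightarrow> Cs i \<in> Obj T"
  using Cs_C C_Obj by blast

lemma a_arr: "i < n \<Longrightarrow> arr (Cs i) (Xs i) (a i)"
  and b_arr: "i < n \<Longrightarrow> arr (Xs (Suc i)) (Cs i) (b (Suc i))"
  and d_arr: "i < n \<Longrightarrow> arr (Xs i) (\<Sigma> (Xs (Suc i))) (d i)"
  using Tri_arr[OF tri] by auto

lemma ex_ad: "i < n \<Longrightarrow> ex3 (Cs i) (Xs i) (\<Sigma> (Xs (Suc i))) (a i) (d i)"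
  and ex_db: "i < n \<Longrightarrow> ex3 (Xs i) (\<Sigma> (Xs (Suc i))) (\<Sigma> (Cs i)) (d i) (\<Sigma>m (b (Suc i)))"
  using Tri_ex3_2[OF tri] Tri_ex3_3[OF tri] by auto

lemma sink: "sink_map T C (Cs 0) (Xs 0) (a 0)" and source: "source_map T C (Xs n) (Cs (n - 1)) (b n)"
  using AR by (auto simp: AR_angle_def)

lemmas a0_rad = sink_mapD(2)[OF subC sink] and bn_rad = source_mapD(2)[OF subC source]

lemma a_minimal: "i < n \<Longrightarrow> right_minimal T (Cs i) (Xs i) (a i)"
  using AR sink_mapD(3)[OF subC sink] by (cases "i = 0") (auto simp: AR_angle_def)

lemma b_minimal: assumes i: "i < n" shows "left_minimal T (Xs (Suc i)) (Cs i) (b (Suc i))"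
proof (cases "Suc i = n")
  case True thus ?thesis using source_mapD(3)[OF subC source] by auto
next
  case False
  hence "0 < Suc i \<and> Suc i < n" using i by simp
  thus ?thesis using AR unfolding AR_angle_def by (metis diff_Suc_1)
qed

text \<open>Unites the sink map, i = 0, through which only radical maps factor, with the
  approximations for i > 0.\<close>

lemma a_factor:
  assumes i: "i < n" and A: "A \<in> C" and h: "arr A (Xs i) h" and r: "i = 0 \<Longrightarrow> rad A X h"
  shows "\<exists>g. arr A (Cs i) g \<and> h = g \<cdot> a i"
proof (cases "i = 0")
  case True thus ?thesis using sink_mapD(4)[OF subC sink A] r by simp
next
  case False
  hence "right_approximation T C (Cs i) (Xs i) (a i)" using AR i by (simp add: AR_angle_def)
  thus ?thesis using right_approximation_iff[OF subC X_Obj[of i]] i A h by auto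
qed

lemma b_factor:
  assumes i: "i < n" and A: "A \<in> C" and h: "arr (Xs (Suc i)) A h" and r: "Suc i = n \<Longrightarrow> rad (Xs n) A h"
  shows "\<exists>g. arr (Cs i) A g \<and> h = b (Suc i) \<cdot> g"
proof (cases "Suc i = n")
  case True thus ?thesis using source_mapD(4)[OF subC source A] r by auto
next
  case False
  hence *: "0 < Suc i \<and> Suc i < n" using i by simp
  hence "left_approximation T C (Xs (Suc i)) (Cs i) (b (Suc i))"
    using AR unfolding AR_angle_def by (metis diff_Suc_1)
  thus ?thesis using left_approximation_iff[OF subC X_Obj[of "Suc i"]] * A h by auto
qed

text \<open>An endomorphism of the i-th triangle of the angle; a correspondence between
  endomorphisms of X_{i+1} and of X_i.\<close>

definition tri_end :: "nat \<Rightarrow> 'm \<Rightarrow> 'm \<Rightarrow> 'm \<Rightarrow> bool" where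
  "tri_end i r c h \<longleftrightarrow> arr (Xs (Suc i)) (Xs (Suc i)) r \<and> arr (Cs i) (Cs i) c \<and> arr (Xs i) (Xs i) h \<and>
     r \<cdot> b (Suc i) = b (Suc i) \<cdot> c \<and> a i \<cdot> h = c \<cdot> a i \<and> d i \<cdot> \<Sigma>m r = h \<cdot> d i"

lemma b_lift:
  assumes i: "i < n" and r: "arr (Xs (Suc i)) (Xs (Suc i)) r"
  shows "\<exists>c. arr (Cs i) (Cs i) c \<and> r \<cdot> b (Suc i) = b (Suc i) \<cdot> c"
proof (rule b_factor[OF i Cs_C[OF i] arr_cmp[OF r b_arr[OF i]]])
  assume "Suc i = n"
  thus "rad (Xs n) (Cs i) (r \<cdot> b (Suc i))" using rad_cmp_left[OF bn_rad] r by auto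
qed

lemma a_lift:
  assumes i: "i < n" and h: "arr (Xs i) (Xs i) h"
  shows "\<exists>c. arr (Cs i) (Cs i) c \<and> a i \<cdot> h = c \<cdot> a i"
proof (rule a_factor[OF i Cs_C[OF i] arr_cmp[OF a_arr[OF i] h]])
  assume "i = 0"
  thus "rad (Cs i) X (a i \<cdot> h)" using rad_cmp_right[OF a0_rad] h by auto
qed

lemma tri_end_down:
  assumes i: "i < n" and r: "arr (Xs (Suc i)) (Xs (Suc i)) r"
  shows "\<exists>c h. tri_end i r c h"
proof -
  obtain c where c: "arr (Cs i) (Cs i) c" "r \<cdot> b (Suc i) = b (Suc i) \<cdot> c" using b_lift[OF i r] by blast
  obtain h where "arr (Xs i) (Xs i) h" "a i \<cdot> h = c \<cdot> a i" "d i \<cdot> \<Sigma>m r = h \<cdot> d i"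
    using Tri_mor[OF tri[OF i] tri[OF i] r c(1) c(2)[symmetric]] by blast
  thus ?thesis using c r unfolding tri_end_def by blast
qed

text \<open>If one outer component is invertible, its inverse also lifts to the middle term, and
  minimality of the map joining the two makes c invertible. A five lemma yields the other outer
  component.\<close>

lemma tri_end_inv:
  assumes i: "i < n" and t: "tri_end i r c h"
  shows "inv_arr (Xs (Suc i)) (Xs (Suc i)) r \<longleftrightarrow> inv_arr (Xs i) (Xs i) h"
proof
  have r: "arr (Xs (Suc i)) (Xs (Suc i)) r" and c: "arr (Cs i) (Cs i) c" and h: "arr (Xs i) (Xs i) h"
    and e1: "r \<cdot> b (Suc i) = b (Suc i) \<cdot> c" and e2: "a i \<cdot> h = c \<cdot> a i" and e3: "d i \<cdot> \<Sigma>m r = h \<cdot> d i"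
    using t unfolding tri_end_def by blast+
  {
    assume inv: "inv_arr (Xs i) (Xs i) h"
    then obtain h' where h': "arr (Xs i) (Xs i) h'" "h \<cdot> h' = idm (Xs i)" "h' \<cdot> h = idm (Xs i)"
      unfolding inv_arr_def by blast
    obtain c' where c': "arr (Cs i) (Cs i) c'" "a i \<cdot> h' = c' \<cdot> a i" using a_lift[OF i h'(1)] by blast
    have "inv_arr (Cs i) (Cs i) c"
      by (rule right_minimal_iso[OF a_minimal[OF i] a_minimal[OF i] a_arr[OF i] a_arr[OF i] c c'(1) h h' e2 c'(2)])
    thus "inv_arr (Xs (Suc i)) (Xs (Suc i)) r"
      using five1[OF tri[OF i] tri[OF i] r _ inv e1[symmetric] e2 e3] by blast
  }
  {
    assume inv: "inv_arr (Xs (Suc i)) (Xs (Suc i)) r"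
    then obtain r' where r': "arr (Xs (Suc i)) (Xs (Suc i)) r'" "r \<cdot> r' = idm (Xs (Suc i))"
      "r' \<cdot> r = idm (Xs (Suc i))" unfolding inv_arr_def by blast
    obtain c' where c': "arr (Cs i) (Cs i) c'" "r' \<cdot> b (Suc i) = b (Suc i) \<cdot> c'" using b_lift[OF i r'(1)] by blast
    have "inv_arr (Cs i) (Cs i) c"
      by (rule left_minimal_iso[OF b_minimal[OF i] b_arr[OF i] c c'(1) r r' e1 c'(2)])
    thus "inv_arr (Xs i) (Xs i) h"
      using five3[OF tri[OF i] tri[OF i] inv _ h e1[symmetric] e2 e3] by blast
  }
qed

text \<open>The correspondence \<open>tri_end\<close> is additive and respects invertibility in both
  directions, so the local property passes from X_i to X_{i+1}.\<close>

lemma local_Xs: "i \<le> n \<Longrightarrow> local_end T (Xs i)"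
proof (induct i)
  case 0 thus ?case using local_X by simp
next
  case (Suc i)
  hence i: "i < n" and l: "local_end T (Xs i)" by auto
  let ?Y = "Xs (Suc i)"
  have o: "?Y \<in> Obj T" "Xs i \<in> Obj T" using X_Obj Suc by auto
  have "idm ?Y \<noteq> 0"
  proof
    assume z: "idm ?Y = 0"
    hence "inv_arr ?Y ?Y 0" using inv_id[OF o(1)] by simp
    \<comment> \<open>If X_{i+1} were zero, its zero endomorphism would be invertible, and so would
      the zero endomorphism of X_i.\<close>
    moreover have "tri_end i 0 0 0"
      using o Cs_Obj[OF i] a_arr[OF i] b_arr[OF i] d_arr[OF i] eqv_zero[OF eqvS o(1,1)] by (simp add: tri_end_def)
    ultimately have "inv_arr (Xs i) (Xs i) 0" using tri_end_inv[OF i] by blast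
    thus False using local_not_inv_zero[OF l] by blast
  qed
  moreover have "inv_arr ?Y ?Y f \<or> inv_arr ?Y ?Y g"
    if fg: "arr ?Y ?Y f" "arr ?Y ?Y g" "inv_arr ?Y ?Y (f + g)" for f g
  proof -
    obtain c h where f: "tri_end i f c h" using tri_end_down[OF i fg(1)] by blast
    obtain c' h' where g: "tri_end i g c' h'" using tri_end_down[OF i fg(2)] by blast
    have 1: "arr (Cs i) (Cs i) c" "arr (Xs i) (Xs i) h" "f \<cdot> b (Suc i) = b (Suc i) \<cdot> c" "a i \<cdot> h = c \<cdot> a i"
      "d i \<cdot> \<Sigma>m f = h \<cdot> d i" using f unfolding tri_end_def by blast+
    have 2: "arr (Cs i) (Cs i) c'" "arr (Xs i) (Xs i) h'" "g \<cdot> b (Suc i) = b (Suc i) \<cdot> c'"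
      "a i \<cdot> h' = c' \<cdot> a i" "d i \<cdot> \<Sigma>m g = h' \<cdot> d i" using g unfolding tri_end_def by blast+
    have "tri_end i (f + g) (c + c') (h + h')"
      unfolding tri_end_def
    proof (intro conjI)
      show "(f + g) \<cdot> b (Suc i) = b (Suc i) \<cdot> (c + c')"
        using add_cmp[OF fg(1,2) b_arr[OF i]] cmp_add[OF b_arr[OF i] 1(1) 2(1)] 1 2 by simp
      show "a i \<cdot> (h + h') = (c + c') \<cdot> a i"
        using add_cmp[OF 1(1) 2(1) a_arr[OF i]] cmp_add[OF a_arr[OF i] 1(2) 2(2)] 1 2 by simp
      show "d i \<cdot> \<Sigma>m (f + g) = (h + h') \<cdot> d i"
        using add_cmp[OF 1(2) 2(2) d_arr[OF i]] eqv_add[OF eqvS fg(1,2)]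
          cmp_add[OF d_arr[OF i] eqv_arr[OF eqvS fg(1)] eqv_arr[OF eqvS fg(2)]] 1 2 by simp
    qed (rule arr_add[OF fg(1,2)], rule arr_add[OF 1(1) 2(1)], rule arr_add[OF 1(2) 2(2)])
    hence "inv_arr (Xs i) (Xs i) (h + h')" using tri_end_inv[OF i] fg by blast
    hence "inv_arr (Xs i) (Xs i) h \<or> inv_arr (Xs i) (Xs i) h'" by (rule localI_sum[OF l 1(2) 2(2)])
    thus ?thesis using tri_end_inv[OF i f] tri_end_inv[OF i g] by blast
  qed
  ultimately show ?case using o by (simp add: local_end_def arr_def inv_arr_iff)
qed

text \<open>This makes the \<open>X\<^sub>i\<close> behave like simple objects modulo maps factoring through the \<open>C\<^sub>i\<close>.\<close>

lemma noninv_d: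
  assumes "i < n" "arr (Xs i) (Xs i) h" "\<not> inv_arr (Xs i) (Xs i) h"
  shows "h \<cdot> d i = 0"
  using assms
proof (induct i arbitrary: h)
  case 0
  have "rad X X h" using rad_local_end[OF local_X] 0 by simp
  then obtain g where g: "arr X (Cs 0) g" "h = g \<cdot> a 0" using a_factor[OF 0(1) X0_C] 0(2) by auto
  have d: "ex3 (Cs 0) X (\<Sigma> (Xs (Suc 0))) (a 0) (d 0)" using ex_ad[OF 0(1)] by simp
  show ?case using assoc[OF g(1) ex3D(1,2)[OF d]] ex3D(3)[OF d] g by simp
next
  case (Suc i)
  have i: "i < n" using Suc(2) by simp
  obtain c k where k: "tri_end i h c k" using tri_end_down[OF i Suc(3)] by blast
  have "k \<cdot> d i = 0"
    by (rule Suc(1)[OF i]) (use k tri_end_inv[OF i k] Suc(4) in \<open>auto simp: tri_end_def\<close>)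
  \<comment> \<open>So h factors as b_{i+1} followed by a map \<open>t\<close> from C_i. As C_i lies
    in C, \<open>t\<close> lifts through the approximation a_{i+1}, which d_{i+1} kills.\<close>
  hence "d i \<cdot> \<Sigma>m h = 0" using k by (simp add: tri_end_def)
  then obtain s where s: "arr (\<Sigma> (Cs i)) (\<Sigma> (Xs (Suc i))) s" "\<Sigma>m h = \<Sigma>m (b (Suc i)) \<cdot> s"
    using ex3D(5)[OF ex_db[OF i] eqv_arr[OF eqvS Suc(3)]] by blast
  have XO: "Xs (Suc i) \<in> Obj T" using X_Obj Suc(2) by simp
  obtain t where t: "arr (Cs i) (Xs (Suc i)) t" "\<Sigma>m t = s" using eqv_full[OF eqvS Cs_Obj[OF i] XO s(1)] by blast
  have h: "h = b (Suc i) \<cdot> t"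
    using eqv_faithful[OF eqvS Suc(3) arr_cmp[OF b_arr[OF i] t(1)]] eqv_cmp[OF eqvS b_arr[OF i] t(1)] s t by simp
  obtain u where u: "arr (Cs i) (Cs (Suc i)) u" "t = u \<cdot> a (Suc i)" using a_factor[OF Suc(2) Cs_C[OF i] t(1)] by auto
  note x = ex3D[OF ex_ad[OF Suc(2)]]
  have "t \<cdot> d (Suc i) = 0" using u assoc[OF u(1) x(1,2)] x(3) by simp
  thus ?case using h assoc[OF b_arr[OF i] t(1) x(2)] b_arr[OF i] by simp
qed

lemma noninv_d':
  assumes i: "i < n" and r: "arr (Xs (Suc i)) (Xs (Suc i)) r" "\<not> inv_arr (Xs (Suc i)) (Xs (Suc i)) r"
  shows "d i \<cdot> \<Sigma>m r = 0"
proof -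
  obtain c k where k: "tri_end i r c k" using tri_end_down[OF i r(1)] by blast
  have "k \<cdot> d i = 0"
    by (rule noninv_d[OF i]) (use k tri_end_inv[OF i k] r(2) in \<open>auto simp: tri_end_def\<close>)
  thus ?thesis using k by (simp add: tri_end_def)
qed

text \<open>The composite X -> X_1[1] -> ... -> X_k[k] of shifted connecting maps, which realises
  the likeness of X_k to X[-k].\<close>

primrec chain :: "nat \<Rightarrow> 'm" where
  "chain 0 = idm X"
| "chain (Suc k) = chain k \<cdot> shm k (d k)"

lemma d_sh: "k < n \<Longrightarrow> arr (sh k (Xs k)) (sh (Suc k) (Xs (Suc k))) (shm k (d k))"
  using sh_arr[OF d_arr, of k k] by (simp add: sh_Suc')

lemma chain_arr: "k \<le> n \<Longrightarrow> arr X (sh k (Xs k)) (chain k)"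
proof (induct k)
  case 0 thus ?case using C_Obj[OF X0_C] by simp
next
  case (Suc k) thus ?case using d_sh[of k] by (auto intro: arr_cmp)
qed

text \<open>If the next composite vanished, \<open>chain k\<close> would lift to C_k[k]. For 0 < k <
  n there are no nonzero maps X -> C_k[k]; for k = 0 the identity of X would factor through the sink
  map and be radical.\<close>

lemma chain_nonzero: "k \<le> n \<Longrightarrow> chain k \<noteq> 0"
proof (induct k)
  case 0 thus ?case using local_nz[OF local_X] by simp
next
  case (Suc k)
  hence k: "k < n" and nz: "chain k \<noteq> 0" by auto
  show ?case
  proof
    assume "chain (Suc k) = 0"
    hence z: "chain k \<cdot> shm k (d k) = 0" by simp
    have e: "ex3 (sh k (Cs k)) (sh k (Xs k)) (sh k (\<Sigma> (Xs (Suc k)))) (shm k (a k)) (shm k (d k))"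
      using sh_ex3[OF ex_ad[OF k]] .
    obtain g where g: "arr X (sh k (Cs k)) g" "chain k = g \<cdot> shm k (a k)"
      using ex3D(4)[OF e chain_arr z] k by auto
    show False
    proof (cases "k = 0")
      case True
      hence "rad X X (idm X)" using g rad_cmp_left[OF a0_rad, of X g] by simp
      hence "inv_arr X X (idm X - idm X \<cdot> idm X)"
        using C_Obj[OF X0_C] unfolding rad_def by blast
      thus False using id_left[OF arr_id[OF C_Obj[OF X0_C]]] local_not_inv_zero[OF local_X] by simp
    next
      case False
      hence "hom0 X (sh k (Cs k))" using ct_rigid[OF C X0_C Cs_C[OF k]] k by simp
      thus False using g nz ex3D(1)[OF e] by (auto simp: hom0_def)
    qed
  qed
qed

text \<open>Duality detects \<open>chain n\<close> by a map that desuspends to h : X_n ->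
  \<open>N 1 X\<close>. If h were radical it would factor through the source map b_n, which the last
  connecting map kills, contrary to detection. So h is a nonradical map of local objects.\<close>

lemma Xn_iso: "iso T (Xs n) (N 1 X)"
proof -
  have NX: "N 1 X \<in> C" using ct_N[OF C X0_C] .
  obtain g where g: "arr (sh n (Xs n)) (sh n (N 1 X)) g" "chain n \<cdot> g \<noteq> 0"
    using serre_n_nondegenerate[OF chain_arr chain_nonzero] by blast
  obtain h where h: "arr (Xs n) (N 1 X) h" "shm n h = g"
    using sh_full[OF C_Obj[OF Xn_C] C_Obj[OF NX] g(1)] by blast
  have "\<not> rad (Xs n) (N 1 X) h"
  proof
    assume r: "rad (Xs n) (N 1 X) h"
    obtain k where n: "n = Suc k" using n1 by (cases n) auto
    hence k: "k < n" by simp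
    obtain u where u: "arr (Cs k) (N 1 X) u" "h = b (Suc k) \<cdot> u" using b_factor[OF k NX] h r n by auto
    note x = ex3D[OF sh_ex3[OF ex_db[OF k], of k]]
    have gu: "g = shm k (\<Sigma>m (b (Suc k))) \<cdot> shm k (\<Sigma>m u)"
      using h u sh_cmp[OF b_arr[OF k] u(1), of n] by (simp add: n shm_Suc')
    have v: "arr (sh k (\<Sigma> (Cs k))) (sh n (N 1 X)) (shm k (\<Sigma>m u))"
      using sh_arr[OF u(1), of n] by (simp add: n shm_Suc' sh_Suc')
    have c: "arr X (sh k (Xs k)) (chain k)" using chain_arr k by simp
    have g': "arr (sh k (\<Sigma> (Xs (Suc k)))) (sh n (N 1 X)) g" using g(1) by (simp add: n sh_Suc')
    have "chain n \<cdot> g = chain k \<cdot> (shm k (d k) \<cdot> g)"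
      using assoc[OF c x(1) g'] by (simp add: n)
    also have "shm k (d k) \<cdot> g = 0" using gu assoc[OF x(1,2) v] x(3) v by simp
    finally show False using g c by simp
  qed
  thus ?thesis
    using inv_cmp_retract_iso[OF local_Xs[of n] _ h(1)] N_local[OF C_Obj[OF X0_C]] local_X by simp
qed

section \<open>Vanishing of maps between C and the shifted X_i\<close>

lemma ex_db_sh: "i < n \<Longrightarrow> ex3 (sh j (Xs i)) (sh (Suc j) (Xs (Suc i))) (sh (Suc j) (Cs i)) (shm j (d i)) (shm (Suc j) (b (Suc i)))"
  using sh_ex3[OF ex_db, of i j] by (simp add: sh_Suc' shm_Suc')

text \<open>Dimension shifting: as (U, C_{i-1}[j]) = 0, maps U -> X_i[j] come from maps U ->
  X_{i-1}[j-1]. Once the shift is used up, maps into an unshifted X_k lift through a_k and die under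
  d_k. The exception j = i ends at maps U -> X, of which only the radical ones lift.\<close>

lemma hom0_C_X:
  assumes "i \<le> n" "0 < j" "j < n" "U \<in> C" "j \<noteq> i \<or> \<not> retract X U"
  shows "hom0 U (sh j (Xs i))"
  using assms
proof (induct i arbitrary: j)
  case 0 thus ?case using ct_rigid[OF C _ X0_C] by simp
next
  case (Suc i)
  then obtain k where j: "j = Suc k" by (cases j) auto
  have i: "i < n" using Suc by simp
  have x: "ex3 (sh k (Xs i)) (sh j (Xs (Suc i))) (sh j (Cs i)) (shm k (d i)) (shm j (b (Suc i)))"
    using ex_db_sh[OF i] j by simp
  have c: "hom0 U (sh j (Cs i))" using ct_rigid[OF C Suc(5) Cs_C[OF i]] Suc by simp
  show ?case
  proof (cases "k = 0")
    case False
    hence "hom0 U (sh k (Xs i))" using Suc(1)[of k] Suc(2-) j by auto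
    thus ?thesis using ex3_hom0_right[OF x _ c] by blast
  next
    case True
    show ?thesis unfolding hom0_def
    proof (intro allI impI)
      fix h assume h: "arr U (sh j (Xs (Suc i))) h"
      have "h \<cdot> shm j (b (Suc i)) = 0" using c h ex3D(2)[OF x] by (auto simp: hom0_def)
      then obtain g where g: "arr U (Xs i) g" "h = g \<cdot> d i" using ex3D(4)[OF x h] True by auto
      have "i = 0 \<Longrightarrow> rad U X g" using rad_to_local[OF local_X _, of U g] g Suc(6) j True by auto
      then obtain g' where g': "arr U (Cs i) g'" "g = g' \<cdot> a i" using a_factor[OF i Suc(5) g(1)] by blast
      note y = ex3D[OF ex_ad[OF i]]
      show "h = 0" using g g' assoc[OF g'(1) y(1,2)] y(3) by simp
    qed
  qed
qed

text \<open>The Serre dual of \<open>hom0_C_X\<close>, with n - j in place of j; the exceptional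
  summand becomes \<open>N 1 X\<close>, that is X_n.\<close>

lemma hom0_X_C:
  assumes i: "i \<le> n" and j: "0 < j" "j < n" and U: "U \<in> C" and r: "n - j \<noteq> i \<or> \<not> retract (N 1 X) U"
  shows "hom0 (Xs i) (sh j U)"
proof -
  have o: "U \<in> Obj T" "Xs i \<in> Obj T" using C_Obj[OF U] X_Obj[OF i] by auto
  have NU: "N (-1) U \<in> C" using ct_N[OF C U] .
  have "retract X (N (-1) U) \<longleftrightarrow> retract (N 1 X) U" using N_retract_swap[OF C_Obj[OF X0_C] o(1), of 1] by simp
  hence "hom0 (N (-1) U) (sh (n - j) (Xs i))" using hom0_C_X[OF i _ _ NU, of "n - j"] j r by auto
  hence "hom0 U (sh (n - j) (N 1 (Xs i)))" using hom0_N_left[OF o, of "n - j" "-1"] by simp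
  thus ?thesis using hom0_serre_sh[OF o(2,1), of j] j by simp
qed

end

section \<open>Transport of factorisations along equivalences\<close>

context triangulated_category
begin

text \<open>Used to move sink maps and approximations along \<open>N l\<close>: the test object D is
  replaced by an isomorphic G D', for which the factorisation is known.\<close>

lemma eqv_factor:
  assumes G: "eqv G \<Phi>" and q: "arr B X q" and D: "D' \<in> Obj T" "iso T (G D') D"
    and fac: "\<And>h. arr D' X h \<Longrightarrow> \<exists>g. arr D' B g \<and> h = g \<cdot> q" and h: "arr D (G X) h"
  shows "\<exists>g. arr D (G B) g \<and> h = g \<cdot> \<Phi> B X q"
proof -
  have X: "X \<in> Obj T" using q by (rule arrD(2))
  obtain s t where st: "arr (G D') D s" "arr D (G D') t" "t \<cdot> s = idm D" using isoE[OF D(2)] by metis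
  obtain h' where h': "arr D' X h'" "\<Phi> D' X h' = s \<cdot> h" using eqv_full[OF G D(1) X arr_cmp[OF st(1) h]] by blast
  obtain g where g: "arr D' B g" "h' = g \<cdot> q" using fac[OF h'(1)] by blast
  have Gg: "arr (G D') (G B) (\<Phi> D' B g)" using eqv_arr[OF G g(1)] .
  have "h = t \<cdot> (s \<cdot> h)" using assoc[OF st(2,1) h] st id_left[OF h] by simp
  also have "s \<cdot> h = \<Phi> D' B g \<cdot> \<Phi> B X q" using eqv_cmp[OF G g(1) q] h' g by simp
  finally have "h = (t \<cdot> \<Phi> D' B g) \<cdot> \<Phi> B X q" using assoc[OF st(2) Gg eqv_arr[OF G q]] by simp
  thus ?thesis using arr_cmp[OF st(2) Gg] by blast
qed

lemma eqv_factor_left: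
  assumes G: "eqv G \<Phi>" and q: "arr X B q" and D: "D' \<in> Obj T" "iso T (G D') D"
    and fac: "\<And>h. arr X D' h \<Longrightarrow> \<exists>g. arr B D' g \<and> h = q \<cdot> g" and h: "arr (G X) D h"
  shows "\<exists>g. arr (G B) D g \<and> h = \<Phi> X B q \<cdot> g"
proof -
  have X: "X \<in> Obj T" using q by (rule arrD(1))
  obtain s t where st: "arr (G D') D s" "arr D (G D') t" "t \<cdot> s = idm D" using isoE[OF D(2)] by metis
  obtain h' where h': "arr X D' h'" "\<Phi> X D' h' = h \<cdot> t" using eqv_full[OF G X D(1) arr_cmp[OF h st(2)]] by blast
  obtain g where g: "arr B D' g" "h' = q \<cdot> g" using fac[OF h'(1)] by blast
  have Gg: "arr (G B) (G D') (\<Phi> B D' g)" using eqv_arr[OF G g(1)] .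
  have "h = (h \<cdot> t) \<cdot> s" using assoc[OF h st(2,1)] st id_right[OF h] by simp
  also have "h \<cdot> t = \<Phi> X B q \<cdot> \<Phi> B D' g" using eqv_cmp[OF G q g(1)] h' g by simp
  finally have "h = \<Phi> X B q \<cdot> (\<Phi> B D' g \<cdot> s)" using assoc[OF eqv_arr[OF G q] Gg st(1)] by simp
  thus ?thesis using arr_cmp[OF Gg st(1)] by blast
qed

end

subsection \<open>Objects orthogonal to the remaining summands\<close>

locale ar_noloops = ar_angle T S n C X Xs Cs a b
  for T :: "('k::field, 'o, 'm::ab_group_add, 'z) tricat_scheme" (structure)
    and S :: "('o, 'm) endofunctor" and n :: nat and C :: "'o set" and X :: 'o
    and Xs Cs :: "nat \<Rightarrow> 'o" and a b :: "nat \<Rightarrow> 'm" +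
  assumes no_loop: "i < n \<Longrightarrow> \<not> retract (N l X) (Cs i)"
begin

definition F0 :: "'o set set" where "F0 = ind T C - serre_orbit T S n X"
text \<open>The D of the overview.\<close>

definition D0 :: "'o set" where "D0 = addcl F0"

lemmas subD = subcategory_addcl[of F0, folded D0_def]
lemmas D_Obj = sub_Obj[OF subD]

lemma X_O: "X \<in> Obj T" using C_Obj[OF X0_C] .
lemma local_NX: "i \<le> n \<Longrightarrow> local_end T (N l (Xs i))"
  using N_local[OF X_Obj] local_Xs by blast

lemma D0_iff: "Y \<in> D0 \<longleftrightarrow> Y \<in> C \<and> (\<forall>l. \<not> retract (N l X) Y)"
proof
  assume Y: "Y \<in> D0"
  hence Yo: "Y \<in> Obj T" and *: "\<And>A. local_end T A \<Longrightarrow> retract A Y \<Longrightarrow> isoclass T A \<in> F0"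
    by (auto simp: D0_def addcl_def)
  have "Y \<in> C" using sub_local[OF subC Yo] * sub_ind[OF subC] unfolding F0_def by blast
  moreover have "\<not> retract (N l X) Y" for l
  proof
    assume "retract (N l X) Y"
    hence "isoclass T (N l X) \<notin> serre_orbit T S n X" using *[of "N l X"] local_NX[of 0 l] by (simp add: F0_def)
    thus False using orbit_iff[OF N_Obj[OF X_O]] iso_refl[OF N_Obj[OF X_O]] by blast
  qed
  ultimately show "Y \<in> C \<and> (\<forall>l. \<not> retract (N l X) Y)" by blast
next
  assume Y: "Y \<in> C \<and> (\<forall>l. \<not> retract (N l X) Y)"
  have "isoclass T A \<in> F0" if A: "local_end T A" "retract A Y" for A
  proof -
    have "A \<in> C" using sub_retract[OF subC] Y A by blast
    hence "isoclass T A \<in> ind T C" using sub_ind[OF subC A(1)] by blast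
    moreover have "isoclass T A \<notin> serre_orbit T S n X"
      using orbit_iff[OF local_Obj[OF A(1)]] Y A(2) retract_iso_left by blast
    ultimately show ?thesis by (simp add: F0_def)
  qed
  thus "Y \<in> D0" using Y C_Obj by (auto simp: D0_def addcl_def)
qed

lemma D0_C: "Y \<in> D0 \<Longrightarrow> Y \<in> C" and D0_not: "Y \<in> D0 \<Longrightarrow> \<not> retract (N l X) Y"
  using D0_iff by blast+

lemma Cs_D0: "i < n \<Longrightarrow> Cs i \<in> D0"
  using D0_iff Cs_C no_loop by blast

lemma D0_N: assumes Y: "Y \<in> D0" shows "N l Y \<in> D0"
  unfolding D0_iff
proof (intro conjI allI notI)
  show "N l Y \<in> C" using ct_N[OF C D0_C[OF Y]] .
  fix k assume "retract (N k X) (N l Y)"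
  hence "retract (N (- l) (N k X)) Y"
    using N_retract_swap[OF N_Obj[OF X_O] D_Obj[OF Y], of "- l" k] by simp
  hence "retract (N (- l + k) X) Y" using retract_iso_left[OF N_add[OF X_O]] by blast
  thus False using D0_not[OF Y] by blast
qed

lemma local_C_cases:
  assumes "local_end T A" "A \<in> C" shows "A \<in> D0 \<or> (\<exists>l. iso T A (N l X))"
proof (cases "A \<in> D0")
  case False
  then obtain l where "retract (N l X) A" using assms D0_iff by blast
  hence "iso T (N l X) A" using local_iso_of_retract[OF local_NX[of 0 l] assms(1)] by simp
  thus ?thesis using iso_sym by blast
qed simp

text \<open>An object of \<open>D0\<close> has no summand X, so its maps to X are automatically
  radical.\<close>

lemma a_factor0:
  assumes i: "i < n" and A: "A \<in> D0" and h: "arr A (Xs i) h"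
  shows "\<exists>g. arr A (Cs i) g \<and> h = g \<cdot> a i"
proof (rule a_factor[OF i D0_C[OF A] h])
  assume "i = 0"
  thus "rad A X h" using rad_to_local[OF local_X, of A h] D0_not[OF A, of 0] h by simp
qed

lemma b_factor0:
  assumes i: "i < n" and A: "A \<in> D0" and h: "arr (Xs (Suc i)) A h"
  shows "\<exists>g. arr (Cs i) A g \<and> h = b (Suc i) \<cdot> g"
proof (rule b_factor[OF i D0_C[OF A] h])
  assume "Suc i = n"
  moreover have "\<not> retract (Xs n) A" using D0_not[OF A, of 1] retract_iso_left[OF Xn_iso] by blast
  ultimately show "rad (Xs n) A h" using rad_from_local[OF local_Xs[of n]] h by simp
qed

lemma hom0_D0_X: "i \<le> n \<Longrightarrow> 0 < j \<Longrightarrow> j < n \<Longrightarrow> A \<in> D0 \<Longrightarrow> hom0 A (sh j (Xs i))"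
  using hom0_C_X[of i j A] D0_C[of A] D0_not[of A 0] by simp

definition orth :: "'o \<Rightarrow> bool" where
  "orth Y \<longleftrightarrow> Y \<in> Obj T \<and> (\<forall>A\<in>D0. \<forall>j. 0 < j \<longrightarrow> j < n \<longrightarrow> hom0 A (sh j Y))"

lemma orth_right: "orth Y \<Longrightarrow> A \<in> D0 \<Longrightarrow> 0 < j \<Longrightarrow> j < n \<Longrightarrow> hom0 A (sh j Y)"
  by (simp add: orth_def)

text \<open>Serre duality carries right orthogonality over because \<open>D0\<close> is stable under
  \<open>N\<close>.\<close>

lemma orth_left: assumes Y: "orth Y" and A: "A \<in> D0" and j: "0 < j" "j < n" shows "hom0 Y (sh j A)"
proof -
  have o: "Y \<in> Obj T" "A \<in> Obj T" using Y D_Obj[OF A] by (auto simp: orth_def)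
  have "hom0 (N (-1) A) (sh (n - j) Y)" using orth_right[OF Y D0_N[OF A]] j by simp
  hence "hom0 A (sh (n - j) (N 1 Y))" using hom0_N_left[OF o(2,1), of "n - j" "-1"] by simp
  thus ?thesis using hom0_serre_sh[OF o, of j] j by simp
qed

lemma orth_N: assumes Y: "orth Y" shows "orth (N l Y)"
  unfolding orth_def
proof (intro conjI ballI allI impI)
  have o: "Y \<in> Obj T" using Y by (simp add: orth_def)
  show "N l Y \<in> Obj T" using N_Obj[OF o] .
  fix A j assume A: "A \<in> D0" and j: "0 < j" "j < n"
  have "hom0 (N (- l) A) (sh j Y)" using orth_right[OF Y D0_N[OF A] j] .
  thus "hom0 A (sh j (N l Y))" using hom0_N_left[OF D_Obj[OF A] o, of j "- l"] j by simp
qed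

lemma orth_X: "i \<le> n \<Longrightarrow> orth (Xs i)"
  using X_Obj hom0_D0_X by (simp add: orth_def)

text \<open>A nonzero \<open>h : X \<rightarrow> Y[j]\<close> factors through \<open>X \<rightarrow> X\<^sub>j[j]\<close>, and a map \<open>Y[j] \<rightarrow> X\<^sub>n[n]\<close> detecting
  \<open>h\<close> by Serre duality factors through \<open>X\<^sub>j[j] \<rightarrow> X\<^sub>n[n]\<close>. The resulting endomorphism of \<open>X\<^sub>j\<close> is
  not killed by the connecting map, hence invertible.\<close>

lemma orth_iso_X:
  assumes l: "local_end T Y" and Y: "orth Y" and j: "0 < j" "j < n" and h: "arr X (sh j Y) h" and nz: "h \<noteq> 0"
  shows "iso T Y (Xs j)"
proof -
  have Yo: "Y \<in> Obj T" using Y by (simp add: orth_def)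
  \<comment> \<open>Orthogonality forbids nonzero maps C_k -> Y[j-k] while j - k > 0, so at each
    such stage the map on X_k extends along d_k.\<close>
  have "k \<le> j \<Longrightarrow> \<exists>f. arr (Xs k) (sh (j - k) Y) f \<and> h = chain k \<cdot> shm k f" for k
  proof (induct k)
    case 0 thus ?case using h id_left[OF h] by auto
  next
    case (Suc k)
    hence k: "k < j" "k < n" using j by auto
    obtain f where f: "arr (Xs k) (sh (j - k) Y) f" "h = chain k \<cdot> shm k f" using Suc by auto
    note x = ex3D[OF ex_ad[OF k(2)]]
    have "hom0 (Cs k) (sh (j - k) Y)" using orth_right[OF Y Cs_D0[OF k(2)]] k j by simp
    hence "a k \<cdot> f = 0" using x(1) f by (auto simp: hom0_def)
    then obtain g where g: "arr (\<Sigma> (Xs (Suc k))) (sh (j - k) Y) g" "f = d k \<cdot> g" using x(5)[OF f(1)] by blast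
    have jk: "j - k = Suc (j - Suc k)" using k by simp
    obtain f' where f': "arr (Xs (Suc k)) (sh (j - Suc k) Y) f'" "\<Sigma>m f' = g"
      using eqv_full[OF eqvS X_Obj[of "Suc k"] sh_Obj[OF Yo, of "j - Suc k"]] g(1) k
      by (auto simp: jk sh_Suc)
    have s: "shm k f = shm k (d k) \<cdot> shm (Suc k) f'"
      using sh_cmp[OF x(2) g(1), of k] g f' by (simp add: shm_Suc')
    have "arr (sh (Suc k) (Xs (Suc k))) (sh j Y) (shm (Suc k) f')"
      using sh_arr[OF f'(1), of "Suc k"] k by (simp add: sh_sh)
    hence "h = chain (Suc k) \<cdot> shm (Suc k) f'"
      using f(2) s assoc[OF chain_arr d_sh[OF k(2)]] k by simp
    thus ?case using f' by blast
  qed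
  from this[of j] obtain f where f: "arr (Xs j) Y f" "h = chain j \<cdot> shm j f" by auto
  obtain g where g: "arr (sh j Y) (sh n (Xs n)) g" "h \<cdot> g \<noteq> 0"
  proof -
    obtain g where g: "arr (sh j Y) (sh n (N 1 X)) g" "h \<cdot> g \<noteq> 0" using serre_n_nondegenerate[OF h nz] by blast
    obtain s t where st: "arr (sh n (Xs n)) (sh n (N 1 X)) s" "arr (sh n (N 1 X)) (sh n (Xs n)) t"
      "t \<cdot> s = idm (sh n (N 1 X))" using isoE[OF sh_iso[OF Xn_iso]] by metis
    have "g = (g \<cdot> t) \<cdot> s" using assoc[OF g(1) st(2,1)] st id_right[OF g(1)] by simp
    hence "h \<cdot> g = (h \<cdot> (g \<cdot> t)) \<cdot> s" using assoc[OF h arr_cmp[OF g(1) st(2)] st(1)] by simp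
    hence "h \<cdot> (g \<cdot> t) \<noteq> 0" using g st by auto
    thus thesis using that[OF arr_cmp[OF g(1) st(2)]] by blast
  qed
  have nj: "n = j + (n - j)" using j by simp
  obtain g0 where g0: "arr Y (sh (n - j) (Xs n)) g0" "shm j g0 = g"
    using sh_full[OF Yo sh_Obj[OF X_Obj[of n], of "n - j"], of j g] g(1) j by (auto simp: sh_sh)
  \<comment> \<open>The dual descent: nonzero maps from Y to C_q[p+1] are excluded by
    \<open>orth_left\<close>, so the map lifts back one connecting map at a time until the unshifted
    X_j is reached.\<close>
  have "m \<le> n - j \<Longrightarrow> \<exists>g' \<rho>. arr Y (sh (n - j - m) (Xs (n - m))) g' \<and>
      arr (sh (n - j - m) (Xs (n - m))) (sh (n - j) (Xs n)) \<rho> \<and> g0 = g' \<cdot> \<rho>" for m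
  proof (induct m)
    case 0
    have "arr (sh (n - j) (Xs n)) (sh (n - j) (Xs n)) (idm (sh (n - j) (Xs n)))"
      using sh_Obj[OF X_Obj[of n]] by simp
    thus ?case using g0 id_right[OF g0(1)]
      by (intro exI[of _ g0] exI[of _ "idm (sh (n - j) (Xs n))"]) simp
  next
    case (Suc m)
    then obtain g' \<rho> where g': "arr Y (sh (n - j - m) (Xs (n - m))) g'"
      and \<rho>: "arr (sh (n - j - m) (Xs (n - m))) (sh (n - j) (Xs n)) \<rho>" and e: "g0 = g' \<cdot> \<rho>" by auto
    define p where "p = n - j - Suc m"
    define q where "q = n - Suc m"
    have pq: "n - j - m = Suc p" "n - m = Suc q" "q < n" "Suc p < n" using Suc(2) j by (auto simp: p_def q_def)
    note x = ex3D[OF ex_db_sh[OF pq(3), of p]]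
    have "hom0 Y (sh (Suc p) (Cs q))" using orth_left[OF Y Cs_D0[OF pq(3)]] pq by simp
    hence "g' \<cdot> shm (Suc p) (b (Suc q)) = 0" using g' x(2) pq by (auto simp: hom0_def)
    then obtain g'' where g'': "arr Y (sh p (Xs q)) g''" "g' = g'' \<cdot> shm p (d q)" using x(4)[of Y g'] g' pq by auto
    have \<rho>': "arr (sh (Suc p) (Xs (Suc q))) (sh (n - j) (Xs n)) \<rho>" using \<rho> pq by simp
    have "g0 = g'' \<cdot> (shm p (d q) \<cdot> \<rho>)" using e g'' assoc[OF g''(1) x(1) \<rho>'] by simp
    thus ?case using g'' arr_cmp[OF x(1) \<rho>'] unfolding p_def q_def by blast
  qed
  from this[of "n - j"] obtain g' \<rho> where g': "arr Y (Xs j) g'" and \<rho>: "arr (Xs j) (sh (n - j) (Xs n)) \<rho>"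
    and e: "g0 = g' \<cdot> \<rho>" using j by auto
  have fg: "arr (Xs j) (Xs j) (f \<cdot> g')" using f g' by auto
  have "inv_arr (Xs j) (Xs j) (f \<cdot> g')"
  proof (rule ccontr)
    assume ni: "\<not> inv_arr (Xs j) (Xs j) (f \<cdot> g')"
    obtain i where i: "j = Suc i" "i < n" using j by (cases j) auto
    have "d i \<cdot> \<Sigma>m (f \<cdot> g') = 0" using noninv_d'[OF i(2)] fg ni i(1) by simp
    hence z: "shm i (d i) \<cdot> shm j (f \<cdot> g') = 0"
      using sh_cmp[OF d_arr[OF i(2)], of "\<Sigma> (Xs j)" "\<Sigma>m (f \<cdot> g')" i] eqv_arr[OF eqvS fg] i
        eqv_zero[OF eqv_sh X_Obj[of i] eqv_Obj[OF eqvS X_Obj[of j]], of i] j by (simp add: shm_Suc')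
    have c: "arr X (sh i (Xs i)) (chain i)" using chain_arr i by simp
    have di: "arr (sh i (Xs i)) (sh j (Xs j)) (shm i (d i))" using d_sh[OF i(2)] i by simp
    have sfg: "arr (sh j (Xs j)) (sh j (Xs j)) (shm j (f \<cdot> g'))" using sh_arr[OF fg] .
    have "chain j \<cdot> shm j (f \<cdot> g') = 0" using assoc[OF c di sfg] z i c by simp
    moreover have "h \<cdot> g = (chain j \<cdot> shm j (f \<cdot> g')) \<cdot> shm j \<rho>"
    proof -
      have cj: "arr X (sh j (Xs j)) (chain j)" using chain_arr j by simp
      have sf: "arr (sh j (Xs j)) (sh j Y) (shm j f)" and sg: "arr (sh j Y) (sh j (Xs j)) (shm j g')"
        and sr: "arr (sh j (Xs j)) (sh j (sh (n - j) (Xs n))) (shm j \<rho>)"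
        using sh_arr f g' \<rho> by blast+
      have "g = shm j g' \<cdot> shm j \<rho>" using sh_cmp[OF g' \<rho>, of j] g0 e by simp
      hence "h \<cdot> g = chain j \<cdot> (shm j f \<cdot> (shm j g' \<cdot> shm j \<rho>))"
        using f assoc[OF cj sf arr_cmp[OF sg sr]] by simp
      also have "\<dots> = chain j \<cdot> (shm j (f \<cdot> g') \<cdot> shm j \<rho>)"
        using assoc[OF sf sg sr] sh_cmp[OF f(1) g', of j] by simp
      finally show ?thesis using assoc[OF cj sfg sr] by simp
    qed
    ultimately show False using g sh_arr[OF \<rho>, of j] by simp
  qed
  hence "retract (Xs j) Y" using retract_of_inv[OF f(1) g'] by blast
  thus ?thesis using local_iso_of_retract[OF local_Xs l] j iso_sym by simp
qed

lemma orth_classify: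
  assumes l: "local_end T Y" and Y: "orth Y"
  shows "Y \<in> D0 \<or> (\<exists>m<n. \<exists>l. iso T Y (N l (Xs m)))"
proof (cases "Y \<in> C")
  case True
  thus ?thesis using local_C_cases[OF l] n1 X0 by (metis less_le_trans zero_less_one)
next
  case False
  have Yo: "Y \<in> Obj T" using l by (rule local_Obj)
  obtain j U where j: "0 < j" "j < n" and U: "U \<in> C" and nz: "\<not> hom0 U (sh j Y)"
    using ct_mem[OF C Yo] False by (auto simp: Suc_le_eq)
  obtain A where A: "local_end T A" "retract A U" "\<not> hom0 A (sh j Y)"
    using hom0_local_left[OF C_Obj[OF U]] nz by blast
  have AC: "A \<in> C" using sub_retract[OF subC U A(2)] .
  have "A \<notin> D0" using orth_right[OF Y _ j] A by blast
  then obtain k where k: "iso T A (N k X)" using local_C_cases[OF A(1) AC] by blast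
  have "\<not> hom0 (N k X) (sh j Y)" using A hom0_iso_left[OF k] by blast
  hence "\<not> hom0 X (sh j (N (- k) Y))" using hom0_N_left[OF X_O Yo] j by simp
  then obtain h where "arr X (sh j (N (- k) Y)) h" "h \<noteq> 0" by (auto simp: hom0_def)
  hence "iso T (N (- k) Y) (Xs j)"
    using orth_iso_X[OF _ orth_N[OF Y] j] N_local[OF Yo] l by blast
  hence "iso T Y (N k (Xs j))" using N_iso_swap[OF Yo X_Obj[of j], of "- k"] j by simp
  thus ?thesis using j by blast
qed

subsection \<open>Rigidity and incompatibility of the exchanged orbits\<close>

text \<open>Dimension shifting in the second argument: X_i[j] lies between X_{i-1}[j-1] and
  C_{i-1}[j]; i steps lead down to X[j-i].\<close>

lemma hom0_push_right:
  assumes "i \<le> n" "i \<le> j" "j < n" "\<And>A k. A \<in> D0 \<Longrightarrow> 0 < k \<Longrightarrow> k < n \<Longrightarrow> hom0 Y (sh k A)" "hom0 Y (sh (j - i) X)"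
  shows "hom0 Y (sh j (Xs i))"
  using assms
proof (induct i arbitrary: j)
  case (Suc i)
  then obtain k where j: "j = Suc k" by (cases j) auto
  have i: "i < n" using Suc(2) by simp
  have "hom0 Y (sh k (Xs i))" using Suc(1)[of k] Suc(2-) j by simp
  moreover have "hom0 Y (sh j (Cs i))" using Suc(5)[OF Cs_D0[OF i]] Suc(3,4) j by simp
  ultimately show ?case using ex3_hom0_right[OF ex_db_sh[OF i, of k]] j by simp
qed simp

text \<open>Dimension shifting in the first argument: X_i lies between C_i and X_{i+1}[1], so each
  of the t steps raises i and lowers j by one.\<close>

lemma hom0_push_left:
  assumes "Y \<in> Obj T" "i + t \<le> n" "t \<le> j" "j < n" "orth Y" "hom0 (Xs (i + t)) (sh (j - t) Y)"
  shows "hom0 (Xs i) (sh j Y)"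
  using assms
proof (induct t arbitrary: i j)
  case (Suc t)
  then obtain k where j: "j = Suc k" by (cases j) auto
  have i: "i < n" using Suc(3) by simp
  have "hom0 (Xs (Suc i)) (sh k Y)" using Suc(1)[of "Suc i" k] Suc(2-) j by simp
  hence "hom0 (\<Sigma> (Xs (Suc i))) (sh j Y)"
    using eqv_hom0[OF eqvS X_Obj[of "Suc i"] sh_Obj[OF Suc(2)]] i j by (simp add: sh_Suc)
  moreover have "hom0 (Cs i) (sh j Y)" using orth_right[OF Suc(6) Cs_D0[OF i]] Suc(4,5) by simp
  ultimately show ?case using ex3_hom0_left[OF ex_ad[OF i]] by blast
qed simp

text \<open>Pushing the second argument down to X leaves a map to a translate of X in degree j - i >
  0. The exception of \<open>hom0_X_C\<close> would require n - (j - i) = i, that is j = n.\<close>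

lemma rigid_less:
  assumes ij: "i < j" "j < n" shows "hom0 (Xs i) (sh j (N l (Xs i)))"
proof -
  have o: "Xs i \<in> Obj T" using X_Obj ij by simp
  have "n - (j - i) \<noteq> i" using ij by arith
  hence "hom0 (Xs i) (sh (j - i) (N l X))" using hom0_X_C[of i "j - i"] ct_N[OF C X0_C, of l] ij by simp
  hence 1: "hom0 (N (- l) (Xs i)) (sh (j - i) X)" using hom0_N_left[OF o X_O, of "j - i" "- l"] ij by simp
  have 2: "hom0 (N (- l) (Xs i)) (sh k A)" if "A \<in> D0" "0 < k" "k < n" for A k
    using orth_left[OF orth_N[OF orth_X] that] ij by simp
  have "hom0 (N (- l) (Xs i)) (sh j (Xs i))" using hom0_push_right[OF _ _ _ 2 1] ij by simp
  thus ?thesis using hom0_N_left[OF o o, of j "- l"] ij by simp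
qed

text \<open>The case i < j pushes the second argument down to X, and i < n - j is its Serre dual.
  For the remaining j the first argument is pushed up towards X_n; this ends in positive degree if n
  < i + j, and j = n - i is the boundary case.\<close>

lemma rigid_X:
  assumes i: "0 < i" "i < n" and j: "0 < j" "j < n" shows "hom0 (Xs i) (sh j (N l (Xs i)))"
proof -
  have o: "Xs i \<in> Obj T" using X_Obj i by simp
  let ?Y = "N l (Xs i)"
  have Yo: "?Y \<in> Obj T" using N_Obj[OF o] .
  have Y: "orth ?Y" using orth_N[OF orth_X] i by simp
  consider "i < j" | "i < n - j" | "j \<le> i" "n < i + j" | "j \<le> i" "n = i + j" by linarith
  thus ?thesis
  proof cases
    case 1 thus ?thesis using rigid_less j by blast
  next
    case 2
    have "hom0 (Xs i) (sh (n - j) (N (- l + 1) (Xs i)))" using rigid_less[of i "n - j"] 2 j by simp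
    hence "hom0 (Xs i) (sh (n - j) (N (- l) (N 1 (Xs i))))"
      using hom0_iso_sh[OF iso_refl[OF o] N_add[OF o, of "- l" 1]] by simp
    hence "hom0 ?Y (sh (n - j) (N 1 (Xs i)))" using hom0_N_left[OF o N_Obj[OF o], of "n - j" l] by simp
    thus ?thesis using hom0_serre_sh[OF o Yo, of j] j by simp
  next
    case 3
    \<comment> \<open>n - i steps turn X_i into X_n, isomorphic to \<open>N 1 X\<close>, and use up
      n - i of the shift. Since m < i, the exception of \<open>hom0_C_X\<close> is avoided.\<close>
    define m where "m = j - (n - i)"
    have m: "0 < m" "m < i" using 3 i j by (auto simp: m_def)
    have NX: "N (1 - l) X \<in> C" using ct_N[OF C X0_C] .
    have "hom0 (N (1 - l) X) (sh m (Xs i))" using hom0_C_X[of i m, OF _ _ _ NX] m i by simp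
    hence "hom0 X (sh m (N (l - 1) (Xs i)))" using hom0_N_left[OF X_O o, of m "1 - l"] m i by simp
    moreover have "iso T (N (l - 1) (Xs i)) (N (-1) ?Y)" using N_add[OF o, of "-1" l] by simp
    ultimately have "hom0 X (sh m (N (-1) ?Y))" using hom0_iso_sh[OF iso_refl[OF X_O]] by blast
    hence "hom0 (N 1 X) (sh m ?Y)" using hom0_N_left[OF X_O Yo, of m 1] m i by simp
    hence "hom0 (Xs n) (sh m ?Y)" using hom0_iso_left[OF Xn_iso] by blast
    thus ?thesis using hom0_push_left[OF Yo _ _ j(2) Y, of i "n - i"] 3 i by (simp add: m_def)
  next
    case 4
    \<comment> \<open>One more push would lose the last shift, so it stops at X_{n-1} -> Y[1]. Such
      a map comes from X_n -> Y, which lifts through the translated a_i to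
      \<open>N l (Cs i)\<close>; this lies in \<open>D0\<close>, so b_n splits off, and the
      connecting map kills b_n.\<close>
    obtain p where p: "n = Suc p" "p < n" using i by (cases n) auto
    have "hom0 (Xs p) (sh 1 ?Y)"
      unfolding hom0_def
    proof (intro allI impI)
      fix f assume f: "arr (Xs p) (sh 1 ?Y) f"
      note x = ex3D[OF ex_ad[OF p(2)]]
      have "hom0 (Cs p) (sh 1 ?Y)" using orth_right[OF Y Cs_D0[OF p(2)]] i j 4 by simp
      hence "a p \<cdot> f = 0" using x(1) f by (auto simp: hom0_def)
      then obtain g where g: "arr (\<Sigma> (Xs n)) (\<Sigma> ?Y) g" "f = d p \<cdot> g" using x(5)[OF f] p by (auto simp: sh_Suc)
      obtain g' where g': "arr (Xs n) ?Y g'" "\<Sigma>m g' = g"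
        using eqv_full[OF eqvS X_Obj[of n] Yo g(1)] by auto
      obtain \<Phi> where G: "eqv (N l) \<Phi>" using eqv_N by blast
      have A: "N (- l) (Xs n) \<in> C" using ct_N[OF C Xn_C] .
      obtain u where u: "arr (Xs n) (N l (Cs i)) u" "g' = u \<cdot> \<Phi> (Cs i) (Xs i) (a i)"
        using eqv_factor[OF G a_arr[OF i(2)] C_Obj[OF A] N_inv[OF X_Obj[of n]] _ g'(1)] a_factor[OF i(2) A] i by auto
      obtain v where v: "arr (Cs p) (N l (Cs i)) v" "u = b n \<cdot> v"
        using b_factor0[OF p(2) D0_N[OF Cs_D0[OF i(2)]]] u p by auto
      have \<Phi>a: "arr (N l (Cs i)) ?Y (\<Phi> (Cs i) (Xs i) (a i))" using eqv_arr[OF G a_arr[OF i(2)]] .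
      have bn: "arr (Xs n) (Cs p) (b n)" using b_arr[OF p(2)] p by simp
      define w where "w = v \<cdot> \<Phi> (Cs i) (Xs i) (a i)"
      have w: "arr (Cs p) ?Y w" using v \<Phi>a by (auto simp: w_def)
      have "g' = b n \<cdot> w" using u v assoc[OF bn v(1) \<Phi>a] by (simp add: w_def)
      hence g_eq: "g = \<Sigma>m (b n) \<cdot> \<Sigma>m w" using eqv_cmp[OF eqvS bn w] g' by simp
      have y: "arr (Xs p) (\<Sigma> (Xs n)) (d p)" "arr (\<Sigma> (Xs n)) (\<Sigma> (Cs p)) (\<Sigma>m (b n))" "d p \<cdot> \<Sigma>m (b n) = 0"
        using ex3D(1-3)[OF ex_db[OF p(2)]] p by auto
      show "f = 0" using g(2) g_eq assoc[OF y(1,2) eqv_arr[OF eqvS w]] y(3) eqv_arr[OF eqvS w] by simp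
    qed
    moreover have "i + (j - 1) = p" "j - (j - 1) = 1" using 4 j p by auto
    ultimately show ?thesis using hom0_push_left[OF Yo, of i "j - 1" j] Y j p by simp
  qed
qed

lemma chain_tail:
  "i + t \<le> n \<Longrightarrow> \<exists>\<rho>. arr (sh i (Xs i)) (sh (i + t) (Xs (i + t))) \<rho> \<and> chain (i + t) = chain i \<cdot> \<rho>"
proof (induct t)
  case 0
  thus ?case using chain_arr[of i] id_right[OF chain_arr[of i]] sh_Obj[OF X_Obj[of i]] by (auto intro!: exI[of _ "idm (sh i (Xs i))"])
next
  case (Suc t)
  then obtain \<rho> where \<rho>: "arr (sh i (Xs i)) (sh (i + t) (Xs (i + t))) \<rho>" "chain (i + t) = chain i \<cdot> \<rho>" by auto
  have "arr (sh (i + t) (Xs (i + t))) (sh (i + Suc t) (Xs (i + Suc t))) (shm (i + t) (d (i + t)))"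
    using d_sh[of "i + t"] Suc(2) by simp
  thus ?case using \<rho> assoc[OF chain_arr[of i] \<rho>(1)] Suc(2)
    by (auto intro!: exI[of _ "\<rho> \<cdot> shm (i + t) (d (i + t))"])
qed

lemma not_hom0_X_X:
  assumes "i < m" "m \<le> n" shows "\<not> hom0 (Xs i) (sh (m - i) (Xs m))"
proof -
  obtain \<rho> where \<rho>: "arr (sh i (Xs i)) (sh m (Xs m)) \<rho>" "chain m = chain i \<cdot> \<rho>"
    using chain_tail[of i "m - i"] assms by auto
  have "\<rho> \<noteq> 0" using \<rho>(2) chain_nonzero[OF assms(2)] chain_arr[of i] assms by auto
  hence "\<not> hom0 (sh i (Xs i)) (sh m (Xs m))" using \<rho>(1) by (auto simp: hom0_def)
  thus ?thesis using sh_hom0_le[of "Xs i" "Xs m" i m] X_Obj assms by simp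
qed

text \<open>For i < m the tail of the chain is nonzero, with k = 0. For m < i duality reverses the
  tail from X_m to X_i, which produces the translate k = -1 and the degree n - (i - m).\<close>

lemma incompatible:
  assumes "i < n" "m < n" "i \<noteq> m"
  shows "\<exists>j k. 0 < j \<and> j < n \<and> \<not> hom0 (N k (Xs i)) (sh j (Xs m))"
proof (cases "i < m")
  case True
  thus ?thesis using not_hom0_X_X[of i m] assms by (intro exI[of _ "m - i"] exI[of _ 0]) auto
next
  case False
  hence mi: "m < i" using assms by simp
  have o: "Xs i \<in> Obj T" "Xs m \<in> Obj T" using X_Obj assms by auto
  have "\<not> hom0 (Xs m) (sh (i - m) (Xs i))" using not_hom0_X_X[OF mi] assms by simp
  hence "\<not> hom0 (Xs i) (sh (n - (i - m)) (N 1 (Xs m)))" using hom0_serre_sh[OF o(2,1), of "i - m"] assms by simp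
  hence "\<not> hom0 (N (-1) (Xs i)) (sh (n - (i - m)) (Xs m))"
    using hom0_N_left[OF o, of "n - (i - m)" "-1"] by simp
  thus ?thesis using mi assms by (intro exI[of _ "n - (i - m)"] exI[of _ "-1"]) auto
qed

text \<open>The nonzero map X -> X_i[i] has a nonzero counterpart from \<open>N k X\<close>, hence
  from X, to the i-th shift of \<open>N k (Xs i)\<close>; \<open>orth_iso_X\<close> then identifies
  that object. So the class of a translate of X determines that of the same translate of
  X_i.\<close>

lemma X_periodic:
  assumes i: "i < n" and k: "iso T X (N k X)" shows "iso T (Xs i) (N k (Xs i))"
proof (cases "i = 0")
  case False
  have o: "Xs i \<in> Obj T" using X_Obj i by simp
  have "\<not> hom0 X (sh i (Xs i))" using not_hom0_X_X[of 0 i] i False by simp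
  hence "\<not> hom0 (N k X) (sh i (N k (Xs i)))" using hom0_N[OF X_O o, of i k] i by simp
  hence "\<not> hom0 X (sh i (N k (Xs i)))" using hom0_iso_left[OF k] by blast
  then obtain h where "arr X (sh i (N k (Xs i))) h" "h \<noteq> 0" by (auto simp: hom0_def)
  hence "iso T (N k (Xs i)) (Xs i)"
    using orth_iso_X[OF local_NX orth_N[OF orth_X]] i False by simp
  thus ?thesis by (rule iso_sym)
qed (use k in simp)

end

subsection \<open>Maps not factoring through the remaining summands\<close>

context ar_noloops
begin

definition via :: "'o \<Rightarrow> 'o \<Rightarrow> 'm \<Rightarrow> bool" where
  "via Z W h \<longleftrightarrow> (\<exists>A u v. A \<in> D0 \<and> arr Z A u \<and> arr A W v \<and> h = u \<cdot> v)"

lemma via_right: assumes "via Z W h" "arr W V g" shows "via Z V (h \<cdot> g)"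
proof -
  obtain A u v where *: "A \<in> D0" "arr Z A u" "arr A W v" "h = u \<cdot> v" using assms by (auto simp: via_def)
  thus ?thesis unfolding via_def using assoc[OF *(2,3) assms(2)] assms(2) by blast
qed

lemma via_add: assumes "via Z W f" "via Z W g" shows "via Z W (f + g)"
proof -
  obtain A u v where A: "A \<in> D0" "arr Z A u" "arr A W v" "f = u \<cdot> v" using assms by (auto simp: via_def)
  obtain B s t where B: "B \<in> D0" "arr Z B s" "arr B W t" "g = s \<cdot> t" using assms by (auto simp: via_def)
  have W: "W \<in> Obj T" using A(3) by (rule arrD(2))
  have "\<exists>E p. E \<in> D0 \<and> arr E W p \<and>
      (\<forall>A' f. (A', f) \<in> {(A, v), (B, t)} \<longrightarrow> (\<exists>u. arr A' E u \<and> f = u \<cdot> p))"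
    by (rule dominate_finite[OF subD W]) (use A B in auto)
  then obtain E p where E: "E \<in> D0" "arr E W p"
    and fac: "\<forall>A' f. (A', f) \<in> {(A, v), (B, t)} \<longrightarrow> (\<exists>u. arr A' E u \<and> f = u \<cdot> p)"
    by (elim exE conjE) (rule that)
  obtain v' where v: "arr A E v'" "v = v' \<cdot> p" using fac[rule_format, of A v] by auto
  obtain t' where t: "arr B E t'" "t = t' \<cdot> p" using fac[rule_format, of B t] by auto
  have uv: "arr Z E (u \<cdot> v')" and st: "arr Z E (s \<cdot> t')" using A B v t by auto
  have "f + g = (u \<cdot> v' + s \<cdot> t') \<cdot> p"
    using add_cmp[OF uv st E(2)] assoc[OF A(2) v(1) E(2)] assoc[OF B(2) t(1) E(2)] A B v t by simp
  thus ?thesis unfolding via_def using E arr_add[OF uv st] by blast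
qed

lemma via_zero: "Z \<in> Obj T \<Longrightarrow> W \<in> Obj T \<Longrightarrow> via Z W 0"
proof -
  assume o: "Z \<in> Obj T" "W \<in> Obj T"
  obtain A where A: "A \<in> D0" using sub_zero[OF subD] by blast
  thus ?thesis unfolding via_def using o arr_zero[OF o(1) D_Obj[OF A]] arr_zero[OF D_Obj[OF A] o(2)] zero_cmp' by metis
qed

text \<open>The members of the orbit of X_i whose maps to W are not all caught by a right
  \<open>D0\<close>-approximation of W, and which an approximation by the exchanged subcategory must
  add.\<close>

definition nonvia :: "nat \<Rightarrow> 'o \<Rightarrow> 'o set set" where
  "nonvia i W = {isoclass T (N l (Xs i)) | l. \<exists>h. arr (N l (Xs i)) W h \<and> \<not> via (N l (Xs i)) W h}"

lemma nonvia_iso: assumes "iso T V W" shows "nonvia i V \<subseteq> nonvia i W"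
proof -
  obtain s t where st: "arr V W s" "arr W V t" "s \<cdot> t = idm V" using isoE[OF assms] by metis
  have "\<exists>h. arr Z W h \<and> \<not> via Z W h" if h: "arr Z V h" "\<not> via Z V h" for Z h
  proof (intro exI conjI notI)
    show "arr Z W (h \<cdot> s)" using h st by auto
    assume "via Z W (h \<cdot> s)"
    hence "via Z V ((h \<cdot> s) \<cdot> t)" using via_right st by blast
    moreover have "(h \<cdot> s) \<cdot> t = h" using assoc[OF h(1) st(1,2)] st id_right[OF h(1)] by simp
    ultimately show False using h by simp
  qed
  thus ?thesis unfolding nonvia_def by blast
qed

text \<open>For m = 0 every map factors through the translate of b_i, whose target lies in
  \<open>D0\<close>. For m > 0 even a nonzero map forces \<open>N (l + 1) X\<close> to be a summand
  of U, which leaves finitely many classes.\<close>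

lemma finite_nonvia_layer:
  assumes i: "0 < i" "i < n" and U: "U \<in> C" and m: "m < n"
  shows "finite (nonvia i (sh m U))"
proof (cases "m = 0")
  case True
  obtain p where p: "i = Suc p" "p < n" using i by (cases i) auto
  have "via (N l (Xs i)) U h" if h: "arr (N l (Xs i)) U h" for l h
  proof -
    obtain \<Phi> where G: "eqv (N l) \<Phi>" using eqv_N by blast
    have U': "N (- l) U \<in> C" using ct_N[OF C U] .
    have bi: "arr (Xs i) (Cs p) (b i)" using b_arr[OF p(2)] p by simp
    have fac: "\<exists>g. arr (Cs p) (N (- l) U) g \<and> k = b i \<cdot> g" if "arr (Xs i) (N (- l) U) k" for k
      using b_factor[OF p(2) U', of k] that p i by simp
    obtain g where "arr (N l (Cs p)) U g" "h = \<Phi> (Xs i) (Cs p) (b i) \<cdot> g"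
      using eqv_factor_left[OF G bi C_Obj[OF U'] N_inv[OF C_Obj[OF U]] fac h] by blast
    thus ?thesis unfolding via_def using D0_N[OF Cs_D0[OF p(2)]] eqv_arr[OF G bi] by blast
  qed
  hence "nonvia i (sh m U) = {}" using True by (auto simp: nonvia_def)
  thus ?thesis by simp
next
  case False
  have o: "Xs i \<in> Obj T" "U \<in> Obj T" using X_Obj[of i] i C_Obj[OF U] by auto
  let ?S = "{isoclass T A | A. local_end T A \<and> retract A U}"
  \<comment> \<open>The exponent recovered from the class of \<open>N (l + 1) X\<close> may differ
    from the original l; by \<open>X_periodic\<close> both give isomorphic translates of
    X_i.\<close>
  let ?\<phi> = "\<lambda>c. isoclass T (N (SOME l. c = isoclass T (N (l + 1) X)) (Xs i))"
  have "nonvia i (sh m U) \<subseteq> ?\<phi> ` ?S"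
  proof
    fix c assume "c \<in> nonvia i (sh m U)"
    then obtain l h where c: "c = isoclass T (N l (Xs i))" and h: "arr (N l (Xs i)) (sh m U) h"
      "\<not> via (N l (Xs i)) (sh m U) h" by (auto simp: nonvia_def)
    have "h \<noteq> 0" using h via_zero N_Obj[OF o(1)] sh_Obj[OF o(2)] by blast
    hence "\<not> hom0 (N l (Xs i)) (sh m U)" using h by (auto simp: hom0_def)
    hence "\<not> hom0 (Xs i) (sh m (N (- l) U))" using hom0_N_left[OF o, of m l] m by simp
    hence "retract (N 1 X) (N (- l) U)"
      using hom0_X_C[of i m, OF _ _ _ ct_N[OF C U]] i m False by auto
    hence "retract (N l (N 1 X)) U" using N_retract_swap[OF N_Obj[OF X_O] o(2)] by blast
    hence r: "retract (N (l + 1) X) U" using retract_iso_left[OF N_add[OF X_O, of l 1]] by simp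
    let ?c = "isoclass T (N (l + 1) X)"
    have S: "?c \<in> ?S" using r local_NX[of 0 "l + 1"] by auto
    define k where "k = (SOME l. ?c = isoclass T (N (l + 1) X))"
    have "?c = isoclass T (N (k + 1) X)" unfolding k_def by (rule someI[of _ l]) simp
    hence "iso T (N (l + 1) X) (N (k + 1) X)" using isoclass_eq[OF N_Obj[OF X_O]] by simp
    hence "iso T X (N (- (l + 1)) (N (k + 1) X))" using N_iso_swap[OF X_O N_Obj[OF X_O], of "l + 1"] by simp
    also have "iso T (N (- (l + 1)) (N (k + 1) X)) (N (k - l) X)"
      using N_add[OF X_O, of "- (l + 1)" "k + 1"] iso_sym by simp
    finally have "iso T (Xs i) (N (k - l) (Xs i))" using X_periodic[OF i(2)] by blast
    hence "iso T (N l (Xs i)) (N l (N (k - l) (Xs i)))" by (rule N_iso)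
    also have "iso T (N l (N (k - l) (Xs i))) (N k (Xs i))" using N_add[OF o(1), of l "k - l"] iso_sym by simp
    finally have "c = ?\<phi> ?c" using isoclass_eq[OF N_Obj[OF o(1)]] c unfolding k_def by simp
    thus "c \<in> ?\<phi> ` ?S" using S by blast
  qed
  thus ?thesis using finite_local_retracts[OF o(2)] finite_subset by blast
qed

text \<open>If the composite of h : Z -> V with \<open>v\<close> factors through A in
  \<open>D0\<close>, the map A -> V' lifts to V because (A, U[m+1]) = 0. Subtracting this lift from
  h leaves a map that comes from U[m].\<close>

lemma nonvia_extension:
  assumes e1: "ex3 (sh m U) V V' u v" and e2: "ex3 V V' (sh (Suc m) U) v w" and U: "U \<in> C" and m: "Suc m < n"
  shows "nonvia i V \<subseteq> nonvia i (sh m U) \<union> nonvia i V'"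
proof
  fix c assume "c \<in> nonvia i V"
  then obtain l h where c: "c = isoclass T (N l (Xs i))" and h: "arr (N l (Xs i)) V h" "\<not> via (N l (Xs i)) V h"
    by (auto simp: nonvia_def)
  let ?Z = "N l (Xs i)"
  note x = ex3D[OF e1] and y = ex3D[OF e2]
  show "c \<in> nonvia i (sh m U) \<union> nonvia i V'"
  proof (rule ccontr)
    assume nc: "c \<notin> nonvia i (sh m U) \<union> nonvia i V'"
    hence 1: "via ?Z (sh m U) k" if "arr ?Z (sh m U) k" for k using that c by (auto simp: nonvia_def)
    have 2: "via ?Z V' k" if "arr ?Z V' k" for k using that c nc by (auto simp: nonvia_def)
    obtain A s t where A: "A \<in> D0" and st: "arr ?Z A s" "arr A V' t" "h \<cdot> v = s \<cdot> t"
      using 2[OF arr_cmp[OF h(1) x(2)]] by (auto simp: via_def)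
    have "hom0 A (sh (Suc m) U)" using ct_rigid[OF C D0_C[OF A] U] m by simp
    hence "t \<cdot> w = 0" using st y(2) by (auto simp: hom0_def)
    then obtain t' where t': "arr A V t'" "t = t' \<cdot> v" using y(4) st by blast
    have st': "arr ?Z V (s \<cdot> t')" using st t' by auto
    have "(h - s \<cdot> t') \<cdot> v = 0" using diff_cmp[OF h(1) st' x(2)] assoc[OF st(1) t'(1) x(2)] st t' by simp
    then obtain g where g: "arr ?Z (sh m U) g" "h - s \<cdot> t' = g \<cdot> u" using x(4) arr_diff[OF h(1) st'] by blast
    have "via ?Z V (g \<cdot> u)" using via_right[OF 1[OF g(1)] x(1)] .
    moreover have "via ?Z V (s \<cdot> t')" using A st t' by (auto simp: via_def)
    ultimately have "via ?Z V (g \<cdot> u + s \<cdot> t')" by (rule via_add)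
    moreover have "g \<cdot> u + s \<cdot> t' = h" using g(2)[symmetric] by simp
    ultimately show False using h by simp
  qed
qed

lemma finite_nonvia:
  assumes i: "0 < i" "i < n" and W: "W \<in> Obj T"
  shows "finite (nonvia i W)"
proof -
  \<comment> \<open>Induction on the number t of layers still to be split off; the hypothesis on V
    says that the first n - 1 - t are gone. At t = 0 a single layer C[n-1] remains.\<close>
  have "\<forall>V\<in>Obj T. (\<forall>p A. p < n - 1 - t \<longrightarrow> A \<in> C \<longrightarrow> hom0 (sh p A) V) \<longrightarrow> finite (nonvia i V)" if "t \<le> n - 1" for t
    using that
  proof (induct t)
    case 0
    show ?case
    proof (intro ballI impI)
      fix V assume V: "V \<in> Obj T" and z: "\<forall>p A. p < n - 1 - 0 \<longrightarrow> A \<in> C \<longrightarrow> hom0 (sh p A) V"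
      obtain A where A: "A \<in> C" "iso T (sh (n - 1) A) V"
        using filtration_end[OF subC V ct_mem[OF C]] z by auto
      have "finite (nonvia i (sh (n - 1) A))" using finite_nonvia_layer[OF i A(1)] n1 by simp
      thus "finite (nonvia i V)" using nonvia_iso[OF iso_sym[OF A(2)]] finite_subset by blast
    qed
  next
    case (Suc t)
    define m where "m = n - 1 - Suc t"
    have m: "n - 1 - t = Suc m" "Suc m < n" using Suc(2) by (auto simp: m_def)
    show ?case
    proof (intro ballI impI)
      fix V assume V: "V \<in> Obj T" and z: "\<forall>p A. p < n - 1 - Suc t \<longrightarrow> A \<in> C \<longrightarrow> hom0 (sh p A) V"
      have z': "hom0 (sh p A) V" if "p < m" "A \<in> C" for p A using z that by (simp add: m_def)
      obtain U V' u v w where U: "U \<in> C" and e: "ex3 (sh m U) V V' u v" "ex3 V V' (sh (Suc m) U) v w"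
        and z2: "\<forall>p A. p < Suc m \<longrightarrow> A \<in> C \<longrightarrow> hom0 (sh p A) V'"
        by (rule filtration_step[OF subC ct_rigid[OF C] ct_right[OF C] V z' m(2)])
      have "V' \<in> Obj T" using ex3D(2)[OF e(1)] by (rule arrD(2))
      hence "finite (nonvia i V')" using Suc m z2 by auto
      moreover have "finite (nonvia i (sh m U))" using finite_nonvia_layer[OF i U] m by simp
      ultimately show "finite (nonvia i V)" using nonvia_extension[OF e U m(2)] finite_subset by blast
    qed
  qed
  from this[of "n - 1"] show ?thesis using W by simp
qed

text \<open>Inside \<open>D0\<close> the identity serves; for \<open>N l X\<close> it is the
  translate of the sink map a_0, whose source lies in \<open>D0\<close> because there are no
  loops.\<close>

lemma D0_approx_local:
  assumes A: "local_end T A" "A \<in> C"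
  shows "\<exists>B q. B \<in> D0 \<and> arr B A q \<and> (\<forall>Y h. Y \<in> D0 \<longrightarrow> arr Y A h \<longrightarrow> (\<exists>g. arr Y B g \<and> h = g \<cdot> q))"
proof (cases "A \<in> D0")
  case True
  have "arr A A (idm A)" using local_Obj[OF A(1)] by simp
  thus ?thesis using True id_right by metis
next
  case False
  then obtain l where l: "iso T A (N l X)" using local_C_cases[OF A] by blast
  obtain s t where st: "arr A (N l X) s" "arr (N l X) A t" "s \<cdot> t = idm A" using isoE[OF l] by metis
  obtain \<Phi> where G: "eqv (N l) \<Phi>" using eqv_N by blast
  have n0: "0 < n" using n1 by simp
  have a0: "arr (Cs 0) X (a 0)" using a_arr[OF n0] by simp
  have \<Phi>a: "arr (N l (Cs 0)) (N l X) (\<Phi> (Cs 0) X (a 0))" using eqv_arr[OF G a0] .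
  have "\<exists>g. arr Y (N l (Cs 0)) g \<and> h = g \<cdot> (\<Phi> (Cs 0) X (a 0) \<cdot> t)" if Y: "Y \<in> D0" and h: "arr Y A h" for Y h
  proof -
    have Y': "N (- l) Y \<in> D0" using D0_N[OF Y] .
    have fac: "\<exists>g. arr (N (- l) Y) (Cs 0) g \<and> k = g \<cdot> a 0" if "arr (N (- l) Y) X k" for k
      using a_factor0[OF n0 Y'] that by simp
    obtain g where g: "arr Y (N l (Cs 0)) g" "h \<cdot> s = g \<cdot> \<Phi> (Cs 0) X (a 0)"
      using eqv_factor[OF G a0 D_Obj[OF Y'] N_inv[OF D_Obj[OF Y]] fac arr_cmp[OF h st(1)]] by blast
    have "h = (h \<cdot> s) \<cdot> t" using assoc[OF h st(1,2)] st id_right[OF h] by simp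
    also have "\<dots> = g \<cdot> (\<Phi> (Cs 0) X (a 0) \<cdot> t)" using g assoc[OF g(1) \<Phi>a st(2)] by simp
    finally show ?thesis using g by blast
  qed
  thus ?thesis using D0_N[OF Cs_D0[OF n0]] arr_cmp[OF \<Phi>a st(2)] by blast
qed

text \<open>A right C-approximation of W is composed with \<open>D0\<close>-approximations of the
  indecomposable summands of its source.\<close>

lemma D0_approx:
  assumes W: "W \<in> Obj T" shows "\<exists>A p. right_approximation T D0 A W p"
proof -
  obtain A p where "right_approximation T C A W p" using ct_right[OF C W] by blast
  hence A: "A \<in> C" and p: "arr A W p" and fac: "\<And>Z h. Z \<in> C \<Longrightarrow> arr Z W h \<Longrightarrow> \<exists>g. arr Z A g \<and> h = g \<cdot> p"
    using right_approximation_iff[OF subC W] by blast+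
  obtain As \<iota> \<pi> where ds: "direct_sum_via T As A \<iota> \<pi>" and lo: "\<And>B. B \<in> set As \<Longrightarrow> local_end T B"
    using ks_via[OF C_Obj[OF A]] by blast
  note e = dsvE[OF ds]
  have "\<exists>B q. B \<in> D0 \<and> arr B (As ! k) q \<and> (\<forall>Y h. Y \<in> D0 \<longrightarrow> arr Y (As ! k) h \<longrightarrow> (\<exists>g. arr Y B g \<and> h = g \<cdot> q))"
    if k: "k < length As" for k
  proof (rule D0_approx_local)
    show "local_end T (As ! k)" using lo k by simp
    show "As ! k \<in> C" using sub_retract[OF subC A] ds_retract[of As A "As ! k"] ds k by (auto simp: direct_sum_def)
  qed
  then obtain B q where B: "\<And>k. k < length As \<Longrightarrow> B k \<in> D0 \<and> arr (B k) (As ! k) (q k) \<and>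
     (\<forall>Y h. Y \<in> D0 \<longrightarrow> arr Y (As ! k) h \<longrightarrow> (\<exists>g. arr Y (B k) g \<and> h = g \<cdot> q k))" by metis
  let ?P = "(\<lambda>k. (B k, q k \<cdot> (\<iota> k \<cdot> p))) ` {..<length As}"
  have "\<exists>E r. E \<in> D0 \<and> arr E W r \<and> (\<forall>A' f. (A', f) \<in> ?P \<longrightarrow> (\<exists>u. arr A' E u \<and> f = u \<cdot> r))"
  proof (rule dominate_finite[OF subD W])
    fix A' f assume "(A', f) \<in> ?P"
    then obtain k where k: "k < length As" "A' = B k" "f = q k \<cdot> (\<iota> k \<cdot> p)" by auto
    have "arr (B k) W (q k \<cdot> (\<iota> k \<cdot> p))"
      by (rule arr_cmp[OF conjunct1[OF conjunct2[OF B[OF k(1)]]] arr_cmp[OF e(2)[OF k(1)] p]])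
    thus "A' \<in> D0 \<and> arr A' W f" using k B by simp
  qed simp
  then obtain E r where E: "E \<in> D0" "arr E W r"
    and domP: "\<forall>A' f. (A', f) \<in> ?P \<longrightarrow> (\<exists>u. arr A' E u \<and> f = u \<cdot> r)" by (elim exE conjE) (rule that)
  have dom: "\<exists>u. arr (B k) E u \<and> q k \<cdot> (\<iota> k \<cdot> p) = u \<cdot> r" if "k < length As" for k
    using domP[rule_format, of "B k" "q k \<cdot> (\<iota> k \<cdot> p)"] that by simp
  have "right_approximation T D0 E W r"
  proof (rule right_approximation_local[OF subD E])
    fix Z h assume Z: "Z \<in> D0" and h: "arr Z W h"
    obtain g where g: "arr Z A g" "h = g \<cdot> p" using fac[OF D0_C[OF Z] h] by blast
    have summand: "\<exists>u. arr Z E u \<and> (g \<cdot> \<pi> k) \<cdot> (\<iota> k \<cdot> p) = u \<cdot> r" if k: "k < length As" for k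
    proof -
      have gk: "arr Z (As ! k) (g \<cdot> \<pi> k)" using g e(3)[OF k] by auto
      have Bk: "arr (B k) (As ! k) (q k)" using B[OF k] by blast
      obtain s where s: "arr Z (B k) s" "g \<cdot> \<pi> k = s \<cdot> q k" using B[OF k] Z gk by blast
      obtain u where u: "arr (B k) E u" "q k \<cdot> (\<iota> k \<cdot> p) = u \<cdot> r" using dom[OF k] by blast
      have "(g \<cdot> \<pi> k) \<cdot> (\<iota> k \<cdot> p) = s \<cdot> (u \<cdot> r)" using s u assoc[OF s(1) Bk arr_cmp[OF e(2)[OF k] p]] by simp
      also have "\<dots> = (s \<cdot> u) \<cdot> r" using assoc[OF s(1) u(1) E(2)] by simp
      finally show ?thesis using s u by blast
    qed
    then obtain u where u: "\<And>k. k < length As \<Longrightarrow> arr Z E (u k) \<and> (g \<cdot> \<pi> k) \<cdot> (\<iota> k \<cdot> p) = u k \<cdot> r" by metis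
    have o: "Z \<in> Obj T" "E \<in> Obj T" using D_Obj Z E by auto
    have "h = g \<cdot> (\<Sum>k<length As. \<pi> k \<cdot> (\<iota> k \<cdot> p))" using g ds_expand_left[OF ds p] by simp
    also have "\<dots> = (\<Sum>k<length As. g \<cdot> (\<pi> k \<cdot> (\<iota> k \<cdot> p)))"
    proof (rule cmp_sum[OF _ g(1) W])
      fix k assume "k \<in> {..<length As}"
      hence k: "k < length As" by simp
      show "arr A W (\<pi> k \<cdot> (\<iota> k \<cdot> p))" by (rule arr_cmp[OF e(3)[OF k] arr_cmp[OF e(2)[OF k] p]])
    qed
    also have "\<dots> = (\<Sum>k<length As. u k \<cdot> r)"
    proof (intro sum.cong refl)
      fix k assume "k \<in> {..<length As}"
      hence k: "k < length As" by simp
      show "g \<cdot> (\<pi> k \<cdot> (\<iota> k \<cdot> p)) = u k \<cdot> r"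
        using u[OF k] assoc[OF g(1) e(3)[OF k] arr_cmp[OF e(2)[OF k] p]] by simp
    qed
    also have "\<dots> = (\<Sum>k<length As. u k) \<cdot> r" using u E o by (intro sum_cmp[symmetric, of _ Z E]) auto
    finally have "h = (\<Sum>k<length As. u k) \<cdot> r" .
    moreover have "arr Z E (\<Sum>k<length As. u k)" by (rule arr_sum) (use u o in auto)
    ultimately show "\<exists>g. arr Z E g \<and> h = g \<cdot> r" by blast
  qed
  thus ?thesis by blast
qed

subsection \<open>The exchanged subcategories\<close>

definition exch_ind :: "nat \<Rightarrow> 'o set set" where "exch_ind i = F0 \<union> serre_orbit T S n (Xs i)"
text \<open>An explicit model of the i-th mutation, studied before the definite description in
  \<open>mutation\<close>; \<open>mutation_eq\<close> identifies the two.\<close>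

definition exch :: "nat \<Rightarrow> 'o set" where "exch i = addcl (exch_ind i)"

lemmas subX = subcategory_addcl[of "exch_ind _", folded exch_def]

lemma exch_local:
  assumes i: "i \<le> n" and l: "local_end T A"
  shows "A \<in> exch i \<longleftrightarrow> A \<in> D0 \<or> (\<exists>k. iso T A (N k (Xs i)))"
  using addcl_local[OF l] orbit_iff[OF local_Obj[OF l]] by (auto simp: exch_def D0_def exch_ind_def)

lemma D0_E: "D0 \<subseteq> exch i"
  by (auto simp: D0_def exch_def exch_ind_def addcl_def)

lemma NX_exch: "i \<le> n \<Longrightarrow> N k (Xs i) \<in> exch i"
  using exch_local[OF _ local_NX] iso_refl[OF N_Obj[OF X_Obj]] by blast

lemma exch_ind_local: assumes "i \<le> n" "c \<in> exch_ind i" shows "\<exists>A. local_end T A \<and> c = isoclass T A"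
proof (cases "c \<in> F0")
  case True thus ?thesis using ind_local unfolding F0_def by blast
next
  case False
  then obtain l where "c = isoclass T (N l (Xs i))" using assms by (auto simp: exch_ind_def serre_orbit_def N_def)
  thus ?thesis using local_NX assms by blast
qed

lemma ind_exch: "i \<le> n \<Longrightarrow> ind T (exch i) = exch_ind i"
  unfolding exch_def using exch_ind_local ind_addcl by blast

lemma exch_N: assumes i: "i \<le> n" and Y: "Y \<in> exch i" shows "N l Y \<in> exch i"
proof (rule sub_local[OF subX])
  have Yo: "Y \<in> Obj T" using sub_Obj[OF subX Y] .
  show "N l Y \<in> Obj T" using N_Obj[OF Yo] .
  fix A assume A: "local_end T A" "retract A (N l Y)"
  have Ao: "A \<in> Obj T" using local_Obj[OF A(1)] .
  have "retract (N (- l) A) Y" using A(2) N_retract_swap[OF Ao Yo, of "- l"] by simp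
  hence "N (- l) A \<in> exch i" using sub_retract[OF subX Y] by blast
  moreover have lA: "local_end T (N (- l) A)" using N_local[OF Ao] A by blast
  ultimately consider "N (- l) A \<in> D0" | k where "iso T (N (- l) A) (N k (Xs i))"
    using exch_local[OF i] by blast
  thus "A \<in> exch i"
  proof cases
    case 1
    hence "N l (N (- l) A) \<in> D0" by (rule D0_N)
    thus ?thesis using sub_iso[OF subD _ N_inv[OF Ao]] D0_E by blast
  next
    case 2
    have "iso T A (N l (N k (Xs i)))" using 2 N_iso_swap[OF Ao N_Obj[OF X_Obj[OF i]], of "- l"] by simp
    also have "iso T (N l (N k (Xs i))) (N (l + k) (Xs i))" using N_add[OF X_Obj[OF i]] iso_sym by blast
    finally show ?thesis using exch_local[OF i A(1)] by blast
  qed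
qed

lemma exch_rigid:
  assumes i: "0 < i" "i < n" and AB: "A \<in> exch i" "B \<in> exch i" and j: "0 < j" "j < n"
  shows "hom0 A (sh j B)"
proof -
  have i': "i \<le> n" and o: "Xs i \<in> Obj T" using i X_Obj by auto
  have loc: "hom0 A (sh j B)" if A: "local_end T A" "A \<in> exch i" and B: "local_end T B" "B \<in> exch i" for A B
  proof -
    have AO: "A \<in> Obj T" "B \<in> Obj T" using A B local_Obj by blast+
    have orthX: "orth (N k (Xs i))" for k using orth_N[OF orth_X[OF i']] .
    have "A \<in> D0 \<or> (\<exists>k. iso T A (N k (Xs i)))" "B \<in> D0 \<or> (\<exists>k. iso T B (N k (Xs i)))"
      using A B exch_local[OF i' A(1)] exch_local[OF i' B(1)] by simp_all
    then consider "A \<in> D0" "B \<in> D0" | k where "A \<in> D0" "iso T B (N k (Xs i))"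
      | k where "iso T A (N k (Xs i))" "B \<in> D0"
      | k l where "iso T A (N k (Xs i))" "iso T B (N l (Xs i))"
      by blast
    thus ?thesis
    proof cases
      case 1 thus ?thesis using ct_rigid[OF C] D0_C j by blast
    next
      case 2
      have "hom0 A (sh j (N k (Xs i)))" using orth_right[OF orthX 2(1) j] .
      thus ?thesis using hom0_iso_sh[OF iso_refl[OF AO(1)] 2(2)] by blast
    next
      case 3
      have "hom0 (N k (Xs i)) (sh j B)" using orth_left[OF orthX 3(2) j] .
      thus ?thesis using hom0_iso_left[OF 3(1)] by blast
    next
      case 4
      have "hom0 (Xs i) (sh j (N (- k + l) (Xs i)))" using rigid_X[OF i j] .
      hence "hom0 (Xs i) (sh j (N (- k) (N l (Xs i))))" using hom0_iso_sh[OF iso_refl[OF o] N_add[OF o]] by blast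
      hence "hom0 (N k (Xs i)) (sh j (N l (Xs i)))" using hom0_N_left[OF o N_Obj[OF o], of j k] j by simp
      thus ?thesis using hom0_iso_sh[OF 4] by blast
    qed
  qed
  have Ao: "A \<in> Obj T" "B \<in> Obj T" using AB sub_Obj[OF subX] by blast+
  show ?thesis
  proof (rule hom0_local_left[OF Ao(1)])
    fix A' assume A': "local_end T A'" "retract A' A"
    have A'E: "A' \<in> exch i" using sub_retract[OF subX AB(1) A'(2)] .
    have A'o: "A' \<in> Obj T" using local_Obj[OF A'(1)] .
    \<comment> \<open>\<open>hom0_local_left\<close> decomposes only the source of a map. Passing to
      the Serre dual puts B into that position.\<close>
    have "hom0 B (sh (n - j) (N 1 A'))"
    proof (rule hom0_local_left[OF Ao(2)])
      fix B' assume B': "local_end T B'" "retract B' B"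
      have "hom0 A' (sh j B')" using loc[OF A'(1) A'E B'(1)] sub_retract[OF subX AB(2) B'(2)] by blast
      thus "hom0 B' (sh (n - j) (N 1 A'))" using hom0_serre_sh[OF A'o local_Obj[OF B'(1)], of j] j by simp
    qed
    thus "hom0 A' (sh j B)" using hom0_serre_sh[OF A'o Ao(2), of j] j by simp
  qed
qed

lemma orth_of_exch:
  assumes "A \<in> Obj T" "\<And>j B. 0 < j \<Longrightarrow> j < n \<Longrightarrow> B \<in> exch i \<Longrightarrow> hom0 B (sh j A)" shows "orth A"
  unfolding orth_def using assms D0_E by blast

text \<open>An indecomposable summand is orthogonal to \<open>D0\<close>, hence classified; a
  summand from the orbit of X_m with m different from i is excluded by a translate of the nonzero
  map of \<open>incompatible\<close>.\<close>

lemma exch_maximal: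
  assumes i: "i < n" and Y: "Y \<in> Obj T" and z: "\<And>j B. 0 < j \<Longrightarrow> j < n \<Longrightarrow> B \<in> exch i \<Longrightarrow> hom0 B (sh j Y)"
  shows "Y \<in> exch i"
proof (rule sub_local[OF subX Y])
  fix A assume A: "local_end T A" "retract A Y"
  have Ao: "A \<in> Obj T" using local_Obj[OF A(1)] .
  have zA: "hom0 B (sh j A)" if "0 < j" "j < n" "B \<in> exch i" for j B
    using hom0_retract_right[OF z[OF that]] sh_retract[OF Ao Y] A(2) by blast
  from orth_classify[OF A(1) orth_of_exch[OF Ao zA]] consider "A \<in> D0" | m l where "m < n" "iso T A (N l (Xs m))"
    by blast
  thus "A \<in> exch i"
  proof cases
    case 1 thus ?thesis using D0_E by blast
  next
    case 2
    show ?thesis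
    proof (cases "m = i")
      case True thus ?thesis using exch_local[of i, OF _ A(1)] 2 i by auto
    next
      case False
      then obtain j k where j: "0 < j" "j < n" and nz: "\<not> hom0 (N k (Xs i)) (sh j (Xs m))"
        using incompatible[OF i 2(1)] by blast
      have o: "Xs i \<in> Obj T" "Xs m \<in> Obj T" using X_Obj i 2 by auto
      have "\<not> hom0 (N l (N k (Xs i))) (sh j (N l (Xs m)))" using hom0_N[OF N_Obj[OF o(1)] o(2)] nz j by simp
      hence "\<not> hom0 (N l (N k (Xs i))) (sh j A)"
        using hom0_iso_sh[OF iso_refl[OF N_Obj[OF N_Obj[OF o(1)]]] 2(2)] by blast
      moreover have "N l (N k (Xs i)) \<in> exch i" using exch_N[OF _ NX_exch] i by simp
      ultimately show ?thesis using zA[OF j] by blast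
    qed
  qed
qed

text \<open>A \<open>D0\<close>-approximation of W is enlarged by spanning sets of the Hom-spaces to
  W from one representative of each class in \<open>nonvia i W\<close>. Maps from other members of
  the orbit factor through \<open>D0\<close> and are caught already.\<close>

lemma exch_approx:
  assumes i: "0 < i" "i < n" and W: "W \<in> Obj T"
  shows "\<exists>A p. right_approximation T (exch i) A W p"
proof -
  obtain A0 p0 where "right_approximation T D0 A0 W p0" using D0_approx[OF W] by blast
  hence A0: "A0 \<in> D0" and p0: "arr A0 W p0" and fac0: "\<And>Z h. Z \<in> D0 \<Longrightarrow> arr Z W h \<Longrightarrow> \<exists>g. arr Z A0 g \<and> h = g \<cdot> p0"
    using right_approximation_iff[OF subD W] by blast+
  have i': "i \<le> n" using i by simp
  have "\<forall>c. \<exists>l. c \<in> nonvia i W \<longrightarrow> c = isoclass T (N l (Xs i))" unfolding nonvia_def by blast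
  then obtain L where L: "\<And>c. c \<in> nonvia i W \<Longrightarrow> c = isoclass T (N (L c) (Xs i))" by metis
  define R where "R c = N (L c) (Xs i)" for c
  have Ro: "R c \<in> Obj T" for c using N_Obj[OF X_Obj[OF i']] by (simp add: R_def)
  have "\<forall>c. \<exists>B. finite B \<and> Hom T (R c) W = module.span (smul T) B" using Hom_finite_dim[OF Ro W] by blast
  then obtain B where B: "\<And>c. finite (B c)" "\<And>c. Hom T (R c) W = module.span (smul T) (B c)" by metis
  have BH: "arr (R c) W f" if "f \<in> B c" for c f
  proof -
    interpret vector_space "smul T" by (rule ambient)
    have "f \<in> Hom T (R c) W" unfolding B(2) using span_base[OF that] .
    thus ?thesis using Ro W by (simp add: arr_def)
  qed
  let ?P = "{(A0, p0)} \<union> (\<Union>c\<in>nonvia i W. (\<lambda>f. (R c, f)) ` B c)"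
  have "\<exists>A p. A \<in> exch i \<and> arr A W p \<and> (\<forall>A' f. (A', f) \<in> ?P \<longrightarrow> (\<exists>u. arr A' A u \<and> f = u \<cdot> p))"
  proof (rule dominate_finite[OF subX W])
    show "finite ?P" using finite_nonvia[OF i W] B(1) by blast
    fix A f assume "(A, f) \<in> ?P"
    thus "A \<in> exch i \<and> arr A W f"
      using A0 p0 D0_E BH NX_exch[OF i'] by (auto simp: R_def)
  qed
  then obtain A p where A: "A \<in> exch i" and p: "arr A W p"
    and dom: "\<And>A' f. (A', f) \<in> ?P \<Longrightarrow> \<exists>u. arr A' A u \<and> f = u \<cdot> p" by blast
  obtain u0 where u0: "arr A0 A u0" "p0 = u0 \<cdot> p" using dom by blast
  have facD: "\<exists>g. arr Z A g \<and> h = g \<cdot> p" if Z: "Z \<in> D0" "arr Z W h" for Z h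
  proof -
    obtain g where g: "arr Z A0 g" "h = g \<cdot> p0" using fac0[OF Z] by blast
    hence "h = (g \<cdot> u0) \<cdot> p" using u0 assoc[OF g(1) u0(1) p] by simp
    thus ?thesis using g u0 by blast
  qed
  have facV: "\<exists>g. arr Z A g \<and> h = g \<cdot> p" if v: "via Z W h" for Z h
  proof -
    obtain Y s t where Y: "Y \<in> D0" "arr Z Y s" "arr Y W t" "h = s \<cdot> t" using v by (auto simp: via_def)
    obtain g where g: "arr Y A g" "t = g \<cdot> p" using facD[OF Y(1,3)] by blast
    hence "h = (s \<cdot> g) \<cdot> p" using Y assoc[OF Y(2) g(1) p] by simp
    thus ?thesis using Y g by blast
  qed
  have "right_approximation T (exch i) A W p"
  proof (rule right_approximation_local[OF subX A p])
    fix Z h assume Z: "local_end T Z" "Z \<in> exch i" and h: "arr Z W h"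
    consider "Z \<in> D0" | k where "iso T Z (N k (Xs i))" using exch_local[OF i' Z(1)] Z(2) by blast
    thus "\<exists>g. arr Z A g \<and> h = g \<cdot> p"
    proof cases
      case 1 thus ?thesis using facD h by blast
    next
      case 2
      let ?c = "isoclass T (N k (Xs i))"
      have No: "N k (Xs i) \<in> Obj T" using N_Obj[OF X_Obj[OF i']] .
      \<comment> \<open>Q is the chosen representative if its class was added to the approximation,
        and otherwise the translate itself.\<close>
      have "\<exists>Q. iso T Z Q \<and> (\<forall>h. arr Q W h \<longrightarrow> (\<exists>g. arr Q A g \<and> h = g \<cdot> p))"
      proof (cases "?c \<in> nonvia i W")
        case True
        have "iso T (N k (Xs i)) (R ?c)" using L[OF True] isoclass_eq[OF No] by (simp add: R_def)
        hence "iso T Z (R ?c)" using 2 iso_trans by blast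
        moreover have "\<exists>g. arr (R ?c) A g \<and> h = g \<cdot> p" if h: "arr (R ?c) W h" for h
          by (rule factor_span[OF B(2) Ro p _ h]) (use dom True in blast)
        ultimately show ?thesis by blast
      next
        case False
        hence "via (N k (Xs i)) W h" if "arr (N k (Xs i)) W h" for h using that by (auto simp: nonvia_def)
        thus ?thesis using facV 2 by blast
      qed
      then obtain Q where Q: "iso T Z Q" and fQ: "\<And>h. arr Q W h \<Longrightarrow> \<exists>g. arr Q A g \<and> h = g \<cdot> p" by blast
      obtain s t where st: "arr Z Q s" "arr Q Z t" "s \<cdot> t = idm Z" using isoE[OF Q] by metis
      obtain g where g: "arr Q A g" "t \<cdot> h = g \<cdot> p" using fQ[OF arr_cmp[OF st(2) h]] by blast
      have "h = s \<cdot> (t \<cdot> h)" using assoc[OF st(1,2) h] st id_left[OF h] by simp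
      also have "\<dots> = (s \<cdot> g) \<cdot> p" using g assoc[OF st(1) g(1) p] by simp
      finally show ?thesis using st g by blast
    qed
  qed
  thus ?thesis by blast
qed

lemma exch_0: "exch 0 = C"
proof -
  have "serre_orbit T S n X \<subseteq> ind T C"
  proof
    fix c assume "c \<in> serre_orbit T S n X"
    then obtain l where "c = isoclass T (N l X)" by (auto simp: serre_orbit_def N_def)
    thus "c \<in> ind T C" using sub_ind[OF subC local_NX[of 0 l]] ct_N[OF C X0_C] by simp
  qed
  hence "exch_ind 0 = ind T C" by (auto simp: exch_ind_def F0_def)
  thus ?thesis using addcl_ind[OF subC] by (simp add: exch_def)
qed

lemma ct_exch: assumes i: "i < n" shows "ct (exch i)"
proof (cases "i = 0")
  case True thus ?thesis using exch_0 C by simp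
next
  case False
  hence i0: "0 < i" by simp
  show ?thesis
  proof (rule ctI[OF subX n1])
    show "N l Y \<in> exch i" if "Y \<in> exch i" for Y l using exch_N that i by simp
    show "\<exists>A p. right_approximation T (exch i) A Y p" if "Y \<in> Obj T" for Y using exch_approx[OF i0 i that] .
    show "Y \<in> exch i \<longleftrightarrow> (\<forall>j\<in>{1..<n}. \<forall>A\<in>exch i. hom0 A (sh j Y))" if Y: "Y \<in> Obj T" for Y
      using exch_rigid[OF i0 i] exch_maximal[OF i Y] by (auto simp: Suc_le_eq)
  qed
qed

lemma not_both:
  assumes D: "ct D" and im: "i < n" "m < n" "i \<noteq> m" and O: "N k (Xs i) \<in> D" "N l (Xs m) \<in> D"
  shows False
proof -
  have o: "Xs i \<in> Obj T" "Xs m \<in> Obj T" using X_Obj im by auto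
  have all: "N j (Xs p) \<in> D" if "N q (Xs p) \<in> D" "p < n" for j q p
  proof -
    have p: "Xs p \<in> Obj T" using X_Obj that by simp
    have "N (j - q) (N q (Xs p)) \<in> D" using ct_N[OF D that(1)] .
    thus ?thesis using sub_iso[OF ct_sub[OF D] _ iso_sym[OF N_add[OF p, of "j - q" q]]] by simp
  qed
  obtain j q where j: "0 < j" "j < n" "\<not> hom0 (N q (Xs i)) (sh j (Xs m))" using incompatible[OF im] by blast
  have "N q (Xs i) \<in> D" "N 0 (Xs m) \<in> D" using all O im by blast+
  thus False using ct_rigid[OF D _ _ j(1,2)] j(3) by auto
qed

lemma ct_containing:
  assumes D: "ct D" and F: "F0 \<subseteq> ind T D"
  shows "\<exists>i<n. D = exch i"
proof -
  note sub = ct_sub[OF D]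
  have D0D: "D0 \<subseteq> D"
  proof -
    have "D0 \<subseteq> addcl (ind T D)" using F unfolding D0_def addcl_def by blast
    thus ?thesis using addcl_ind[OF sub] by simp
  qed
  have cl: "A \<in> D0 \<or> (\<exists>m<n. \<exists>l. iso T A (N l (Xs m)))" if A: "local_end T A" "A \<in> D" for A
  proof (rule orth_classify[OF A(1)])
    show "orth A" unfolding orth_def using local_Obj[OF A(1)] ct_rigid[OF D _ A(2)] D0D by blast
  qed
  \<comment> \<open>Without any orbit D would lie in \<open>D0\<close>, so X would be orthogonal to
    D and belong to D by maximality.\<close>
  have "\<exists>i<n. \<exists>l. N l (Xs i) \<in> D"
  proof (rule ccontr)
    assume no: "\<not> ?thesis"
    have "D \<subseteq> D0"
    proof
      fix Y assume Y: "Y \<in> D"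
      show "Y \<in> D0"
      proof (rule sub_local[OF subD sub_Obj[OF sub Y]])
        fix A assume A: "local_end T A" "retract A Y"
        have "A \<in> D" using sub_retract[OF sub Y A(2)] .
        thus "A \<in> D0" using cl[OF A(1)] no sub_iso[OF sub] by blast
      qed
    qed
    hence "hom0 A (sh j X)" if "A \<in> D" "0 < j" "j < n" for A j using ct_rigid[OF C _ X0_C] that D0_C by blast
    hence "X \<in> D" using ct_mem[OF D X_O] by auto
    hence "N 0 (Xs 0) \<in> D" by simp
    thus False using no n1 by (metis less_le_trans zero_less_one)
  qed
  then obtain i l where i: "i < n" and l: "N l (Xs i) \<in> D" by blast
  have o: "Xs i \<in> Obj T" using X_Obj i by simp
  have all: "N j (Xs i) \<in> D" for j
    using ct_N[OF D l, of "j - l"] sub_iso[OF sub _ iso_sym[OF N_add[OF o, of "j - l" l]]] by simp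
  have "A \<in> D \<longleftrightarrow> A \<in> exch i" if A: "local_end T A" for A
  proof -
    have "A \<in> D \<longleftrightarrow> A \<in> D0 \<or> (\<exists>k. iso T A (N k (Xs i)))"
    proof
      assume AD: "A \<in> D"
      show "A \<in> D0 \<or> (\<exists>k. iso T A (N k (Xs i)))"
        using cl[OF A AD] not_both[OF D i _ _ l] sub_iso[OF sub AD] by blast
    next
      assume "A \<in> D0 \<or> (\<exists>k. iso T A (N k (Xs i)))"
      thus "A \<in> D" using D0D all sub_iso[OF sub] iso_sym by blast
    qed
    thus ?thesis using exch_local[of i, OF _ A] i by simp
  qed
  hence "ind T D = ind T (exch i)"
    using ind_local_mem[OF sub] ind_local_mem[OF subX] by (intro set_eqI) metis
  hence "D = exch i" using addcl_ind[OF sub] addcl_ind[OF subX] by metis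
  thus ?thesis using i by blast
qed

lemma exch_inj: "inj_on exch {0..<n}"
proof (rule inj_onI, rule ccontr)
  fix i m assume im: "i \<in> {0..<n}" "m \<in> {0..<n}" "exch i = exch m" "i \<noteq> m"
  have "N 0 (Xs i) \<in> exch i" "N 0 (Xs m) \<in> exch i" using NX_exch[of i 0] NX_exch[of m 0] im by auto
  thus False using not_both[OF ct_exch[of i] _ _ im(4), of 0 0] im by simp
qed

lemma orbit_disjoint:
  assumes "i < n" shows "F0 \<inter> serre_orbit T S n (Xs i) = {}"
proof (cases "i = 0")
  case True thus ?thesis by (auto simp: F0_def)
next
  case False
  show ?thesis
  proof (rule ccontr)
    assume "\<not> ?thesis"
    then obtain l where "isoclass T (N l (Xs i)) \<in> F0" by (auto simp: serre_orbit_def N_def)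
    hence "N l (Xs i) \<in> C" using sub_ind[OF subC local_NX] assms by (simp add: F0_def)
    moreover have "N 0 (Xs 0) \<in> C" using X0_C by simp
    ultimately show False using not_both[OF C _ assms] n1 False by (metis less_le_trans zero_less_one)
  qed
qed

end

section \<open>Uniqueness of Auslander-Reiten angles\<close>

context ar_angle
begin

text \<open>\<open>is_mutation\<close> admits any AR angle of X, so the definite description in
  \<open>mutation\<close> rests on this. An isomorphism of the X_i lifts to the C_i by
  factorisation, is invertible there by minimality, and extends to the X_{i+1} by the five
  lemma.\<close>

lemma angle_unique:
  assumes AR': "AR_angle T n C X Xs' Cs' a' b'"
  shows "i \<le> n \<Longrightarrow> iso T (Xs i) (Xs' i)"
proof -
  interpret B: ar_angle T S n C X Xs' Cs' a' b' by unfold_locales (rule n1 C local_X AR')+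
  show "i \<le> n \<Longrightarrow> iso T (Xs i) (Xs' i)"
  proof (induct i)
    case 0 show ?case using iso_refl[OF C_Obj[OF X0_C]] by simp
  next
    case (Suc i)
    hence i: "i < n" by simp
    obtain h h' where h: "arr (Xs i) (Xs' i) h" "arr (Xs' i) (Xs i) h'" "h \<cdot> h' = idm (Xs i)" "h' \<cdot> h = idm (Xs' i)"
      using Suc isoE by (metis Suc_leD)
    have r: "rad (Cs i) X (a i \<cdot> h)" if "i = 0" using rad_cmp_right[OF a0_rad] h that by auto
    obtain c where c: "arr (Cs i) (Cs' i) c" "a i \<cdot> h = c \<cdot> a' i"
      using B.a_factor[OF i Cs_C[OF i] arr_cmp[OF a_arr[OF i] h(1)] r] by blast
    have r': "rad (Cs' i) X (a' i \<cdot> h')" if "i = 0" using rad_cmp_right[OF B.a0_rad] h that by auto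
    obtain c' where c': "arr (Cs' i) (Cs i) c'" "a' i \<cdot> h' = c' \<cdot> a i"
      using a_factor[OF i B.Cs_C[OF i] arr_cmp[OF B.a_arr[OF i] h(2)] r'] by blast
    have ic: "inv_arr (Cs i) (Cs' i) c"
      by (rule right_minimal_iso[OF a_minimal[OF i] B.a_minimal[OF i] a_arr[OF i] B.a_arr[OF i]
            c(1) c'(1) h c(2) c'(2)])
    have ih: "inv_arr (Xs i) (Xs' i) h" using h by (auto simp: inv_arr_def)
    \<comment> \<open>The triangles are rotated so that the two known components, on C_i and X_i,
      come first; the third then lives on X_{i+1}[1].\<close>
    obtain k where k: "arr (\<Sigma> (Xs (Suc i))) (\<Sigma> (Xs' (Suc i))) k" "d i \<cdot> k = h \<cdot> B.d i"
      "- \<Sigma>m (b (Suc i)) \<cdot> \<Sigma>m c = k \<cdot> - \<Sigma>m (b' (Suc i))"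
      using Tri_mor[OF Tri_rot[OF tri[OF i]] Tri_rot[OF B.tri[OF i]] c(1) h(1) c(2)] by blast
    have "inv_arr (\<Sigma> (Xs (Suc i))) (\<Sigma> (Xs' (Suc i))) k"
      by (rule five3[OF Tri_rot[OF tri[OF i]] Tri_rot[OF B.tri[OF i]] ic ih k(1) c(2) k(2,3)])
    hence "iso T (\<Sigma> (Xs (Suc i))) (\<Sigma> (Xs' (Suc i)))" unfolding iso_iff by blast
    thus ?case using eqv_iso_iff[OF eqvS X_Obj B.X_Obj] Suc(2) by simp
  qed
qed

end

section \<open>Identification and counting of the mutations\<close>

context ar_noloops
begin

lemma is_mutation_iff:
  assumes i: "i < n"
  shows "is_mutation T S n C X i D \<longleftrightarrow> D = exch i"
proof
  assume D: "D = exch i"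
  show "is_mutation T S n C X i D"
    using D subX AR orbit_disjoint[OF i] ind_exch[of i] i unfolding is_mutation_def exch_ind_def F0_def by auto
next
  assume "is_mutation T S n C X i D"
  then obtain Xs' Cs' a' b' where sub: "subcategory T D" and ar: "AR_angle T n C X Xs' Cs' a' b'"
    and ind: "ind T D = F0 \<union> serre_orbit T S n (Xs' i)" unfolding is_mutation_def F0_def by blast
  have Xi: "iso T (Xs i) (Xs' i)" using angle_unique[OF ar] i by simp
  have "isoclass T (N l (Xs i)) = isoclass T (N l (Xs' i))" for l
    using isoclass_eq[OF N_Obj[OF X_Obj[of i]]] N_iso[OF Xi] i by simp
  hence "serre_orbit T S n (Xs i) = serre_orbit T S n (Xs' i)" by (simp add: serre_orbit_def N_def)
  hence "ind T D = exch_ind i" using ind by (simp add: exch_ind_def)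
  thus "D = exch i" using addcl_ind[OF sub] by (simp add: exch_def)
qed

lemma mutation_eq: "i < n \<Longrightarrow> mutation T S n C X i = exch i"
  unfolding mutation_def by (rule the_equality) (simp_all add: is_mutation_iff)

lemma ct_containing_eq: "{D. ct D \<and> F0 \<subseteq> ind T D} = mutation T S n C X ` {0..<n}"
proof -
  have "F0 \<subseteq> ind T (exch i)" if "i < n" for i using ind_exch[of i] that by (simp add: exch_ind_def)
  hence "{D. ct D \<and> F0 \<subseteq> ind T D} = exch ` {0..<n}" using ct_containing ct_exch by fastforce
  also have "\<dots> = mutation T S n C X ` {0..<n}" using mutation_eq by (auto intro!: image_cong)
  finally show ?thesis .
qed

lemma card_mutations: "card (mutation T S n C X ` {0..<n}) = n"
proof -
  have "mutation T S n C X ` {0..<n} = exch ` {0..<n}" using mutation_eq by (auto intro!: image_cong)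
  thus ?thesis using card_image[OF exch_inj] by simp
qed

end

section \<open>From the stated no-loop condition to one on summands\<close>

context serre_category
begin

lemma no_loopsD:
  assumes C: "ct C" and nl: "no_loops T S n C X"
  obtains Xs Cs a b where "AR_angle T n C X Xs Cs a b" "\<And>i l. i < n \<Longrightarrow> \<not> retract (N l X) (Cs i)"
proof -
  from nl obtain Xs Cs a b where AR: "AR_angle T n C X Xs Cs a b"
    and no: "\<And>B l. direct_sum T (map Cs [0..<n]) B \<Longrightarrow> N l X \<notin> add T B"
    unfolding no_loops_def N_def by blast
  have o: "set (map Cs [0..<n]) \<subseteq> Obj T" using AR sub_Obj[OF ct_sub[OF C]] by (auto simp: AR_angle_def)
  \<comment> \<open>The no-loop condition quantifies over all direct sums of the C_i, so one has to
    exist for it to apply.\<close>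
  obtain B where B: "direct_sum T (map Cs [0..<n]) B" using ex_direct_sum[OF o] by blast
  have "\<not> retract (N l X) (Cs i)" if i: "i < n" for i l
  proof
    assume r: "retract (N l X) (Cs i)"
    have "retract (Cs i) B" by (rule ds_retract[OF B]) (use i in auto)
    hence "retract (N l X) B" using r retract_trans by blast
    hence "N l X \<in> add T B" using sub_retract by (auto simp: add_def)
    thus False using no[OF B] by blast
  qed
  thus thesis using that[OF AR] by blast
qed

end

theorem theorem5p8:
  fixes T :: "('k::field, 'o, 'm::ab_group_add) tricat"
    and S :: "('o, 'm) endofunctor" and n :: nat and C :: "'o set" and X :: 'o
  assumes "triangulated_category T"
    and "serre_functor T S"
    and "n \<ge> 1"
    and "n_cluster_tilting T n C"
    and "X \<in> C" and "indecomposable T X"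
    and "no_loops T S n C X"
  shows "{D. n_cluster_tilting T n D \<and> ind T C - serre_orbit T S n X \<subseteq> ind T D}
           = mutation T S n C X ` {0..<n}
       \<and> card {D. n_cluster_tilting T n D \<and> ind T C - serre_orbit T S n X \<subseteq> ind T D} = n"
proof -
  interpret triangulated_category T by (rule assms(1))
  interpret serre_category T S n by unfold_locales (rule assms(2))
  have C: "ct C" using assms(4) by (simp add: ct_def)
  obtain Xs Cs a b where AR: "AR_angle T n C X Xs Cs a b" and nl: "\<And>i l. i < n \<Longrightarrow> \<not> retract (N l X) (Cs i)"
    using no_loopsD[OF C assms(7)] by blast
  interpret ar_noloops T S n C X Xs Cs a b
    by unfold_locales (use assms(3,6) C AR nl indecomposable_iff_local in auto)
  show ?thesis using ct_containing_eq card_mutations by (simp add: ct_def F0_def)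
qed

end
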